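(* Let $F=\mathbb F_q(\mathcal X)$ be the function field of the Kummer curve $y^m=f(x)$ with $f$ separable of degree $n$, with the places $Q_0,Q_1,\dots,Q_n$ and $R_1,\dots,R_N$, as described in the context. Let $D=\sum_{k=1}^NR_k$ and let $$E_1=\sum_{k=1}^n\alpha_kQ_k\quad\text{and}\quad E_2=\sum_{k=0}^{n-1}\beta_kQ_k$$ (with $\alpha_k,\beta_k\in\mathbb Z$) be two non-special divisors of degree $g-1$. Suppose that $s$ is an integer satisfying (i) $\alpha_k-\beta_k\le s$ for $1\le k\le n-1$, (ii) $\alpha_n\le s\le(\beta_0+N)/n$, and (iii) $\frac{g-1+\beta_0-\alpha_n}{n-1}<s<\frac{N-g+1+\beta_0-\alpha_n}{n-1}$. Consider the divisors $$G=\sum_{k=1}^{n-1}\alpha_kQ_k+sQ_n+(\beta_0+N-sn)Q_0\quad\text{and}\quad H=\sum_{k=1}^{n-1}(s+\beta_k)Q_k+\alpha_nQ_n.$$ Then $(C_{\mathcal L}(D,G),C_{\mathcal L}(D,H))$ is a linear complementary pair of algebraic geometry codes with parameters (length and dimension) $$[N,\,N-s(n-1)-(\alpha_n-\beta_0)]\quad\text{and}\quad[N,\,s(n-1)+\alpha_n-\beta_0],$$ respectively.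
   Context: Let $\mathbb F_q$ be the finite field with $q$ elements, $m,n\ge2$ integers with $\operatorname{char}(\mathbb F_q)\nmid m$ and $\gcd(m,n)=1$, and $a_1,\dots,a_n\in\mathbb F_q$ pairwise distinct. Let $\mathcal X$ be the curve over $\mathbb F_q$ defined by $y^m=f(x)=\prod_{k=1}^n(x-a_k)$, with function field $F=\mathbb F_q(\mathcal X)=\mathbb F_q(x,y)$ of genus $g\ge1$. Let $Q_0$ be the only place at infinity of $F$ and let $Q_k$ be the (unique, totally ramified) place of $F$ over the place of $\mathbb F_q(x)$ corresponding to $a_k$, $1\le k\le n$. Let $P_1,\dots,P_t$ be pairwise distinct rational places of $\mathbb F_q(x)$ that split completely in $F/\mathbb F_q(x)$, and let $R_1,\dots,R_N$ be all the $N=mt$ rational places of $F$ lying over $P_1,\dots,P_t$. A divisor $A$ of $F$ is non-special if $\ell(A)=\deg(A)+1-g$, where $\ell(A)=\dim_{\mathbb F_q}\mathcal L(A)$. If $D$ is a sum of $M$ distinct rational places $S_1,\dots,S_M$ and $A$ is a divisor with support disjoint from that of $D$, then $C_{\mathcal L}(D,A)=\{(z(S_1),\dots,z(S_M)):z\in\mathcal L(A)\}\subseteq\mathbb F_q^M$. A pair $(\mathcal C_1,\mathcal C_2)$ of linear codes in $\mathbb F_q^M$ is a linear complementary pair (LCP) if $\mathcal C_1\oplus\mathcal C_2=\mathbb F_q^M$. An $[M,k]$ code is a linear code of length $M$ and dimension $k$. *)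

theory Defs
  imports
    "HOL-Analysis.Analysis"
    "HOL-Computational_Algebra.Computational_Algebra"
    "HOL-Library.Poly_Mapping"
begin

section \<open>Fields over a constant field\<close>

text \<open>
  A field extension is a field type together with an embedding of the base field; in what
  follows \<open>\<iota> :: 'k \<Rightarrow> 'f\<close> is the embedding of the constant field \<open>'k\<close> into the function field
  \<open>'f\<close>. The rational function field in one variable is the type \<open>'k poly fract\<close>.
\<close>

definition field_embedding :: "('a::field \<Rightarrow> 'b::field) \<Rightarrow> bool" where
  "field_embedding h \<longleftrightarrow>
     h 1 = 1 \<and> (\<forall>a b. h (a + b) = h a + h b) \<and> (\<forall>a b. h (a * b) = h a * h b)"

definition scale_by :: "('a::field \<Rightarrow> 'b::field) \<Rightarrow> 'a \<Rightarrow> 'b \<Rightarrow> 'b" where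
  "scale_by h c z = h c * z"

definition extension_degree :: "('a::field \<Rightarrow> 'b::field) \<Rightarrow> nat" where
  "extension_degree h = vector_space.dim (scale_by h) (UNIV :: 'b set)"

definition is_subfield :: "'a::field set \<Rightarrow> bool" where
  "is_subfield S \<longleftrightarrow>
     1 \<in> S \<and> (\<forall>a\<in>S. \<forall>b\<in>S. a - b \<in> S \<and> a * b \<in> S) \<and> (\<forall>a\<in>S. inverse a \<in> S)"

definition adjoin :: "'a::field set \<Rightarrow> 'a \<Rightarrow> 'a set" where
  "adjoin L y = \<Inter>{S. is_subfield S \<and> L \<subseteq> S \<and> y \<in> S}"

definition rat_const :: "'k::field \<Rightarrow> 'k poly fract" where
  "rat_const c = Fract [:c:] 1"


section \<open>Places and valuations\<close>

definition valuation_ring :: "('k::field \<Rightarrow> 'f::field) \<Rightarrow> 'f set \<Rightarrow> bool" where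
  "valuation_ring \<iota> V \<longleftrightarrow>
     range \<iota> \<subset> V \<and> V \<subset> UNIV \<and>
     (\<forall>a\<in>V. \<forall>b\<in>V. a - b \<in> V \<and> a * b \<in> V) \<and>
     (\<forall>z. z \<in> V \<or> inverse z \<in> V)"

text \<open>A place is the maximal ideal of a valuation ring, i.e. its set of non-units.\<close>

definition places :: "('k::field \<Rightarrow> 'f::field) \<Rightarrow> 'f set set" where
  "places \<iota> = {{z \<in> V. z = 0 \<or> inverse z \<notin> V} | V. valuation_ring \<iota> V}"

text \<open>The valuation ring is recovered from its place. Note that \<open>inverse 0 = 0\<close> lies in \<open>P\<close>.\<close>

definition place_ring :: "'f::field set \<Rightarrow> 'f set" where
  "place_ring P = {z. z = 0 \<or> inverse z \<notin> P}"

text \<open>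
  The normalised discrete valuation \<open>v\<^sub>P\<close>: \<open>z = t\<^sup>k u\<close> with \<open>t\<close> a generator of \<open>P\<close> and \<open>u\<close> a unit.
  It is only meaningful for \<open>z \<noteq> 0\<close>, and there is no value \<open>\<infinity>\<close> at \<open>0\<close>.
\<close>

definition place_val :: "'f::field set \<Rightarrow> 'f \<Rightarrow> int" where
  "place_val P z =
     (THE k. \<exists>t u. P = {t * w | w. w \<in> place_ring P} \<and>
                   u \<noteq> 0 \<and> u \<in> place_ring P \<and> inverse u \<in> place_ring P \<and>
                   z = t powi k * u)"

text \<open>
  \<open>B\<close> is mapped injectively onto a basis of the residue field \<open>place_ring P / P\<close> over the
  constant field: every residue class is a unique linear combination of classes of \<open>B\<close>.
\<close>

definition residue_basis :: "('k::field \<Rightarrow> 'f::field) \<Rightarrow> 'f set \<Rightarrow> 'f set \<Rightarrow> bool" where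
  "residue_basis \<iota> P B \<longleftrightarrow>
     finite B \<and> B \<subseteq> place_ring P \<and>
     (\<forall>z\<in>place_ring P. \<exists>!c. c \<in> B \<rightarrow>\<^sub>E (UNIV :: 'k set) \<and> z - (\<Sum>b\<in>B. \<iota> (c b) * b) \<in> P)"

definition place_degree :: "('k::field \<Rightarrow> 'f::field) \<Rightarrow> 'f set \<Rightarrow> nat" where
  "place_degree \<iota> P = (THE d. \<exists>B. residue_basis \<iota> P B \<and> card B = d)"

definition rational_places :: "('k::field \<Rightarrow> 'f::field) \<Rightarrow> 'f set set" where
  "rational_places \<iota> = {P \<in> places \<iota>. place_degree \<iota> P = 1}"

text \<open>The residue class of \<open>z\<close> at a rational place, as an element of the constant field.\<close>

definition place_eval :: "('k::field \<Rightarrow> 'f::field) \<Rightarrow> 'f set \<Rightarrow> 'f \<Rightarrow> 'k" where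
  "place_eval \<iota> P z = (THE c. z - \<iota> c \<in> P)"

definition lies_over :: "('a::field \<Rightarrow> 'b::field) \<Rightarrow> 'b set \<Rightarrow> 'a set \<Rightarrow> bool" where
  "lies_over h P' P \<longleftrightarrow> h ` P \<subseteq> P'"

text \<open>
  For an extension \<open>\<kappa>\<close> of the rational function field. The extension is meant to be finite.
\<close>

definition splits_completely ::
  "('k::field poly fract \<Rightarrow> 'f::field) \<Rightarrow> 'k poly fract set \<Rightarrow> bool" where
  "splits_completely \<kappa> P \<longleftrightarrow>
     card {P' \<in> places (\<kappa> \<circ> rat_const). lies_over \<kappa> P' P} = extension_degree \<kappa>"

definition rat_place :: "'k::field \<Rightarrow> 'k poly fract set" where
  "rat_place a = {Fract p q | p q. poly p a = 0 \<and> poly q a \<noteq> 0}"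

definition rat_place_infinity :: "'k::field poly fract set" where
  "rat_place_infinity = {Fract p q | p q. q \<noteq> 0 \<and> (p = 0 \<or> degree p < degree q)}"


section \<open>Divisors, Riemann-Roch spaces and the genus\<close>

text \<open>
  Divisors are elements of the free abelian group on the places, i.e. finitely supported
  functions \<open>'f set \<Rightarrow>\<^sub>0 int\<close> whose support consists of places.
\<close>

definition divisors :: "('k::field \<Rightarrow> 'f::field) \<Rightarrow> ('f set \<Rightarrow>\<^sub>0 int) set" where
  "divisors \<iota> = {A. Poly_Mapping.keys A \<subseteq> places \<iota>}"

definition divisor_degree :: "('k::field \<Rightarrow> 'f::field) \<Rightarrow> ('f set \<Rightarrow>\<^sub>0 int) \<Rightarrow> int" where
  "divisor_degree \<iota> A =
     (\<Sum>P\<in>Poly_Mapping.keys A. Poly_Mapping.lookup A P * int (place_degree \<iota> P))"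

definition riemann_roch_space :: "('k::field \<Rightarrow> 'f::field) \<Rightarrow> ('f set \<Rightarrow>\<^sub>0 int) \<Rightarrow> 'f set" where
  "riemann_roch_space \<iota> A =
     {z. z = 0 \<or> (\<forall>P\<in>places \<iota>. place_val P z \<ge> - Poly_Mapping.lookup A P)}"

definition ell :: "('k::field \<Rightarrow> 'f::field) \<Rightarrow> ('f set \<Rightarrow>\<^sub>0 int) \<Rightarrow> nat" where
  "ell \<iota> A = vector_space.dim (scale_by \<iota>) (riemann_roch_space \<iota> A)"

definition genus :: "('k::field \<Rightarrow> 'f::field) \<Rightarrow> int" where
  "genus \<iota> = (GREATEST d. \<exists>A\<in>divisors \<iota>. d = divisor_degree \<iota> A - int (ell \<iota> A) + 1)"

definition nonspecial :: "('k::field \<Rightarrow> 'f::field) \<Rightarrow> ('f set \<Rightarrow>\<^sub>0 int) \<Rightarrow> bool" where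
  "nonspecial \<iota> A \<longleftrightarrow>
     A \<in> divisors \<iota> \<and> int (ell \<iota> A) = divisor_degree \<iota> A + 1 - genus \<iota>"


section \<open>Codes\<close>

definition linear_code :: "('k::field ^ 'i::finite) set \<Rightarrow> nat \<Rightarrow> int \<Rightarrow> bool" where
  "linear_code C M k \<longleftrightarrow> vec.subspace C \<and> CARD('i) = M \<and> int (vec.dim C) = k"

definition linear_complementary_pair ::
  "('k::field ^ 'i::finite) set \<Rightarrow> ('k ^ 'i) set \<Rightarrow> bool" where
  "linear_complementary_pair C\<^sub>1 C\<^sub>2 \<longleftrightarrow>
     vec.subspace C\<^sub>1 \<and> vec.subspace C\<^sub>2 \<and>
     C\<^sub>1 \<inter> C\<^sub>2 = {0} \<and> {c + d | c d. c \<in> C\<^sub>1 \<and> d \<in> C\<^sub>2} = UNIV"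

text \<open>
  The code of the divisors \<open>D = (\<Sum>i\<in>UNIV. S i)\<close> and \<open>A\<close>. The first divisor is given by the
  enumeration \<open>S\<close> of its places, which also fixes the order of the coordinates.
\<close>

definition ag_code ::
  "('k::field \<Rightarrow> 'f::field) \<Rightarrow> ('i::finite \<Rightarrow> 'f set) \<Rightarrow> ('f set \<Rightarrow>\<^sub>0 int) \<Rightarrow> ('k ^ 'i) set" where
  "ag_code \<iota> S A = {\<chi> i. place_eval \<iota> (S i) z | z. z \<in> riemann_roch_space \<iota> A}"


section \<open>The Kummer function field\<close>

text \<open>
  \<open>\<kappa>\<close> makes \<open>'f\<close> an extension of the rational function field that is generated by an element
  \<open>y\<close> with \<open>y\<^sup>m = f(x)\<close>, where \<open>x\<close> is the image of the variable.
\<close>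

definition kummer_function_field ::
  "('k::field poly fract \<Rightarrow> 'f::field) \<Rightarrow> 'f \<Rightarrow> nat \<Rightarrow> 'k poly \<Rightarrow> bool" where
  "kummer_function_field \<kappa> y m f \<longleftrightarrow>
     field_embedding \<kappa> \<and> y ^ m = \<kappa> (Fract f 1) \<and> adjoin (range \<kappa>) y = UNIV"

end

theory Submission
  imports Defs
begin

text \<open>
  Let \<open>h\<close> be the product of the functions \<open>x - b\<close>, where \<open>b\<close> runs over the points of the line below
  the evaluation places. The divisor of \<open>y\<close> is \<open>Q\<^sub>1 + \<dots> + Q\<^sub>n - n Q\<^sub>0\<close> and that of \<open>h\<close> is
  \<open>D - N Q\<^sub>0\<close>. If \<open>z \<in> L(G)\<close> and \<open>w \<in> L(H)\<close> have the same values at all evaluation places, then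
  \<open>(z - w) y\<^sup>s / h\<close> lies in \<open>L(E\<^sub>2)\<close>, which is zero because \<open>E\<^sub>2\<close> is non-special of degree \<open>g - 1\<close>.
  So \<open>z = w\<close> lies in both spaces, hence in \<open>L(E\<^sub>1) = 0\<close>. Therefore evaluation is injective on
  \<open>L(G)\<close> and on \<open>L(H)\<close>, and the two codes meet only in zero. In the other direction Riemann's
  inequality \<open>\<ell>(A) \<ge> deg A + 1 - g\<close> bounds the two dimensions from below by numbers with sum \<open>N\<close>.
  Hence both bounds are attained and the codes together fill the whole space
  (\<open>lcp_of_trivial_agreement\<close>).

  What remains is to develop, for places that are defined as arbitrary valuation rings and for a genus
  that is defined as a maximum, the facts used here: places are discrete, residue fields are finite,
  Riemann-Roch spaces are finite-dimensional, the genus is attained, and the divisors of \<open>y\<close> and \<open>h\<close>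
  are as stated. Since the constant field is finite, all dimensions are measured by cardinalities, and
  almost everything rests on one counting argument, \<open>card_le_of_independent_mod\<close>: if \<open>W\<close> is a finite
  subgroup of a \<open>z\<close>-stable group \<open>\<Lambda>\<close> and meets \<open>z \<Lambda>\<close> only in zero, where \<open>z\<close> is a quotient of
  polynomials in \<open>x\<close> of degree at most \<open>e\<close>, then \<open>W\<close> has at most \<open>q\<^bsup>m e\<^esup>\<close> elements, because the sums
  \<open>w\<^sub>0 + z w\<^sub>1 + \<dots> + z\<^sup>T w\<^sub>T\<close> are distinct and have bounded degree. Taking for \<open>\<Lambda>\<close> a valuation ring
  shows that a place is discrete (\<open>place_principal\<close>, \<open>decompose_ring\<close>) and has a finite residue field
  (\<open>ex_residue_basis\<close>); taking for \<open>\<Lambda>\<close> the functions that are regular at several places gives the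
  bound \<open>m e\<close> for the number of zeros of \<open>z\<close>, counted with multiplicity and degree
  (\<open>sum_zeros_le_height\<close>).

  For the Kummer extension this bound and the coprimality of \<open>m\<close> and \<open>n\<close> force total ramification at
  infinity and at the \<open>a\<^sub>k\<close> (\<open>totally_ramified\<close>). Functions with a zero have a pole, by Zorn's lemma
  (\<open>exists_place_with_pole\<close>), so \<open>L(- Q\<^sub>0) = 0\<close> and every Riemann-Roch space is finite. The elements
  \<open>u\<^sub>0(x) + u\<^sub>1(x) y + \<dots>\<close> show that \<open>L(c Q\<^sub>0)\<close> grows like \<open>c\<close>; every divisor lies below one
  that is equivalent to some \<open>c Q\<^sub>0\<close>, and Riemann's inequality follows (\<open>finite_and_bounded\<close>,
  \<open>riemann_inequality\<close>).
\<close>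

section \<open>Counting over a finite field\<close>

lemma card_finite_subspace:
  fixes sc :: "'k::{field,finite} \<Rightarrow> 'v::ab_group_add \<Rightarrow> 'v"
  assumes "vector_space sc" and sub: "module.subspace sc V" and fin: "finite V"
  shows "card V = CARD('k) ^ vector_space.dim sc V"
proof -
  interpret vector_space sc by fact
  obtain B where B: "B \<subseteq> V" "independent B" "V \<subseteq> span B" "card B = dim V"
    using basis_exists by blast
  have finB: "finite B" using B(1) fin finite_subset by blast
  have spanB: "span B = V" using B(1,3) sub span_minimal by blast
  define F where "F c = (\<Sum>b\<in>B. sc (c b) b)" for c
  have "inj_on F (B \<rightarrow>\<^sub>E UNIV)"
  proof (rule inj_onI)
    fix c d assume c: "c \<in> B \<rightarrow>\<^sub>E UNIV" and d: "d \<in> B \<rightarrow>\<^sub>E UNIV" and e: "F c = F d"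
    have "(\<Sum>b\<in>B. sc (c b - d b) b) = 0"
      using e by (simp add: F_def scale_left_diff_distrib sum_subtractf)
    then have "\<forall>b\<in>B. c b - d b = 0" using independentD[OF B(2) finB subset_refl, of "\<lambda>b. c b - d b"] by blast
    then show "c = d" using c d by (intro PiE_ext[OF c d]) auto
  qed
  moreover have "F ` (B \<rightarrow>\<^sub>E UNIV) = V"
  proof -
    have "F (restrict u B) = F u" for u unfolding F_def by (intro sum.cong) auto
    then have "range F \<subseteq> F ` (B \<rightarrow>\<^sub>E UNIV)"
      by (metis (no_types, lifting) UNIV_I image_eqI image_subsetI restrict_PiE_iff)
    moreover have "range F = V" using span_finite[OF finB] spanB unfolding F_def by blast
    ultimately show ?thesis by blast
  qed
  ultimately have "card V = card (B \<rightarrow>\<^sub>E (UNIV :: 'k set))" by (metis card_image)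
  then show ?thesis using card_PiE[OF finB, of "\<lambda>_. UNIV :: 'k set"] B(4) by simp
qed

text \<open>
  The fibres of \<open>\<phi>\<close> lie in cosets of \<open>K\<close>, so \<open>\<phi>\<close> separates the cosets. This replaces the
  comparison of dimensions of \<open>G / K\<close> and of the target by a comparison of cardinalities.
\<close>
lemma card_le_fibres:
  fixes G :: "'a::ab_group_add set"
  assumes "\<phi> ` G \<subseteq> S" "finite S" "finite K"
    and fib: "\<And>z w. z \<in> G \<Longrightarrow> w \<in> G \<Longrightarrow> \<phi> z = \<phi> w \<Longrightarrow> z - w \<in> K"
  shows "finite G \<and> card G \<le> card K * card S"
proof -
  define r where "r s = (SOME z. z \<in> G \<and> \<phi> z = s)" for s
  have r: "r (\<phi> z) \<in> G \<and> \<phi> (r (\<phi> z)) = \<phi> z" if "z \<in> G" for z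
    unfolding r_def using that by (rule_tac someI[of _ z]) auto
  let ?f = "\<lambda>z. (z - r (\<phi> z), \<phi> z)"
  have inj: "inj_on ?f G" by (rule inj_onI) auto
  have sub: "?f ` G \<subseteq> K \<times> S" using r fib assms(1) by auto
  have fin: "finite (K \<times> S)" using assms by blast
  have "finite G" using inj sub fin by (metis finite_imageD finite_subset)
  moreover have "card G \<le> card (K \<times> S)" using card_inj_on_le[OF inj sub fin] .
  ultimately show ?thesis by (simp add: card_cartesian_product)
qed

text \<open>
  Exponential growth absorbs the constant \<open>C\<close>. This is how an estimate for sums of \<open>T\<close> terms with an
  error term that does not depend on \<open>T\<close> turns into an exact one.
\<close>
lemma power_growth:
  fixes a b C :: nat
  assumes "\<And>T. a ^ T \<le> C * b ^ T" "b > 0"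
  shows "a \<le> b"
proof (rule ccontr)
  assume "\<not> a \<le> b"
  then have "real a / real b > 1" using assms(2) by simp
  then obtain T where T: "real C < (real a / real b) ^ T"
    using real_arch_pow[of "real a / real b" "real C"] by auto
  have "real (a ^ T) \<le> real (C * b ^ T)" unfolding of_nat_le_iff by (rule assms(1))
  then have "(real a / real b) ^ T \<le> real C"
    using assms(2) by (simp add: power_divide divide_le_eq)
  then show False using T by simp
qed

section \<open>Field embeddings and valuation rings\<close>

lemma field_embedding_1: "field_embedding h \<Longrightarrow> h 1 = 1"
  and field_embedding_add: "field_embedding h \<Longrightarrow> h (a + b) = h a + h b"
  and field_embedding_mult: "field_embedding h \<Longrightarrow> h (a * b) = h a * h b"
  by (simp_all add: field_embedding_def)

lemma field_embedding_0: "field_embedding h \<Longrightarrow> h 0 = 0"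
  using field_embedding_add[of h 0 0] add_left_imp_eq[of "h 0" "h 0" 0] by (metis add.right_neutral)

lemma field_embedding_diff: "field_embedding h \<Longrightarrow> h (a - b) = h a - h b"
  using field_embedding_add[of h "a - b" b] by simp

lemma field_embedding_minus: "field_embedding h \<Longrightarrow> h (- b) = - h b"
  using field_embedding_diff[of h 0 b] field_embedding_0[of h] by simp

lemma field_embedding_eq_0: "field_embedding h \<Longrightarrow> h a = 0 \<longleftrightarrow> a = 0"
  using field_embedding_mult[of h a "inverse a"] field_embedding_1[of h] field_embedding_0[of h]
  by (cases "a = 0") auto

lemma field_embedding_eq: "field_embedding h \<Longrightarrow> h a = h b \<longleftrightarrow> a = b"
  using field_embedding_diff[of h a b] field_embedding_eq_0[of h "a - b"] by auto

lemma field_embedding_inverse: "field_embedding h \<Longrightarrow> h (inverse a) = inverse (h a)"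
  using field_embedding_mult[of h a "inverse a"] field_embedding_1[of h] field_embedding_0[of h]
  by (cases "a = 0") (auto intro!: inverse_unique[symmetric])

lemma field_embedding_divide: "field_embedding h \<Longrightarrow> h (a / b) = h a / h b"
  by (simp add: divide_inverse field_embedding_inverse field_embedding_mult)

lemma field_embedding_power: "field_embedding h \<Longrightarrow> h (a ^ i) = h a ^ i"
  by (induction i) (simp_all add: field_embedding_1 field_embedding_mult)

lemma field_embedding_sum: "field_embedding h \<Longrightarrow> h (sum f S) = (\<Sum>i\<in>S. h (f i))"
  by (induction S rule: infinite_finite_induct)
    (simp_all add: field_embedding_0 field_embedding_add)

lemma field_embedding_prod: "field_embedding h \<Longrightarrow> h (prod f S) = (\<Prod>i\<in>S. h (f i))"
  by (induction S rule: infinite_finite_induct)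
    (simp_all add: field_embedding_1 field_embedding_mult)

lemmas field_embedding_simps = field_embedding_1 field_embedding_add field_embedding_mult
  field_embedding_0 field_embedding_diff field_embedding_minus field_embedding_eq_0
  field_embedding_eq field_embedding_inverse field_embedding_divide field_embedding_power
  field_embedding_sum field_embedding_prod

lemma vector_space_scale_by:
  "field_embedding h \<Longrightarrow> vector_space (scale_by h)"
  by unfold_locales (simp_all add: scale_by_def field_embedding_simps algebra_simps)

lemma field_embedding_rat_const: "field_embedding rat_const"
  unfolding field_embedding_def rat_const_def
  by (simp add: One_fract_def one_pCons) (metis mult.commute)

lemma field_embedding_comp:
  "field_embedding g \<Longrightarrow> field_embedding h \<Longrightarrow> field_embedding (g \<circ> h)"
  by (simp add: field_embedding_def)

lemma places_cases:
  assumes "P \<in> places \<iota>"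
  shows "valuation_ring \<iota> (place_ring P)"
    and "P = {z \<in> place_ring P. z = 0 \<or> inverse z \<notin> place_ring P}"
proof -
  obtain V where V: "valuation_ring \<iota> V" and P: "P = {z \<in> V. z = 0 \<or> inverse z \<notin> V}"
    using assms unfolding places_def by blast
  have d: "z \<in> V \<or> inverse z \<in> V" for z using V unfolding valuation_ring_def by blast
  have "0 \<in> V" using d[of 0] by simp
  then have "place_ring P = V" unfolding place_ring_def P using d by auto
  then show "valuation_ring \<iota> (place_ring P)"
    and "P = {z \<in> place_ring P. z = 0 \<or> inverse z \<notin> place_ring P}" using V P by auto
qed

lemma placesI:
  assumes "valuation_ring \<iota> V"
  shows "\<exists>P\<in>places \<iota>. place_ring P = V"
proof -
  let ?P = "{z \<in> V. z = 0 \<or> inverse z \<notin> V}"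
  have P: "?P \<in> places \<iota>" using assms unfolding places_def by blast
  have d: "z \<in> V \<or> inverse z \<in> V" for z using assms unfolding valuation_ring_def by blast
  have "0 \<in> V" using d[of 0] by simp
  then have "place_ring ?P = V" unfolding place_ring_def using d by auto
  then show ?thesis using P by blast
qed

locale place =
  fixes \<iota> :: "'k::field \<Rightarrow> 'f::field" and P :: "'f set"
  assumes emb: "field_embedding \<iota>" and P: "P \<in> places \<iota>"
begin

abbreviation V where "V \<equiv> place_ring P"

lemma ring_diff: "a \<in> V \<Longrightarrow> b \<in> V \<Longrightarrow> a - b \<in> V"
  and ring_mult: "a \<in> V \<Longrightarrow> b \<in> V \<Longrightarrow> a * b \<in> V"
  and ring_cases: "a \<in> V \<or> inverse a \<in> V"
  and const_in_ring: "\<iota> c \<in> V"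
  and ring_proper: "V \<noteq> UNIV"
  using places_cases(1)[OF P] unfolding valuation_ring_def by auto

lemma place_iff: "z \<in> P \<longleftrightarrow> z \<in> V \<and> (z = 0 \<or> inverse z \<notin> V)"
  using places_cases(2)[OF P] by blast

lemma ring_0: "0 \<in> V" and ring_1: "1 \<in> V"
  using const_in_ring[of 0] const_in_ring[of 1] by (simp_all add: field_embedding_simps[OF emb])

lemma ring_minus: "a \<in> V \<Longrightarrow> - a \<in> V" using ring_diff[OF ring_0] by simp
lemma ring_add: "a \<in> V \<Longrightarrow> b \<in> V \<Longrightarrow> a + b \<in> V"
  using ring_diff[of a "- b"] ring_minus by simp
lemma ring_sum: "(\<And>i. i \<in> S \<Longrightarrow> f i \<in> V) \<Longrightarrow> sum f S \<in> V"
  by (induction S rule: infinite_finite_induct) (auto intro: ring_0 ring_add)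
lemma ring_power: "a \<in> V \<Longrightarrow> a ^ i \<in> V"
  by (induction i) (auto intro: ring_1 ring_mult)

lemma place_subset: "z \<in> P \<Longrightarrow> z \<in> V" using place_iff by blast
lemma place_0: "0 \<in> P" using place_iff ring_0 by blast
lemma one_notin_place: "1 \<notin> P" using place_iff ring_1 by auto

lemma not_ring_inverse: "z \<notin> V \<Longrightarrow> inverse z \<in> P"
  using place_iff ring_cases ring_0 by (metis inverse_inverse_eq inverse_zero)

lemma place_not_ring: "z \<noteq> 0 \<Longrightarrow> z \<in> P \<longleftrightarrow> inverse z \<notin> V"
  using place_iff ring_cases by blast

lemma place_mult: "a \<in> P \<Longrightarrow> b \<in> V \<Longrightarrow> a * b \<in> P"
proof -
  assume a: "a \<in> P" and b: "b \<in> V"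
  show "a * b \<in> P"
  proof (cases "a = 0 \<or> b = 0")
    case True then show ?thesis using place_0 by auto
  next
    case False
    then have "inverse a = b * inverse (a * b)" by (simp add: field_simps)
    then show ?thesis using a b False place_iff ring_mult by (metis mult_eq_0_iff)
  qed
qed

lemma place_mult': "a \<in> V \<Longrightarrow> b \<in> P \<Longrightarrow> a * b \<in> P"
  by (metis place_mult mult.commute)

lemma place_add: "a \<in> P \<Longrightarrow> b \<in> P \<Longrightarrow> a + b \<in> P"
proof -
  have aux: "a + b \<in> P" if a: "a \<in> P" "b \<in> P" "b \<noteq> 0" "a / b \<in> V" for a b
  proof -
    have "a + b = b * (a / b + 1)" using that by (simp add: field_simps)
    then show ?thesis using that place_mult ring_add ring_1 by metis
  qed
  assume a: "a \<in> P" and b: "b \<in> P"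
  show ?thesis
  proof (cases "a = 0 \<or> b = 0")
    case True then show ?thesis using a b by auto
  next
    case False
    then show ?thesis using aux[OF a b] aux[OF b a] ring_cases[of "a / b"]
      by (auto simp: add.commute)
  qed
qed

lemma place_minus: "a \<in> P \<Longrightarrow> - a \<in> P"
  using place_mult[of a "- 1"] ring_minus[OF ring_1] by simp
lemma place_diff: "a \<in> P \<Longrightarrow> b \<in> P \<Longrightarrow> a - b \<in> P"
  using place_add[of a "- b"] place_minus by simp
lemma place_sum: "(\<And>i. i \<in> S \<Longrightarrow> f i \<in> P) \<Longrightarrow> sum f S \<in> P"
  by (induction S rule: infinite_finite_induct) (auto intro: place_0 place_add)

lemma const_in_place: "\<iota> c \<in> P \<longleftrightarrow> c = 0"
proof (cases "c = 0")
  case True then show ?thesis using place_0 field_embedding_0[OF emb] by metis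
next
  case False
  then have "\<iota> c \<noteq> 0" "inverse (\<iota> c) \<in> V"
    using field_embedding_eq_0[OF emb] field_embedding_inverse[OF emb, of c] const_in_ring[of "inverse c"] by metis+
  then show ?thesis using False place_iff by metis
qed

lemma range_in_place: "z \<in> range \<iota> \<Longrightarrow> z \<in> P \<Longrightarrow> z = 0"
  using const_in_place field_embedding_0[OF emb] by (metis imageE)

text \<open>
  Divisibility in a valuation ring is total, so all members of a finite set of non-zero elements of the
  field are multiples of one of them. This is used to clear the denominators of a relation.
\<close>
lemma exists_dominating:
  assumes "finite S" "S \<noteq> {}" "0 \<notin> S"
  shows "\<exists>s\<in>S. \<forall>r\<in>S. r / s \<in> V"
  using assms
proof (induction S rule: finite_ne_induct)
  case (singleton x) then show ?case using ring_1 by simp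
next
  case (insert x S)
  then obtain s where s: "s \<in> S" "\<forall>r\<in>S. r / s \<in> V" by auto
  have nz: "x \<noteq> 0" "s \<noteq> 0" using insert s by auto
  show ?case
  proof (cases "x / s \<in> V")
    case True then show ?thesis using s by auto
  next
    case False
    then have sx: "s / x \<in> V" using ring_cases[of "x / s"] by auto
    have "r / x \<in> V" if "r \<in> S" for r
    proof -
      have "r / x = (r / s) * (s / x)" using nz by simp
      then show ?thesis using s(2) that sx ring_mult by metis
    qed
    then show ?thesis using ring_1 nz by auto
  qed
qed

end

section \<open>Existence of poles\<close>

definition subring :: "'a::field set \<Rightarrow> bool" where
  "subring A \<longleftrightarrow> 1 \<in> A \<and> (\<forall>a\<in>A. \<forall>b\<in>A. a - b \<in> A \<and> a * b \<in> A)"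

definition poly_ring :: "'a::field set \<Rightarrow> 'a \<Rightarrow> 'a set" where
  "poly_ring A w = {poly p w | p. \<forall>i. coeff p i \<in> A}"

lemma subring_0: "subring A \<Longrightarrow> 0 \<in> A" unfolding subring_def by (metis diff_self)
lemma subring_minus: "subring A \<Longrightarrow> a \<in> A \<Longrightarrow> - a \<in> A"
  using subring_0 unfolding subring_def by (metis diff_0)
lemma subring_add: "subring A \<Longrightarrow> a \<in> A \<Longrightarrow> b \<in> A \<Longrightarrow> a + b \<in> A"
  using subring_minus[of A b] unfolding subring_def by (metis diff_minus_eq_add)
lemma subring_mult: "subring A \<Longrightarrow> a \<in> A \<Longrightarrow> b \<in> A \<Longrightarrow> a * b \<in> A"
  unfolding subring_def by blast
lemma subring_sum: "subring A \<Longrightarrow> (\<And>i. i \<in> S \<Longrightarrow> f i \<in> A) \<Longrightarrow> sum f S \<in> A"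
  by (induction S rule: infinite_finite_induct) (auto intro: subring_0 subring_add)
lemma subring_power: "subring A \<Longrightarrow> a \<in> A \<Longrightarrow> a ^ i \<in> A"
  by (induction i) (auto simp: subring_def)

lemma poly_ring:
  assumes A: "subring A"
  shows "subring (poly_ring A w)" and "A \<subseteq> poly_ring A w" and "w \<in> poly_ring A w"
proof -
  have sub: "poly [:a:] w \<in> poly_ring A w" if "a \<in> A" for a
    unfolding poly_ring_def using that subring_0[OF A]
    by (intro CollectI exI[of _ "[:a:]"]) (auto simp: coeff_pCons split: nat.splits)
  then show s: "A \<subseteq> poly_ring A w" by auto
  have "poly [:0,1:] w \<in> poly_ring A w"
    unfolding poly_ring_def using subring_0[OF A] A[unfolded subring_def]
    by (intro CollectI exI[of _ "[:0,1:]"]) (auto simp: coeff_pCons split: nat.splits)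
  then show "w \<in> poly_ring A w" by simp
  show "subring (poly_ring A w)"
    unfolding subring_def
  proof (intro conjI ballI)
    show "1 \<in> poly_ring A w" using s A unfolding subring_def by blast
    fix u v assume "u \<in> poly_ring A w" "v \<in> poly_ring A w"
    then obtain p q where p: "u = poly p w" "\<forall>i. coeff p i \<in> A"
      and q: "v = poly q w" "\<forall>i. coeff q i \<in> A" unfolding poly_ring_def by blast
    have "\<forall>i. coeff (p - q) i \<in> A" using p(2) q(2) A unfolding subring_def coeff_diff by blast
    then show "u - v \<in> poly_ring A w" unfolding poly_ring_def p q by (intro CollectI exI[of _ "p - q"]) simp
    have "\<forall>i. coeff (p * q) i \<in> A" unfolding coeff_mult
      using p q by (intro allI subring_sum[OF A] subring_mult[OF A]) auto
    then show "u * v \<in> poly_ring A w" unfolding poly_ring_def p q by (intro CollectI exI[of _ "p * q"]) simp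
  qed
qed

lemma poly_ringE:
  assumes "z \<in> poly_ring A w" "subring A"
  obtains a r where "\<And>i. a i \<in> A" "z = (\<Sum>i\<le>r. a i * w ^ i)"
  using assms(1) that unfolding poly_ring_def poly_altdef by blast

text \<open>
  By Zorn's lemma choose a subring \<open>M\<close> that is maximal among those that contain the constants and
  \<open>1/z\<close> but not \<open>z\<close>. For \<open>b \<in> M\<close> the element \<open>1 - b/z\<close> is a unit of \<open>M\<close>: adjoining its inverse does not
  make \<open>z\<close> available. If neither \<open>w\<close> nor \<open>1/w\<close> were in \<open>M\<close>, then \<open>z\<close> would be a polynomial in \<open>w\<close> and
  one in \<open>1/w\<close> over \<open>M\<close>; the second relation, multiplied by \<open>w\<^sup>r / z\<close>, expresses \<open>w\<^sup>r\<close> by lower powers of \<open>w\<close>, since its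
  coefficient \<open>1 - b\<^sub>0/z\<close> is a unit, and so lowers the degree of the first. By symmetry both degrees
  descend to zero, which contradicts \<open>z \<notin> M\<close>. So \<open>M\<close> is a valuation ring.
\<close>
lemma exists_place_with_pole:
  fixes \<iota> :: "'k::field \<Rightarrow> 'f::field"
  assumes emb: "field_embedding \<iota>" and A0: "subring A0" "range \<iota> \<subseteq> A0" "inverse z \<in> A0" "z \<notin> A0"
  shows "\<exists>P\<in>places \<iota>. z \<notin> place_ring P"
proof -
  define \<A> where "\<A> = {A. subring A \<and> range \<iota> \<subseteq> A \<and> inverse z \<in> A \<and> z \<notin> A}"
  have "\<exists>M\<in>\<A>. \<forall>X\<in>\<A>. M \<subseteq> X \<longrightarrow> X = M"
  proof (rule subset_Zorn_nonempty)
    show "\<A> \<noteq> {}" using A0 unfolding \<A>_def by blast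
    fix C assume C: "C \<noteq> {}" "subset.chain \<A> C"
    have "C \<subseteq> \<A>" and cmp: "\<And>A B. A \<in> C \<Longrightarrow> B \<in> C \<Longrightarrow> A \<subseteq> B \<or> B \<subseteq> A"
      using C(2) unfolding subset_chain_def by (metis, metis)
    then have mem: "A \<in> \<A>" if "A \<in> C" for A using that by (metis subsetD)
    have two: "\<exists>A\<in>C. u \<in> A \<and> v \<in> A" if u: "u \<in> \<Union>C" and v: "v \<in> \<Union>C" for u v
    proof -
      obtain A where A: "A \<in> C" "u \<in> A" using u by (elim UnionE)
      obtain B where B: "B \<in> C" "v \<in> B" using v by (elim UnionE)
      show ?thesis using cmp[OF A(1) B(1)] A B by (metis subsetD)
    qed
    have "subring (\<Union>C)"
      unfolding subring_def
    proof (intro conjI ballI)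
      show "1 \<in> \<Union>C" using C(1) mem unfolding \<A>_def subring_def by blast
      fix u v assume "u \<in> \<Union>C" "v \<in> \<Union>C"
      then obtain A where A: "A \<in> C" "u \<in> A" "v \<in> A" using two by blast
      then have "subring A" using mem \<A>_def by blast
      then show "u - v \<in> \<Union>C" "u * v \<in> \<Union>C" using A unfolding subring_def by blast+
    qed
    then show "\<Union>C \<in> \<A>" using C(1) mem unfolding \<A>_def by auto
  qed
  then obtain M where M: "M \<in> \<A>" and max: "\<And>X. X \<in> \<A> \<Longrightarrow> M \<subseteq> X \<Longrightarrow> X = M" by blast
  have sM: "subring M" and kM: "range \<iota> \<subseteq> M" and iM: "inverse z \<in> M" and zM: "z \<notin> M"
    using M unfolding \<A>_def by auto
  have z0: "z \<noteq> 0" using zM subring_0[OF sM] by blast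
  have ext: "w \<in> M" if "z \<notin> poly_ring M w" for w
  proof -
    have "poly_ring M w \<in> \<A>" using poly_ring[OF sM, of w] kM iM that unfolding \<A>_def by blast
    then show ?thesis using max poly_ring[OF sM, of w] by metis
  qed
  have unit: "inverse (1 - b / z) \<in> M \<and> 1 - b / z \<noteq> 0" if b: "b \<in> M" for b
  proof
    define c where "c = 1 - b / z"
    show c0: "1 - b / z \<noteq> 0" using b zM z0 by (auto simp: field_simps)
    have cM: "c \<in> M" unfolding c_def divide_inverse using sM b iM subring_mult[OF sM]
      unfolding subring_def by blast
    have pw: "\<exists>d\<in>M. c ^ i = 1 - d / z" for i
    proof (induction i)
      case 0 then show ?case using subring_0[OF sM] by auto
    next
      case (Suc i)
      then obtain d where d: "d \<in> M" "c ^ i = 1 - d / z" by blast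
      have "c ^ Suc i = c - c * d / z" unfolding power_Suc d(2) by (simp add: algebra_simps)
      also have "\<dots> = 1 - (b + c * d) / z" unfolding c_def using z0 by (simp add: field_simps)
      finally show ?case using b d(1) cM sM by (metis subring_add subring_mult)
    qed
    show "inverse (1 - b / z) \<in> M"
    proof (rule ext, rule notI)
      assume "z \<in> poly_ring M (inverse (1 - b / z))"
      then obtain a r where a: "\<And>i. a i \<in> M" "z = (\<Sum>i\<le>r. a i * inverse c ^ i)"
        using poly_ringE sM unfolding c_def by metis
      have "z * c ^ r = (\<Sum>i\<le>r. a i * c ^ (r - i))"
        unfolding a(2) sum_distrib_right using c0
        by (intro sum.cong) (auto simp: c_def[symmetric] power_diff field_simps)
      also have "\<dots> \<in> M" using a(1) cM sM by (intro subring_sum subring_mult subring_power) auto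
      finally have u: "z * c ^ r \<in> M" .
      obtain d where d: "d \<in> M" "c ^ r = 1 - d / z" using pw by blast
      have "z = z * c ^ r + d" using d(2) z0 by (simp add: field_simps)
      then show False using u d(1) zM subring_add[OF sM] by metis
    qed
  qed
  define D where "D w r \<longleftrightarrow> (\<exists>a. (\<forall>i. a i \<in> M) \<and> z = (\<Sum>i\<le>r. a i * w ^ i))" for w r
  have step: "D w r" if dw: "D w (Suc r)" and di: "D (inverse w) (Suc r)" and w0: "w \<noteq> 0" for w r
  proof -
    obtain a where a: "\<And>i. a i \<in> M" "z = (\<Sum>i\<le>Suc r. a i * w ^ i)" using dw D_def by blast
    obtain b where b: "\<And>i. b i \<in> M" "z = (\<Sum>i\<le>Suc r. b i * inverse w ^ i)" using di D_def by blast
    define v where "v = inverse (1 - b 0 / z)"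
    have v: "v \<in> M" "1 - b 0 / z \<noteq> 0" using unit[OF b(1)] unfolding v_def by auto
    have "z * w ^ Suc r = (\<Sum>i\<le>Suc r. b i * w ^ (Suc r - i))"
      unfolding b(2) sum_distrib_right using w0
      by (intro sum.cong) (auto simp: power_diff field_simps)
    also have "\<dots> = (\<Sum>i\<le>Suc r. b (Suc r - i) * w ^ i)"
      by (rule sum.reindex_bij_witness[of _ "\<lambda>i. Suc r - i" "\<lambda>i. Suc r - i"]) auto
    also have "\<dots> = (\<Sum>i\<le>r. b (Suc r - i) * w ^ i) + b 0 * w ^ Suc r" by simp
    finally have "(1 - b 0 / z) * w ^ Suc r = inverse z * (\<Sum>i\<le>r. b (Suc r - i) * w ^ i)"
      using z0 by (simp add: field_simps)
    moreover have "v * ((1 - b 0 / z) * w ^ Suc r) = w ^ Suc r"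
      unfolding v_def mult.assoc[symmetric] left_inverse[OF v(2)] by simp
    ultimately have "w ^ Suc r = v * inverse z * (\<Sum>i\<le>r. b (Suc r - i) * w ^ i)"
      by (metis mult.assoc)
    then have "z = (\<Sum>i\<le>r. a i * w ^ i)
        + a (Suc r) * (v * inverse z * (\<Sum>i\<le>r. b (Suc r - i) * w ^ i))"
      using a(2) unfolding sum.atMost_Suc by metis
    also have "\<dots> = (\<Sum>i\<le>r. (a i + a (Suc r) * v * inverse z * b (Suc r - i)) * w ^ i)"
      by (simp add: algebra_simps sum.distrib sum_distrib_left)
    finally have "z = (\<Sum>i\<le>r. (a i + a (Suc r) * v * inverse z * b (Suc r - i)) * w ^ i)" .
    moreover have "a i + a (Suc r) * v * inverse z * b (Suc r - i) \<in> M" for i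
      using a(1) b(1) v(1) iM by (intro subring_add[OF sM] subring_mult[OF sM]) auto
    ultimately show ?thesis unfolding D_def by (intro exI[of _ "\<lambda>i. a i + a (Suc r) * v * inverse z * b (Suc r - i)"]) blast
  qed
  have mono: "D w s" if "D w r" "r \<le> s" for w r s
  proof -
    from that(1) obtain a where aa: "(\<forall>i. a i \<in> M) \<and> z = (\<Sum>i\<le>r. a i * w ^ i)" unfolding D_def ..
    note a = conjunct1[OF aa] conjunct2[OF aa]
    define a' where "a' i = (if i \<le> r then a i else 0)" for i
    have "(\<Sum>i\<le>s. a' i * w ^ i) = (\<Sum>i\<le>r. a i * w ^ i)"
      by (rule sum.mono_neutral_cong_right) (use that(2) in \<open>auto simp: a'_def\<close>)
    then have "z = (\<Sum>i\<le>s. a' i * w ^ i)" using a(2) by metis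
    moreover have "\<forall>i. a' i \<in> M" unfolding a'_def using a(1) subring_0[OF sM] by simp
    ultimately show ?thesis unfolding D_def by blast
  qed
  have down: "D w 0" if "D w r" "D (inverse w) r" "w \<noteq> 0" for w r
    using that
  proof (induction r)
    case (Suc r)
    then show ?case using step[of w r] step[of "inverse w" r] by simp
  qed simp
  have "w \<in> M \<or> inverse w \<in> M" for w
  proof (rule ccontr)
    assume n: "\<not> (w \<in> M \<or> inverse w \<in> M)"
    then have w0: "w \<noteq> 0" using subring_0[OF sM] by blast
    obtain r where r: "D w r" using n ext[of w] poly_ringE[OF _ sM] unfolding D_def by metis
    obtain s where s: "D (inverse w) s" using n ext[of "inverse w"] poly_ringE[OF _ sM] unfolding D_def by metis
    have "D w 0" using down[of w "max r s"] mono[OF r] mono[OF s] w0 by simp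
    then show False using zM unfolding D_def by auto
  qed
  moreover have "range \<iota> \<noteq> M"
  proof
    assume eq: "range \<iota> = M"
    then obtain c where "inverse z = \<iota> c" using iM by blast
    then have "z = \<iota> (inverse c)" by (metis emb field_embedding_inverse inverse_inverse_eq)
    then show False using zM eq by blast
  qed
  moreover have "M \<noteq> UNIV" using zM by auto
  ultimately have "valuation_ring \<iota> M"
    using sM kM unfolding valuation_ring_def subring_def by blast
  then show ?thesis using placesI zM by metis
qed

text \<open>
  The ring \<open>k[1/z]\<close> does not contain \<open>z\<close>: in an equation \<open>z = a\<^sub>0 + \<dots> + a\<^sub>r z\<^bsup>-r\<^esup>\<close>, multiplied by
  \<open>z\<^sup>r\<close>, every term but \<open>a\<^sub>r\<close> lies in \<open>P\<close>, so \<open>a\<^sub>r\<close> vanishes, and the degree descends.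
\<close>
lemma (in place) exists_pole:
  assumes z: "z \<in> P" "z \<noteq> 0"
  shows "\<exists>P'\<in>places \<iota>. z \<notin> place_ring P'"
proof (rule exists_place_with_pole[OF emb])
  have s: "subring (range \<iota>)"
    unfolding subring_def
  proof (intro conjI ballI)
    show "1 \<in> range \<iota>" using field_embedding_1[OF emb] by (metis rangeI)
    fix u v assume "u \<in> range \<iota>" "v \<in> range \<iota>"
    then obtain c d where "u = \<iota> c" "v = \<iota> d" by blast
    then have "u - v = \<iota> (c - d)" "u * v = \<iota> (c * d)" by (simp_all add: field_embedding_simps[OF emb])
    then show "u - v \<in> range \<iota>" "u * v \<in> range \<iota>" by blast+
  qed
  show "subring (poly_ring (range \<iota>) (inverse z))" "range \<iota> \<subseteq> poly_ring (range \<iota>) (inverse z)"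
    "inverse z \<in> poly_ring (range \<iota>) (inverse z)" using poly_ring[OF s] by auto
  show "z \<notin> poly_ring (range \<iota>) (inverse z)"
  proof
    assume "z \<in> poly_ring (range \<iota>) (inverse z)"
    then obtain a r where a: "\<And>i. a i \<in> range \<iota>" "z = (\<Sum>i\<le>r. a i * inverse z ^ i)"
      using poly_ringE s by metis
    have "z = (\<Sum>i\<le>r. a i * inverse z ^ i) \<Longrightarrow> False" for r
    proof (induction r)
      case 0
      then have "z \<in> range \<iota>" using a(1)[of 0] by simp
      then show ?case using z range_in_place by blast
    next
      case (Suc r)
      have "z * z ^ Suc r = (\<Sum>i\<le>Suc r. a i * inverse z ^ i) * z ^ Suc r"
        using arg_cong[OF Suc.prems, of "\<lambda>u. u * z ^ Suc r"] .
      also have "\<dots> = (\<Sum>i\<le>r. a i * z ^ (Suc r - i)) + a (Suc r)"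
      proof -
        have "a i * inverse z ^ i * z ^ Suc r = a i * z ^ (Suc r - i)" if "i \<le> Suc r" for i
          using z(2) that by (simp add: power_diff field_simps)
        then have "(\<Sum>i\<le>Suc r. a i * inverse z ^ i * z ^ Suc r) = (\<Sum>i\<le>Suc r. a i * z ^ (Suc r - i))"
          by (intro sum.cong) auto
        then show ?thesis unfolding sum_distrib_right by simp
      qed
      finally have "a (Suc r) = z * z ^ Suc r - (\<Sum>i\<le>r. a i * z ^ (Suc r - i))" by simp
      moreover have "a i \<in> V" for i using a(1)[of i] const_in_ring by auto
      then have "a i * z ^ (Suc r - i) \<in> P" if "i \<le> r" for i
        using place_mult'[of "a i" "z * z ^ (r - i)"] place_mult[OF z(1) ring_power[OF place_subset[OF z(1)]]] that
        by (simp add: Suc_diff_le)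
      then have "(\<Sum>i\<le>r. a i * z ^ (Suc r - i)) \<in> P" by (intro place_sum) auto
      moreover have "z * z ^ Suc r \<in> P" using z(1) place_mult ring_power place_subset by blast
      ultimately have "a (Suc r) \<in> P" using place_diff by metis
      then have "a (Suc r) = 0" using a(1)[of "Suc r"] range_in_place by blast
      then have "(\<Sum>i\<le>Suc r. a i * inverse z ^ i) = (\<Sum>i\<le>r. a i * inverse z ^ i)" by simp
      then show ?case using Suc.IH Suc.prems by metis
    qed
    then show False using a(2) by blast
  qed
qed

section \<open>Polynomials of bounded degree and algebraic relations\<close>

text \<open>
  Polynomials of degree less than \<open>D\<close>. Zero is a member for every \<open>D\<close> although its degree is the
  number zero, so that \<open>below D\<close> has exactly \<open>q\<^sup>D\<close> elements.
\<close>
definition below :: "nat \<Rightarrow> 'k::field poly set" where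
  "below D = {p. p = 0 \<or> degree p < D}"

lemma below_0: "0 \<in> below D" by (simp add: below_def)

lemma below_add: "p \<in> below D \<Longrightarrow> q \<in> below D \<Longrightarrow> p + q \<in> below D"
  unfolding below_def using degree_add_less[of p D q] by (cases "p = 0"; cases "q = 0") auto

lemma below_mono: "p \<in> below D \<Longrightarrow> D \<le> D' \<Longrightarrow> p \<in> below D'"
  unfolding below_def by auto

lemma below_mult: "p \<in> below D \<Longrightarrow> degree h \<le> e \<Longrightarrow> h * p \<in> below (D + e)"
  unfolding below_def using degree_mult_le[of h p] by auto

lemma below_Suc: "below (Suc D) = (\<lambda>(c, p). pCons c p) ` (UNIV \<times> below D)"
proof
  show "below (Suc D) \<subseteq> (\<lambda>(c, p). pCons c p) ` (UNIV \<times> below D)"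
  proof
    fix p assume p: "p \<in> below (Suc D)"
    obtain c q where q: "p = pCons c q" by (cases p)
    then have "q \<in> below D" using p unfolding below_def by (auto split: if_splits)
    then show "p \<in> (\<lambda>(c, p). pCons c p) ` (UNIV \<times> below D)" using q by auto
  qed
  show "(\<lambda>(c, p). pCons c p) ` (UNIV \<times> below D) \<subseteq> below (Suc D)"
    unfolding below_def by (auto split: if_splits)
qed

lemma card_below: "finite (below D :: 'k::{field,finite} poly set)"
    "card (below D :: 'k::{field,finite} poly set) = CARD('k) ^ D"
proof (induction D)
  case 0
  have "below 0 = {0 :: 'k poly}" by (auto simp: below_def)
  then show "finite (below 0 :: 'k poly set)" "card (below 0 :: 'k poly set) = CARD('k) ^ 0" by auto
next
  case (Suc D)
  have i: "inj_on (\<lambda>(c, p). pCons c p) (UNIV \<times> below D :: ('k \<times> 'k poly) set)" by (auto simp: inj_on_def)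
  show "finite (below (Suc D) :: 'k poly set)" unfolding below_Suc using Suc by simp
  show "card (below (Suc D) :: 'k poly set) = CARD('k) ^ Suc D"
    unfolding below_Suc card_image[OF i] using Suc by (simp add: card_cartesian_product)
qed

text \<open>
  More powers of \<open>w\<close> than \<open>T\<close> has elements are linearly dependent; dividing the relation by the lowest
  power of \<open>w\<close> that occurs in it makes the constant term non-zero.
\<close>
lemma power_relation:
  fixes h :: "'a::field \<Rightarrow> 'b::field"
  assumes h: "field_embedding h" and w: "w \<noteq> 0" and T: "finite T"
    and span: "\<And>i. w ^ i \<in> module.span (scale_by h) T"
  shows "\<exists>c r. c 0 \<noteq> 0 \<and> (\<Sum>i\<le>r. h (c i) * w ^ i) = 0"
proof -
  interpret L: vector_space "scale_by h" by (rule vector_space_scale_by[OF h])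
  have h0: "h 0 = 0" by (rule field_embedding_0[OF h])
  have "\<exists>c :: nat \<Rightarrow> 'a. (\<exists>i\<le>card T. c i \<noteq> 0) \<and> (\<Sum>i\<le>card T. h (c i) * w ^ i) = 0"
  proof (cases "inj_on (\<lambda>i. w ^ i) {..card T}")
    case False
    then obtain i j where ij: "i \<le> card T" "j \<le> card T" "i \<noteq> j" "w ^ i = w ^ j" unfolding inj_on_def by auto
    define c :: "nat \<Rightarrow> 'a" where "c l = (if l = i then 1 else if l = j then - 1 else 0)" for l
    have "(\<Sum>l\<le>card T. h (c l) * w ^ l) = (\<Sum>l\<in>{i, j}. h (c l) * w ^ l)"
      using ij by (intro sum.mono_neutral_right) (auto simp: c_def h0)
    also have "\<dots> = 0"
      using ij by (simp add: c_def field_embedding_1[OF h] field_embedding_minus[OF h])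
    finally show ?thesis using ij(1) by (intro exI[of _ c]) (auto simp: c_def)
  next
    case True
    let ?S = "(\<lambda>i. w ^ i) ` {..card T}"
    have "L.dependent ?S"
    proof (rule ccontr)
      assume "\<not> L.dependent ?S"
      then have "card ?S \<le> card T"
        using L.independent_span_bound[of T ?S] span T by auto
      then show False using card_image[OF True] by simp
    qed
    then obtain u where u: "\<exists>v\<in>?S. u v \<noteq> 0" "(\<Sum>v\<in>?S. scale_by h (u v) v) = 0"
      using L.dependent_finite[of ?S] by auto
    have "(\<Sum>i\<le>card T. h (u (w ^ i)) * w ^ i) = 0"
      using u(2) unfolding sum.reindex[OF True] by (simp add: scale_by_def)
    then show ?thesis using u(1) by (intro exI[of _ "\<lambda>i. u (w ^ i)"]) auto
  qed
  then obtain c :: "nat \<Rightarrow> 'a" where c: "\<exists>i\<le>card T. c i \<noteq> 0" "(\<Sum>i\<le>card T. h (c i) * w ^ i) = 0" by blast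
  define i0 where "i0 = (LEAST i. c i \<noteq> 0)"
  have i0: "c i0 \<noteq> 0" unfolding i0_def by (rule LeastI_ex) (use c(1) in blast)
  have i0_least: "c i = 0" if "i < i0" for i using not_less_Least[of i "\<lambda>i. c i \<noteq> 0"] that unfolding i0_def by blast
  obtain i where "i \<le> card T" "c i \<noteq> 0" using c(1) by blast
  then have i0m: "i0 \<le> card T" using i0_least[of i] by (cases "i < i0") auto
  define r where "r = card T - i0"
  have "(\<Sum>i\<le>card T. h (c i) * w ^ i) = (\<Sum>i\<in>{i0..card T}. h (c i) * w ^ i)"
    using i0_least by (intro sum.mono_neutral_right) (auto simp: h0)
  also have "\<dots> = (\<Sum>i\<le>r. h (c (i + i0)) * w ^ (i + i0))"
    by (rule sum.reindex_bij_witness[of _ "\<lambda>i. i + i0" "\<lambda>i. i - i0"]) (use i0m in \<open>auto simp: r_def\<close>)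
  also have "\<dots> = w ^ i0 * (\<Sum>i\<le>r. h (c (i + i0)) * w ^ i)"
    unfolding sum_distrib_left by (intro sum.cong) (simp_all add: power_add)
  finally have "(\<Sum>i\<le>r. h (c (i + i0)) * w ^ i) = 0" using c(2) w by simp
  then show ?thesis using i0 by (intro exI[of _ "\<lambda>i. c (i + i0)"] exI[of _ r]) simp
qed

section \<open>Finite extensions of the rational function field\<close>

text \<open>
  The elements \<open>b 0, \<dots>, b (m - 1)\<close> span the extension but need not be independent, so \<open>m\<close> is an upper
  bound for its degree. The general theory needs only such a bound.
\<close>
locale function_field =
  fixes \<kappa> :: "'k::{field,finite} poly fract \<Rightarrow> 'f::field" and \<iota> :: "'k \<Rightarrow> 'f"
    and m :: nat and b :: "nat \<Rightarrow> 'f"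
  assumes kap: "field_embedding \<kappa>" and iota: "\<iota> = \<kappa> \<circ> rat_const"
    and gen: "\<exists>c. w = (\<Sum>j<m. \<kappa> (c j) * b j)"
begin

lemma emb: "field_embedding \<iota>"
  unfolding iota by (rule field_embedding_comp[OF kap field_embedding_rat_const])

lemma place: "P \<in> places \<iota> \<Longrightarrow> place \<iota> P"
  using emb by (simp add: place_def)

lemma q_gt_1: "CARD('k) > 1"
  using card_mono[of "UNIV :: 'k set" "{0, 1}"] by simp

text \<open>
  The value \<open>p(x)\<close>, where \<open>x\<close> is the image of the variable.
\<close>
definition ev :: "'k poly \<Rightarrow> 'f" where "ev p = \<kappa> (Fract p 1)"

lemma ev_0: "ev 0 = 0" and ev_1: "ev 1 = 1"
  using field_embedding_0[OF kap] field_embedding_1[OF kap]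
  by (simp_all add: ev_def Zero_fract_def One_fract_def)

lemma ev_mult: "ev (p * r) = ev p * ev r"
  by (simp add: ev_def flip: field_embedding_mult[OF kap])

lemma ev_add: "ev (p + r) = ev p + ev r"
  by (simp add: ev_def flip: field_embedding_add[OF kap])

lemma ev_diff: "ev (p - r) = ev p - ev r"
  by (simp add: ev_def flip: field_embedding_diff[OF kap])

lemma ev_eq_0: "ev p = 0 \<longleftrightarrow> p = 0"
  by (simp add: ev_def field_embedding_eq_0[OF kap] Zero_fract_def eq_fract)

lemma ev_power: "ev (p ^ i) = ev p ^ i"
  by (induction i) (simp_all add: ev_1 ev_mult)

lemma ev_prod: "ev (prod f S) = (\<Prod>i\<in>S. ev (f i))"
  by (induction S rule: infinite_finite_induct) (simp_all add: ev_1 ev_mult)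

lemma ev_const: "ev [:c:] = \<iota> c"
  by (simp add: ev_def iota rat_const_def)

lemma kappa_Fract: "v \<noteq> 0 \<Longrightarrow> \<kappa> (Fract u v) = ev u / ev v"
proof -
  assume v: "v \<noteq> 0"
  then have "Fract u v * Fract v 1 = Fract u 1" by (simp add: eq_fract)
  then have "\<kappa> (Fract u v) * ev v = ev u" unfolding ev_def by (metis field_embedding_mult[OF kap])
  then show ?thesis using v ev_eq_0[of v] by (simp add: eq_divide_eq)
qed

text \<open>
  The elements whose coordinates are polynomials in \<open>x\<close> of degree less than \<open>D\<close>. Up to a common
  denominator every finite set consists of such elements.
\<close>
definition coords_below :: "nat \<Rightarrow> 'f set" where
  "coords_below D = {\<Sum>j<m. ev (u j) * b j | u. \<forall>j<m. u j \<in> below D}"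

lemma card_coords_below: "finite (coords_below D)" "card (coords_below D) \<le> CARD('k) ^ (m * D)"
proof -
  define F where "F u = (\<Sum>j<m. ev (u j) * b j)" for u
  let ?S = "{..<m} \<rightarrow>\<^sub>E (below D :: 'k poly set)"
  have sub: "coords_below D \<subseteq> F ` ?S"
  proof
    fix w assume "w \<in> coords_below D"
    then obtain u where u: "w = F u" "\<forall>j<m. u j \<in> below D" unfolding coords_below_def F_def by blast
    have eq: "w = F (restrict u {..<m})" unfolding u F_def by (intro sum.cong) auto
    have mem: "restrict u {..<m} \<in> ?S" using u(2) by (simp add: PiE_iff)
    show "w \<in> F ` ?S" by (subst eq) (rule imageI[OF mem])
  qed
  have f: "finite ?S" by (intro finite_PiE) (auto simp: card_below)
  show "finite (coords_below D)" by (rule finite_subset[OF sub finite_imageI[OF f]])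
  have "card (coords_below D) \<le> card (F ` ?S)" by (rule card_mono[OF finite_imageI[OF f] sub])
  also have "\<dots> \<le> card ?S" by (rule card_image_le[OF f])
  also have "\<dots> = CARD('k) ^ (m * D)" by (simp add: card_PiE card_below mult.commute flip: power_mult)
  finally show "card (coords_below D) \<le> CARD('k) ^ (m * D)" .
qed

lemma coords_below_add: "v \<in> coords_below D \<Longrightarrow> w \<in> coords_below D \<Longrightarrow> v + w \<in> coords_below D"
proof -
  assume "v \<in> coords_below D" "w \<in> coords_below D"
  then obtain u u' where u: "v = (\<Sum>j<m. ev (u j) * b j)" "\<forall>j<m. u j \<in> below D"
    and u': "w = (\<Sum>j<m. ev (u' j) * b j)" "\<forall>j<m. u' j \<in> below D" unfolding coords_below_def by blast
  have "v + w = (\<Sum>j<m. ev (u j + u' j) * b j)"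
    unfolding u(1) u'(1) by (simp add: ev_add ring_distribs sum.distrib)
  moreover have "\<forall>j<m. u j + u' j \<in> below D" using u(2) u'(2) below_add by blast
  ultimately show ?thesis unfolding coords_below_def by (intro CollectI exI[of _ "\<lambda>j. u j + u' j"]) simp
qed

lemma coords_below_0: "0 \<in> coords_below D"
  unfolding coords_below_def by (intro CollectI exI[of _ "\<lambda>_. 0"]) (simp add: ev_0 below_0)

lemma coords_below_sum: "(\<And>i. i \<in> S \<Longrightarrow> f i \<in> coords_below D) \<Longrightarrow> sum f S \<in> coords_below D"
  by (induction S rule: infinite_finite_induct) (auto intro: coords_below_0 coords_below_add)

lemma coords_below_mono: "w \<in> coords_below D \<Longrightarrow> D \<le> D' \<Longrightarrow> w \<in> coords_below D'"
  unfolding coords_below_def using below_mono by blast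

lemma coords_below_mult: "w \<in> coords_below D \<Longrightarrow> degree h \<le> e \<Longrightarrow> ev h * w \<in> coords_below (D + e)"
proof -
  assume w: "w \<in> coords_below D" and h: "degree h \<le> e"
  obtain u where u: "w = (\<Sum>j<m. ev (u j) * b j)" "\<forall>j<m. u j \<in> below D" using w unfolding coords_below_def by blast
  have "ev h * w = (\<Sum>j<m. ev (h * u j) * b j)"
    unfolding u(1) by (simp add: ev_mult sum_distrib_left mult.assoc)
  moreover have "\<forall>j<m. h * u j \<in> below (D + e)" using u(2) h below_mult by blast
  ultimately show ?thesis unfolding coords_below_def by (intro CollectI exI[of _ "\<lambda>j. h * u j"]) simp
qed

lemma fract_cases: obtains u v where "r = Fract u v" "v \<noteq> (0 :: 'k poly)"
  by (cases r) blast

lemma denominator: "\<exists>d D. d \<noteq> 0 \<and> ev d * w \<in> coords_below D"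
proof -
  obtain c where c: "w = (\<Sum>j<m. \<kappa> (c j) * b j)" using gen by blast
  have "\<forall>j. \<exists>u v. c j = Fract u v \<and> v \<noteq> 0" using fract_cases by metis
  then obtain u v where uv: "\<And>j. c j = Fract (u j) (v j)" "\<And>j. v j \<noteq> 0" by metis
  define d where "d = (\<Prod>j<m. v j)"
  define h where "h j = (\<Prod>i\<in>{..<m} - {j}. v i) * u j" for j
  have "ev d * \<kappa> (c j) = ev (h j)" if "j < m" for j
  proof -
    have "d = v j * (\<Prod>i\<in>{..<m} - {j}. v i)" unfolding d_def using that by (intro prod.remove) auto
    moreover have "ev (v j) \<noteq> 0" using uv ev_eq_0 by blast
    ultimately show ?thesis unfolding uv(1) kappa_Fract[OF uv(2)] h_def by (simp add: ev_mult)
  qed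
  then have "ev d * w = (\<Sum>j<m. ev (h j) * b j)"
    unfolding c sum_distrib_left mult.assoc[symmetric] by (intro sum.cong) auto
  moreover have "h j \<in> below (Suc (\<Sum>i<m. degree (h i)))" if "j < m" for j
    unfolding below_def using member_le_sum[of j "{..<m}" "\<lambda>i. degree (h i)"] that by auto
  ultimately have "ev d * w \<in> coords_below (Suc (\<Sum>i<m. degree (h i)))" unfolding coords_below_def by blast
  moreover have "d \<noteq> 0" unfolding d_def using uv by simp
  ultimately show ?thesis by blast
qed

lemma common_denominator: "finite W \<Longrightarrow> \<exists>d D. d \<noteq> 0 \<and> (\<forall>w\<in>W. ev d * w \<in> coords_below D)"
proof (induction W rule: finite_induct)
  case empty then show ?case by (intro exI[of _ 1]) auto
next
  case (insert w W)
  obtain d D where d: "d \<noteq> 0" "\<forall>w\<in>W. ev d * w \<in> coords_below D" using insert by blast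
  obtain d' D' where d': "d' \<noteq> 0" "ev d' * w \<in> coords_below D'" using denominator by blast
  have "ev (d * d') * v \<in> coords_below (D + D' + degree d + degree d')" if v: "v \<in> insert w W" for v
  proof (cases "v = w")
    case True
    have "ev d * (ev d' * w) \<in> coords_below (D' + degree d)" using coords_below_mult d' by blast
    then show ?thesis using True coords_below_mono by (simp add: ev_mult mult.assoc)
  next
    case False
    then have "ev d' * (ev d * v) \<in> coords_below (D + degree d')" using coords_below_mult d v by blast
    then show ?thesis using coords_below_mono by (simp add: ev_mult mult_ac)
  qed
  then show ?case using d d' by (intro exI[of _ "d * d'"] exI[of _ "D + D' + degree d + degree d'"]) auto
qed

text \<open>
  Since \<open>W\<close> meets \<open>z \<Lambda>\<close> only in zero, the sums of \<open>z\<^sup>l w\<^sub>l\<close> over \<open>l < T\<close> with \<open>w\<^sub>l \<in> W\<close> are distinct: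
  the lowest term of a difference lies in \<open>z \<Lambda>\<close>. There are \<open>card W ^ T\<close> of them. Multiplied by a
  common denominator of \<open>W\<close> and by \<open>v(x)\<^sup>T\<close> they get polynomial coordinates of degree less than
  \<open>D + e T\<close>, which leaves at most \<open>q\<^bsup>m (D + e T)\<^esup>\<close> possibilities. Now let \<open>T\<close> grow.
\<close>
lemma card_le_of_independent_mod:
  assumes z: "z = ev u / ev v" "z \<noteq> 0" "degree u \<le> e" "degree v \<le> e"
    and \<Lambda>: "\<And>x y. x \<in> \<Lambda> \<Longrightarrow> y \<in> \<Lambda> \<Longrightarrow> x - y \<in> \<Lambda>" "\<And>x. x \<in> \<Lambda> \<Longrightarrow> z * x \<in> \<Lambda>"
    and W: "finite W" "W \<subseteq> \<Lambda>" "W \<noteq> {}" "\<And>x y. x \<in> W \<Longrightarrow> y \<in> W \<Longrightarrow> x - y \<in> W"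
    and indep: "\<And>x. x \<in> \<Lambda> \<Longrightarrow> z * x \<in> W \<Longrightarrow> x = 0"
  shows "card W \<le> CARD('k) ^ (m * e)"
proof -
  have v0: "ev v \<noteq> 0" using z by auto
  have 0: "0 \<in> \<Lambda>" using W \<Lambda>(1) by (metis diff_self ex_in_conv subsetD)
  have \<Lambda>_minus: "- x \<in> \<Lambda>" if "x \<in> \<Lambda>" for x using \<Lambda>(1)[OF 0 that] by simp
  have \<Lambda>_add: "x + y \<in> \<Lambda>" if "x \<in> \<Lambda>" "y \<in> \<Lambda>" for x y using \<Lambda>(1)[OF that(1) \<Lambda>_minus[OF that(2)]] by simp
  have \<Lambda>_pow: "z ^ l * x \<in> \<Lambda>" if "x \<in> \<Lambda>" for l x
    by (induction l) (use that \<Lambda>(2) in \<open>auto simp: mult.assoc\<close>)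
  have \<Lambda>_sum: "sum f S \<in> \<Lambda>" if "\<And>i. i \<in> S \<Longrightarrow> f i \<in> \<Lambda>" for f and S :: "nat set"
    using that by (induction S rule: infinite_finite_induct) (auto intro: 0 \<Lambda>_add)
  have ind: "\<forall>l<T. \<delta> l = 0" if "\<forall>l<T. \<delta> l \<in> W" "(\<Sum>l<T. z ^ l * \<delta> l) = 0" for T \<delta>
    using that
  proof (induction T arbitrary: \<delta>)
    case (Suc T)
    define S where "S = (\<Sum>l<T. z ^ l * \<delta> (Suc l))"
    have S: "\<delta> 0 + z * S = 0"
      using Suc.prems(2) unfolding S_def sum.lessThan_Suc_shift sum_distrib_left by (simp add: mult.assoc)
    have S\<Lambda>: "S \<in> \<Lambda>" unfolding S_def using Suc.prems(1) W(2) by (intro \<Lambda>_sum \<Lambda>_pow) auto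
    have "z * (- S) = \<delta> 0" using S by (simp add: add_eq_0_iff2)
    then have "- S = 0" using indep[OF \<Lambda>_minus[OF S\<Lambda>]] Suc.prems(1) by simp
    then have "S = 0" "\<delta> 0 = 0" using S by simp_all
    then show ?case using Suc.IH[of "\<lambda>l. \<delta> (Suc l)"] Suc.prems(1) unfolding S_def
      by (metis Suc_less_eq less_Suc_eq_0_disj)
  qed simp
  obtain d D where d: "d \<noteq> 0" "\<forall>w\<in>W. ev d * w \<in> coords_below D" using common_denominator[OF W(1)] by blast
  have "card W ^ T \<le> CARD('k) ^ (m * D) * (CARD('k) ^ (m * e)) ^ T" for T
  proof -
  define \<Phi> where "\<Phi> w = ev d * ev v ^ T * (\<Sum>l<T. z ^ l * w l)" for w
  have inj: "inj_on \<Phi> ({..<T} \<rightarrow>\<^sub>E W)"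
  proof (rule inj_onI)
    fix w w' assume w: "w \<in> {..<T} \<rightarrow>\<^sub>E W" "w' \<in> {..<T} \<rightarrow>\<^sub>E W" "\<Phi> w = \<Phi> w'"
    have "(\<Sum>l<T. z ^ l * w l) = (\<Sum>l<T. z ^ l * w' l)"
      using w(3) d v0 ev_eq_0[of d] unfolding \<Phi>_def by simp
    then have "(\<Sum>l<T. z ^ l * (w l - w' l)) = 0" by (simp add: right_diff_distrib sum_subtractf)
    moreover have "\<forall>l<T. w l - w' l \<in> W" using w W(4) by auto
    ultimately have "\<forall>l<T. w l - w' l = 0" using ind[of T "\<lambda>l. w l - w' l"] by blast
    then show "w = w'" by (intro PiE_ext[OF w(1,2)]) auto
  qed
  have "\<Phi> w \<in> coords_below (D + e * T)" if w: "w \<in> {..<T} \<rightarrow>\<^sub>E W" for w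
  proof -
    have "\<Phi> w = (\<Sum>l<T. ev (u ^ l * v ^ (T - l)) * (ev d * w l))"
      unfolding \<Phi>_def sum_distrib_left
    proof (intro sum.cong refl)
      fix l assume l: "l \<in> {..<T}"
      then have "ev v ^ T = ev v ^ l * ev v ^ (T - l)" by (simp flip: power_add)
      then show "ev d * ev v ^ T * (z ^ l * w l) = ev (u ^ l * v ^ (T - l)) * (ev d * w l)"
        using v0 by (simp add: z(1) ev_mult ev_power power_divide field_simps)
    qed
    also have "\<dots> \<in> coords_below (D + e * T)"
    proof (intro coords_below_sum coords_below_mult)
      fix l assume l: "l \<in> {..<T}"
      show "ev d * w l \<in> coords_below D" using w d l by auto
      have "degree (u ^ l * v ^ (T - l)) \<le> degree (u ^ l) + degree (v ^ (T - l))" by (rule degree_mult_le)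
      also have "\<dots> \<le> degree u * l + degree v * (T - l)" using degree_power_le add_mono by blast
      also have "\<dots> \<le> e * l + e * (T - l)" using z by (intro add_mono mult_right_mono) auto
      also have "\<dots> = e * T" using l by (simp flip: distrib_left)
      finally show "degree (u ^ l * v ^ (T - l)) \<le> e * T" .
    qed
    finally show ?thesis .
  qed
  then have "card ({..<T} \<rightarrow>\<^sub>E W) \<le> card (coords_below (D + e * T))"
    by (intro card_inj_on_le[OF inj _ card_coords_below(1)]) blast
  also have "\<dots> \<le> CARD('k) ^ (m * (D + e * T))" by (rule card_coords_below)
  finally show ?thesis by (simp add: card_PiE power_mult power_add distrib_left mult.assoc)
  qed
  then show ?thesis by (rule power_growth) (use q_gt_1 in auto)
qed

text \<open>
  The larger of the degrees of numerator and denominator in lowest terms. For non-constant \<open>z\<close> it is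
  the degree of \<open>k(x)\<close> over \<open>k(z)\<close>, so \<open>m * height z\<close> bounds the degree of the extension over
  \<open>k(z)\<close>.
\<close>
definition height :: "'f \<Rightarrow> nat" where
  "height z = (LEAST e. \<exists>u v. z = ev u / ev v \<and> v \<noteq> 0 \<and> degree u \<le> e \<and> degree v \<le> e)"

lemma height: 
  assumes "z \<in> range \<kappa>"
  shows "\<exists>u v. z = ev u / ev v \<and> v \<noteq> 0 \<and> degree u \<le> height z \<and> degree v \<le> height z"
proof -
  obtain r where "z = \<kappa> r" using assms by blast
  moreover obtain u v where "r = Fract u v" "v \<noteq> 0" by (rule fract_cases)
  ultimately have "z = ev u / ev v" using kappa_Fract by simp
  then show ?thesis unfolding height_def using \<open>v \<noteq> 0\<close>
    by (intro LeastI[of "\<lambda>e. \<exists>u v. z = ev u / ev v \<and> v \<noteq> 0 \<and> degree u \<le> e \<and> degree v \<le> e" "max (degree u) (degree v)"]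
        exI[of _ u] exI[of _ v]) simp
qed

lemma height_le:
  assumes "v \<noteq> 0" "z = ev u / ev v" "degree u \<le> e" "degree v \<le> e"
  shows "height z \<le> e"
  unfolding height_def using assms by (intro Least_le) blast

lemma card_le_height:
  assumes z: "z \<in> range \<kappa>" "z \<noteq> 0"
    and \<Lambda>: "\<And>x y. x \<in> \<Lambda> \<Longrightarrow> y \<in> \<Lambda> \<Longrightarrow> x - y \<in> \<Lambda>" "\<And>x. x \<in> \<Lambda> \<Longrightarrow> z * x \<in> \<Lambda>"
    and W: "finite W" "W \<subseteq> \<Lambda>" "W \<noteq> {}" "\<And>x y. x \<in> W \<Longrightarrow> y \<in> W \<Longrightarrow> x - y \<in> W"
    and indep: "\<And>x. x \<in> \<Lambda> \<Longrightarrow> z * x \<in> W \<Longrightarrow> x = 0"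
  shows "card W \<le> CARD('k) ^ (m * height z)"
proof -
  obtain u v where uv: "z = ev u / ev v" "degree u \<le> height z" "degree v \<le> height z"
    using height[OF z(1)] by blast
  show ?thesis by (rule card_le_of_independent_mod[OF uv(1) z(2) uv(2,3) \<Lambda> W indep])
qed

lemma relation_with_constant_term:
  assumes w: "w \<noteq> 0"
  shows "\<exists>c r. c 0 \<noteq> 0 \<and> (\<Sum>i\<le>r. \<kappa> (c i) * w ^ i) = 0"
proof (rule power_relation[OF kap w])
  interpret L: vector_space "scale_by \<kappa>" by (rule vector_space_scale_by[OF kap])
  show "finite (b ` {..<m})" by simp
  fix i
  obtain c where c: "w ^ i = (\<Sum>j<m. \<kappa> (c j) * b j)" using gen by blast
  have "(\<Sum>j<m. scale_by \<kappa> (c j) (b j)) \<in> L.span (b ` {..<m})"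
    by (intro L.span_sum L.span_scale L.span_base) auto
  then show "w ^ i \<in> L.span (b ` {..<m})" using c by (simp add: scale_by_def)
qed

text \<open>
  In an algebraic equation for \<open>w\<close> whose coefficients are integral at \<open>P\<close>, the constant term is a
  multiple of \<open>w\<close>. Thus questions on \<open>w\<close> reduce to an element \<open>z\<close> of \<open>k(x)\<close>, to which the counting
  argument applies.
\<close>
lemma ring_divides_base:
  assumes P: "P \<in> places \<iota>" and w: "w \<in> place_ring P" "w \<noteq> 0"
  shows "\<exists>z\<in>range \<kappa>. z \<noteq> 0 \<and> z / w \<in> place_ring P"
proof -
  interpret place \<iota> P by (rule place[OF P])
  obtain c r where c: "c 0 \<noteq> 0" "(\<Sum>i\<le>r. \<kappa> (c i) * w ^ i) = 0"
    using relation_with_constant_term[OF w(2)] by blast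
  define S where "S = {\<kappa> (c i) | i. i \<le> r \<and> c i \<noteq> 0}"
  have S: "finite S" "S \<noteq> {}" "0 \<notin> S" unfolding S_def using c(1) by (auto simp: field_embedding_eq_0[OF kap])
  obtain s where s: "s \<in> S" "\<And>r. r \<in> S \<Longrightarrow> r / s \<in> V" using exists_dominating[OF S] by auto
  have s0: "s \<noteq> 0" using s(1) S(3) by metis
  have cV: "\<kappa> (c i) / s \<in> V" if "i \<le> r" for i
    using s(2)[of "\<kappa> (c i)"] that ring_0 field_embedding_0[OF kap] unfolding S_def by (cases "c i = 0") auto
  have c0: "\<kappa> (c 0) \<noteq> 0" using c(1) by (simp add: field_embedding_eq_0[OF kap])
  then obtain r' where r': "r = Suc r'" using c(2) by (cases r) auto
  define B where "B = (\<Sum>i\<le>r'. \<kappa> (c (Suc i)) / s * w ^ i)"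
  have "(\<Sum>i\<le>r'. \<kappa> (c (Suc i)) * w ^ Suc i) = w * s * B"
    unfolding B_def sum_distrib_left using s0 by (intro sum.cong) auto
  then have "\<kappa> (c 0) + w * s * B = 0" using c(2) unfolding r' sum.atMost_Suc_shift by simp
  then have "\<kappa> (c 0) = - (w * s * B)" by (simp add: eq_neg_iff_add_eq_0)
  then have "\<kappa> (c 0) / s / w = - B" using s0 w(2) by simp
  moreover have "B \<in> V" unfolding B_def using cV w(1) r' by (intro ring_sum ring_mult ring_power) auto
  ultimately have "\<kappa> (c 0) / s / w \<in> V" using ring_minus by metis
  moreover obtain i1 where "s = \<kappa> (c i1)" using s(1) unfolding S_def by blast
  then have "\<kappa> (c 0) / s = \<kappa> (c 0 / c i1)" by (simp add: field_embedding_divide[OF kap])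
  moreover have "\<kappa> (c 0) / s \<noteq> 0" using s0 c0 by simp
  ultimately show ?thesis by (metis rangeI)
qed

end

context function_field begin

section \<open>Places are discrete valuations\<close>

text \<open>
  Certifies that \<open>c\<close> generates the top of a strictly ascending chain of \<open>r + 1\<close> principal ideals of
  the valuation ring whose bottom is generated by \<open>z\<close>. The chain itself is not recorded, only the
  space \<open>W\<close> of the combinations with constant coefficients of the \<open>r\<close> generators above \<open>z\<close>: none of
  them except zero is divisible by \<open>z\<close>, so \<open>card_le_height\<close> bounds \<open>r\<close>.
\<close>
definition chain_top :: "'f set \<Rightarrow> 'f \<Rightarrow> nat \<Rightarrow> 'f \<Rightarrow> bool" where
  "chain_top P z r c \<longleftrightarrow> c \<noteq> 0 \<and> z / c \<in> place_ring P \<and>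
     (\<exists>W. finite W \<and> W \<noteq> {} \<and> card W = CARD('k) ^ r \<and> (\<forall>x\<in>W. \<forall>y\<in>W. x - y \<in> W) \<and>
       (\<forall>w\<in>W. w / c \<in> place_ring P) \<and> (\<forall>x\<in>place_ring P. z * x \<in> W \<longrightarrow> x = 0))"

lemma chain_topE:
  assumes "chain_top P z r c"
  obtains W where "finite W" "W \<noteq> {}" "card W = CARD('k) ^ r"
    "\<And>x y. x \<in> W \<Longrightarrow> y \<in> W \<Longrightarrow> x - y \<in> W" "\<And>w. w \<in> W \<Longrightarrow> w / c \<in> place_ring P"
    "\<And>x. x \<in> place_ring P \<Longrightarrow> z * x \<in> W \<Longrightarrow> x = 0"
proof -
  from assms obtain W where W: "finite W \<and> W \<noteq> {} \<and> card W = CARD('k) ^ r \<and> (\<forall>x\<in>W. \<forall>y\<in>W. x - y \<in> W) \<and>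
       (\<forall>w\<in>W. w / c \<in> place_ring P) \<and> (\<forall>x\<in>place_ring P. z * x \<in> W \<longrightarrow> x = 0)"
    unfolding chain_top_def by auto
  show ?thesis by (rule that[of W]) (use W in \<open>simp_all\<close>)
qed

lemma chain_top_0:
  assumes "P \<in> places \<iota>" "z \<noteq> 0"
  shows "chain_top P z 0 z"
proof -
  interpret place \<iota> P by (rule place[OF assms(1)])
  show ?thesis unfolding chain_top_def using assms(2) ring_0 ring_1
    by (intro conjI exI[of _ "{0}"]) auto
qed

text \<open>
  A combination \<open>w + \<iota> k * c'\<close> with \<open>k \<noteq> 0\<close> is a unit multiple of \<open>c'\<close>, since \<open>w / c'\<close> lies in the
  maximal ideal. Hence it is not divisible by \<open>z\<close>, which is a proper multiple of \<open>c'\<close>.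
\<close>
lemma chain_top_Suc:
  assumes "P \<in> places \<iota>" and ch: "chain_top P z r c" and c': "c' \<noteq> 0" "c / c' \<in> P"
  shows "chain_top P z (Suc r) c'"
proof -
  interpret place \<iota> P by (rule place[OF assms(1)])
  have c: "c \<noteq> 0" and zc: "z / c \<in> V" using ch unfolding chain_top_def by auto
  obtain W where W: "finite W" "W \<noteq> {}" "card W = CARD('k) ^ r"
    and Wd: "\<And>x y. x \<in> W \<Longrightarrow> y \<in> W \<Longrightarrow> x - y \<in> W"
    and Wc: "\<And>w. w \<in> W \<Longrightarrow> w / c \<in> V"
    and Wz: "\<And>x. x \<in> V \<Longrightarrow> z * x \<in> W \<Longrightarrow> x = 0"
    by (rule chain_topE[OF ch]) blast
  have WP: "w / c' \<in> P" if "w \<in> W" for w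
  proof -
    have "w / c' = (w / c) * (c / c')" using c by simp
    then show ?thesis using Wc[OF that] c'(2) place_mult' by metis
  qed
  define F where "F = (\<lambda>(w, k). w + \<iota> k * c')"
  have quot: "F (w, k) / c' = w / c' + \<iota> k" for w k
    unfolding F_def using c'(1) by (simp add: add_divide_distrib)
  have diffF: "F (w, k) - F (w', k') = F (w - w', k - k')" for w k w' k'
    unfolding F_def by (simp add: field_embedding_diff[OF emb] algebra_simps)
  have zeroF: "k = 0" if "F (w, k) / c' \<in> P" "w \<in> W" for w k
    using place_diff[OF that(1) WP[OF that(2)]] quot const_in_place by simp
  have "inj_on F (W \<times> UNIV)"
  proof (rule inj_onI, clarify)
    fix w k w' k' assume w: "w \<in> W" "w' \<in> W" and e: "F (w, k) = F (w', k')"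
    have "F (w - w', k - k') = 0" using e diffF[of w k w' k'] by simp
    then have "k - k' = 0" using zeroF[of "w - w'" "k - k'"] Wd[OF w] place_0 by simp
    then show "w = w' \<and> k = k'" using e unfolding F_def by simp
  qed
  then have card: "card (F ` (W \<times> UNIV)) = CARD('k) ^ Suc r"
    using W(3) by (simp add: card_image card_cartesian_product)
  have zc': "z / c' \<in> P"
  proof -
    have "z / c' = (z / c) * (c / c')" using c by simp
    then show ?thesis using zc c'(2) place_mult' by metis
  qed
  show ?thesis
    unfolding chain_top_def
  proof (intro conjI exI[of _ "F ` (W \<times> UNIV)"] ballI impI)
    show "c' \<noteq> 0" by fact
    show "z / c' \<in> V" using zc' place_subset by blast
    show "finite (F ` (W \<times> UNIV))" using W(1) by simp
    show "F ` (W \<times> UNIV) \<noteq> {}" using W(2) by simp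
    show "card (F ` (W \<times> UNIV)) = CARD('k) ^ Suc r" by (rule card)
    fix x assume x: "x \<in> F ` (W \<times> UNIV)"
    then obtain w k where wk: "x = F (w, k)" "w \<in> W" by auto
    show "x / c' \<in> V" unfolding wk(1) quot using WP[OF wk(2)] place_subset ring_add const_in_ring by blast
    fix y assume "y \<in> F ` (W \<times> UNIV)"
    then obtain w' k' where wk': "y = F (w', k')" "w' \<in> W" by auto
    show "x - y \<in> F ` (W \<times> UNIV)" unfolding wk(1) wk'(1) diffF using Wd[OF wk(2) wk'(2)] by blast
  next
    fix x assume x: "x \<in> V" "z * x \<in> F ` (W \<times> UNIV)"
    then obtain w k where wk: "z * x = F (w, k)" "w \<in> W" by auto
    have "z * x / c' = (z / c') * x" by simp
    then have "F (w, k) / c' \<in> P" using wk(1) place_mult[OF zc' x(1)] by simp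
    then have "k = 0" using zeroF wk(2) by blast
    then have "z * x = w" using wk(1) by (simp add: F_def field_embedding_0[OF emb])
    then show "x = 0" using Wz[OF x(1)] wk(2) by simp
  qed
qed

lemma chain_top_bound:
  assumes "P \<in> places \<iota>" "z \<in> range \<kappa>" "z \<noteq> 0" "z \<in> place_ring P" "chain_top P z r c" "c \<in> place_ring P"
  shows "r \<le> m * height z"
proof -
  interpret place \<iota> P by (rule place[OF assms(1)])
  have c: "c \<noteq> 0" using assms(5) unfolding chain_top_def by auto
  obtain W where W: "finite W" "W \<noteq> {}" "card W = CARD('k) ^ r"
    and Wd: "\<And>x y. x \<in> W \<Longrightarrow> y \<in> W \<Longrightarrow> x - y \<in> W"
    and Wc: "\<And>w. w \<in> W \<Longrightarrow> w / c \<in> V"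
    and Wz: "\<And>x. x \<in> V \<Longrightarrow> z * x \<in> W \<Longrightarrow> x = 0"
    by (rule chain_topE[OF assms(5)]) blast
  have WV: "W \<subseteq> V"
  proof
    fix w assume "w \<in> W"
    then have "(w / c) * c \<in> V" using Wc assms(6) ring_mult by blast
    then show "w \<in> V" using c by simp
  qed
  have "card W \<le> CARD('k) ^ (m * height z)"
    by (rule card_le_height[where \<Lambda> = V, OF assms(2,3) ring_diff ring_mult[OF assms(4)] W(1) WV W(2) Wd Wz])
  then show ?thesis unfolding W(3) using q_gt_1 by simp
qed

text \<open>
  A non-zero element of \<open>P\<close> divides an element of \<open>k(x)\<close>, so \<open>P\<close> restricts to a non-trivial place of
  \<open>k(x)\<close>.
\<close>
lemma base_element_in_place:
  assumes "P \<in> places \<iota>"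
  shows "\<exists>z\<in>range \<kappa>. z \<noteq> 0 \<and> z \<in> P"
proof -
  interpret place \<iota> P by (rule place[OF assms(1)])
  obtain w where "w \<notin> V" using ring_proper by blast
  then have w: "inverse w \<in> P" "inverse w \<noteq> 0" using not_ring_inverse ring_0 by auto
  obtain z where z: "z \<in> range \<kappa>" "z \<noteq> 0" "z / inverse w \<in> V"
    using ring_divides_base[OF assms place_subset[OF w(1)] w(2)] by blast
  have "inverse w * (z / inverse w) \<in> P" by (rule place_mult[OF w(1) z(3)])
  then have "z \<in> P" using w(2) by simp
  then show ?thesis using z by blast
qed

text \<open>
  If no element generated \<open>P\<close>, then each \<open>c \<in> P\<close> could be replaced by some \<open>c' \<in> P\<close> of which it is a
  proper multiple, and chains above a fixed \<open>z\<close> would be arbitrarily long.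
\<close>
lemma place_principal:
  assumes "P \<in> places \<iota>"
  shows "\<exists>t. t \<noteq> 0 \<and> t \<in> P \<and> (\<forall>w\<in>P. w / t \<in> place_ring P)"
proof (rule ccontr)
  assume neg: "\<not> ?thesis"
  interpret place \<iota> P by (rule place[OF assms(1)])
  obtain z where z: "z \<in> range \<kappa>" "z \<noteq> 0" "z \<in> P" using base_element_in_place[OF assms] by blast
  have "\<exists>c. c \<in> P \<and> chain_top P z r c" for r
  proof (induction r)
    case 0 then show ?case using chain_top_0[OF assms z(2)] z(3) by blast
  next
    case (Suc r)
    then obtain c where c: "c \<in> P" "chain_top P z r c" by blast
    have c0: "c \<noteq> 0" using c(2) unfolding chain_top_def by blast
    obtain c' where c': "c' \<in> P" "c' / c \<notin> V" using neg c(1) c0 by blast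
    have "c' \<noteq> 0" using c'(2) ring_0 by auto
    moreover have "c / c' \<in> P" using not_ring_inverse[OF c'(2)] by simp
    ultimately show ?case using chain_top_Suc[OF assms c(2)] c'(1) by blast
  qed
  then obtain c where "c \<in> P" "chain_top P z (Suc (m * height z)) c" by blast
  then show False using chain_top_bound[OF assms z(1,2) place_subset[OF z(3)]] place_subset by fastforce
qed

definition units :: "'f set \<Rightarrow> 'f set" where
  "units P = {u. u \<noteq> 0 \<and> u \<in> place_ring P \<and> inverse u \<in> place_ring P}"

lemma units_iff: "P \<in> places \<iota> \<Longrightarrow> u \<in> units P \<longleftrightarrow> u \<in> place_ring P \<and> u \<notin> P"
proof -
  assume "P \<in> places \<iota>"
  then interpret place \<iota> P by (rule place)
  show ?thesis unfolding units_def using place_iff by auto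
qed

lemma units_mult: "P \<in> places \<iota> \<Longrightarrow> u \<in> units P \<Longrightarrow> v \<in> units P \<Longrightarrow> u * v \<in> units P"
  unfolding units_def by (auto intro: place.ring_mult[OF place] simp: mult.commute)

lemma units_inverse: "u \<in> units P \<Longrightarrow> inverse u \<in> units P"
  unfolding units_def by auto

lemma units_1: "P \<in> places \<iota> \<Longrightarrow> 1 \<in> units P"
  unfolding units_def using place.ring_1[OF place] by simp

lemma units_powi: "P \<in> places \<iota> \<Longrightarrow> u \<in> units P \<Longrightarrow> u powi k \<in> units P"
proof -
  assume P: "P \<in> places \<iota>" and u: "u \<in> units P"
  have "u ^ i \<in> units P" for i by (induction i) (auto intro: units_1 units_mult P u)
  then show ?thesis unfolding power_int_def
    using units_inverse by (metis power_inverse)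
qed

text \<open>
  This is the condition on \<open>t\<close> in the definition of \<open>place_val\<close>, with \<open>t \<noteq> 0\<close> added.
\<close>
definition uniformizer :: "'f set \<Rightarrow> 'f \<Rightarrow> bool" where
  "uniformizer P t \<longleftrightarrow> t \<noteq> 0 \<and> P = {t * w | w. w \<in> place_ring P}"

lemma ex_uniformizer: "P \<in> places \<iota> \<Longrightarrow> \<exists>t. uniformizer P t"
proof -
  assume P: "P \<in> places \<iota>"
  then interpret place \<iota> P by (rule place)
  obtain t where t: "t \<noteq> 0" "t \<in> P" "\<And>w. w \<in> P \<Longrightarrow> w / t \<in> V" using place_principal[OF P] by blast
  have "P = {t * w | w. w \<in> V}"
  proof
    show "{t * w | w. w \<in> V} \<subseteq> P" using place_mult[OF t(2)] by blast
    show "P \<subseteq> {t * w | w. w \<in> V}"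
    proof
      fix w assume "w \<in> P"
      then have "w / t \<in> V" "w = t * (w / t)" using t by auto
      then show "w \<in> {t * w | w. w \<in> V}" by blast
    qed
  qed
  then show ?thesis using t(1) unfolding uniformizer_def by blast
qed

lemma uniformizer_in: "P \<in> places \<iota> \<Longrightarrow> uniformizer P t \<Longrightarrow> t \<in> P"
  unfolding uniformizer_def using place.ring_1[OF place] by (metis (mono_tags, lifting) mem_Collect_eq mult_1_right)

lemma uniformizer_div: "uniformizer P t \<Longrightarrow> w \<in> P \<Longrightarrow> w / t \<in> place_ring P"
  unfolding uniformizer_def by (auto simp: set_eq_iff)

text \<open>
  If all powers of \<open>t\<close> divided \<open>w\<close>, they would divide an element \<open>z\<close> of \<open>k(x)\<close>, and
  \<open>z, t\<^sup>r, \<dots>, t, 1\<close> would be a chain of arbitrary length. So some power is the last one that divides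
  \<open>w\<close>.
\<close>
lemma decompose_ring:
  assumes P: "P \<in> places \<iota>" and t: "uniformizer P t" and w: "w \<in> place_ring P" "w \<noteq> 0"
  shows "\<exists>k. w / t ^ k \<in> units P"
proof -
  interpret place \<iota> P by (rule place[OF P])
  have t0: "t \<noteq> 0" using t unfolding uniformizer_def by blast
  have tP: "t \<in> P" by (rule uniformizer_in[OF P t])
  obtain z where z: "z \<in> range \<kappa>" "z \<noteq> 0" "z / w \<in> V" using ring_divides_base[OF P w] by blast
  have zV: "z \<in> V" using ring_mult[OF z(3) w(1)] w(2) by simp
  have "\<exists>r. w / t ^ r \<notin> V"
  proof (rule ccontr)
    assume "\<not> ?thesis"
    then have wt: "w / t ^ r \<in> V" for r by blast
    have zt: "z / t ^ r \<in> P" for r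
    proof -
      have "z / t ^ r = (z / w) * (w / t ^ Suc r) * t" using w(2) t0 by simp
      then show ?thesis using ring_mult[OF z(3) wt] tP place_mult' by metis
    qed
    define r where "r = m * height z"
    have "chain_top P z (Suc j) (t ^ (r - j))" if "j \<le> r" for j
      using that
    proof (induction j)
      case 0
      show ?case using chain_top_Suc[OF P chain_top_0[OF P z(2)], of "t ^ r"] t0 zt by simp
    next
      case (Suc j)
      then have "chain_top P z (Suc j) (t ^ (r - j))" by simp
      moreover have "r - j = Suc (r - Suc j)" using Suc by simp
      then have "t ^ (r - j) / t ^ (r - Suc j) \<in> P" using t0 tP by simp
      ultimately show ?case using chain_top_Suc[OF P] t0 by simp
    qed
    from this[of r] have "chain_top P z (Suc r) 1" by simp
    then have "Suc r \<le> m * height z" using chain_top_bound[OF P z(1,2) zV] ring_1 by blast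
    then show False unfolding r_def by simp
  qed
  define r where "r = (LEAST r. w / t ^ r \<notin> V)"
  have r: "w / t ^ r \<notin> V" unfolding r_def using \<open>\<exists>r. w / t ^ r \<notin> V\<close> by (rule LeastI_ex)
  have r0: "r \<noteq> 0" using r w(1) by (intro notI) simp
  then obtain k where k: "r = Suc k" by (cases r) auto
  have wk: "w / t ^ k \<in> V" using not_less_Least[of k "\<lambda>r. w / t ^ r \<notin> V"] k unfolding r_def by auto
  have "w / t ^ k \<notin> P"
  proof
    assume "w / t ^ k \<in> P"
    then have "w / t ^ k / t \<in> V" by (rule uniformizer_div[OF t])
    then show False using r k by (simp add: field_simps)
  qed
  then show ?thesis using wk units_iff[OF P] by blast
qed

lemma decompose:
  assumes P: "P \<in> places \<iota>" and t: "uniformizer P t" and w: "w \<noteq> 0"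
  shows "\<exists>k. \<exists>u\<in>units P. w = t powi k * u"
proof -
  interpret place \<iota> P by (rule place[OF P])
  have t0: "t \<noteq> 0" using t unfolding uniformizer_def by blast
  show ?thesis
  proof (cases "w \<in> V")
    case True
    then obtain k where "w / t ^ k \<in> units P" using decompose_ring[OF P t True w] by blast
    moreover have "w = t powi (int k) * (w / t ^ k)" using t0 by simp
    ultimately show ?thesis by blast
  next
    case False
    then have "inverse w \<in> V" "inverse w \<noteq> 0" using ring_cases w by auto
    then obtain k where "inverse w / t ^ k \<in> units P" using decompose_ring[OF P t] by blast
    then have "inverse (inverse w / t ^ k) \<in> units P" by (rule units_inverse)
    moreover have "w = t powi (- int k) * inverse (inverse w / t ^ k)"
      using t0 w by (simp add: power_int_minus field_simps)
    ultimately show ?thesis by blast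
  qed
qed

lemma power_in_units:
  assumes P: "P \<in> places \<iota>" and t: "t \<in> P" "t \<noteq> 0" and u: "t powi d \<in> units P"
  shows "d = 0"
proof -
  interpret place \<iota> P by (rule place[OF P])
  have *: "t ^ Suc j \<notin> units P" for j
    using units_iff[OF P] place_mult[OF t(1) ring_power[OF place_subset[OF t(1)]]] by simp
  show ?thesis
  proof (rule ccontr)
    assume "d \<noteq> 0"
    then consider "d > 0" | "d < 0" by linarith
    then show False
    proof cases
      case 1
      then have "t powi d = t ^ Suc (nat d - 1)" by (simp add: power_int_def)
      then show ?thesis using * u by metis
    next
      case 2
      then have "inverse (t powi d) = t ^ Suc (nat (- d) - 1)" by (simp add: power_int_def power_inverse)
      then show ?thesis using * units_inverse[OF u] by metis
    qed
  qed
qed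

text \<open>
  Two uniformizers differ by a unit, so the exponent does not depend on the uniformizer, and the
  description in the definition of \<open>place_val\<close> has a unique solution.
\<close>
lemma place_val_eqI:
  assumes P: "P \<in> places \<iota>" and t: "uniformizer P t" and u: "u \<in> units P"
  shows "place_val P (t powi k * u) = k"
  unfolding place_val_def
proof (rule the_equality)
  show "\<exists>ta ua. P = {ta * w |w. w \<in> place_ring P} \<and> ua \<noteq> 0 \<and> ua \<in> place_ring P \<and>
      inverse ua \<in> place_ring P \<and> t powi k * u = ta powi k * ua"
    using t u unfolding uniformizer_def units_def by blast
next
  interpret place \<iota> P by (rule place[OF P])
  fix k' assume "\<exists>ta ua. P = {ta * w |w. w \<in> place_ring P} \<and> ua \<noteq> 0 \<and> ua \<in> place_ring P \<and>
      inverse ua \<in> place_ring P \<and> t powi k * u = ta powi k' * ua"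
  then obtain t' u' where t': "P = {t' * w |w. w \<in> place_ring P}" and u': "u' \<in> units P"
    and e: "t powi k * u = t' powi k' * u'" unfolding units_def by blast
  have t0: "t \<noteq> 0" using t unfolding uniformizer_def by blast
  have tP: "t \<in> P" by (rule uniformizer_in[OF P t])
  obtain w where w: "t = t' * w" "w \<in> V" using tP t' by auto
  have t'0: "t' \<noteq> 0" using w(1) t0 by auto
  then have ut': "uniformizer P t'" using t' unfolding uniformizer_def by blast
  have "t' / t \<in> V" by (rule uniformizer_div[OF t uniformizer_in[OF P ut']])
  then have wu: "w \<in> units P" unfolding units_def using w t0 by (auto simp: field_simps)
  have "t' = t * inverse w" using w t0 by auto
  then have "t' powi k' = t powi k' * inverse w powi k'" by (simp add: power_int_mult_distrib)
  then have "t powi k * u = t powi k' * (inverse w powi k' * u')" using e by (simp add: mult.assoc)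
  then have e2: "t powi k * u = t powi k' * (inverse w powi k' * u')" .
  have "u \<noteq> 0" using u unfolding units_def by blast
  then have "t powi k = t powi k * u * inverse u" by simp
  also have "\<dots> = t powi k' * (inverse w powi k' * u' * inverse u)" unfolding e2 by (simp add: mult.assoc)
  finally have "t powi (k - k') = inverse w powi k' * u' * inverse u"
    using t0 by (simp add: power_int_diff)
  moreover have "inverse w powi k' * u' * inverse u \<in> units P"
    by (intro units_mult[OF P] units_powi[OF P] units_inverse wu u u')
  ultimately have "k - k' = 0" using power_in_units[OF P tP t0] by metis
  then show "k' = k" by simp
qed

lemma place_val_decompose:
  assumes P: "P \<in> places \<iota>" and t: "uniformizer P t" and w: "w \<noteq> 0"
  shows "\<exists>u\<in>units P. w = t powi place_val P w * u"
  using decompose[OF assms] place_val_eqI[OF P t] by metis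

lemma place_val_uniformizer: "P \<in> places \<iota> \<Longrightarrow> uniformizer P t \<Longrightarrow> place_val P t = 1"
  using place_val_eqI[of P t 1 1] units_1 by simp

lemma place_val_mult:
  assumes P: "P \<in> places \<iota>" and "z \<noteq> 0" "w \<noteq> 0"
  shows "place_val P (z * w) = place_val P z + place_val P w"
proof -
  obtain t where t: "uniformizer P t" using ex_uniformizer[OF P] by blast
  have t0: "t \<noteq> 0" using t unfolding uniformizer_def by blast
  obtain u v where u: "u \<in> units P" "z = t powi place_val P z * u"
    and v: "v \<in> units P" "w = t powi place_val P w * v"
    using place_val_decompose[OF P t] assms by metis
  have "z * w = t powi (place_val P z + place_val P w) * (u * v)"
    by (subst u(2), subst v(2)) (simp add: power_int_add t0)
  then show ?thesis using place_val_eqI[OF P t units_mult[OF P u(1) v(1)]] by metis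
qed

lemma place_val_unit: "P \<in> places \<iota> \<Longrightarrow> u \<in> units P \<Longrightarrow> place_val P u = 0"
  using ex_uniformizer place_val_eqI[of P _ u 0] by fastforce

lemma place_val_1: "P \<in> places \<iota> \<Longrightarrow> place_val P 1 = 0"
  using place_val_unit units_1 by blast

lemma place_val_inverse:
  assumes P: "P \<in> places \<iota>" and "z \<noteq> 0"
  shows "place_val P (inverse z) = - place_val P z"
  using place_val_mult[OF P assms(2), of "inverse z"] place_val_1[OF P] assms(2) by simp

lemma place_val_power:
  assumes P: "P \<in> places \<iota>" and "z \<noteq> 0"
  shows "place_val P (z ^ i) = int i * place_val P z"
  by (induction i) (use assms in \<open>auto simp: place_val_1 place_val_mult algebra_simps\<close>)

lemma place_val_powi:
  assumes P: "P \<in> places \<iota>" and "z \<noteq> 0"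
  shows "place_val P (z powi i) = i * place_val P z"
  unfolding power_int_def using assms by (auto simp: place_val_power place_val_inverse)

lemma place_val_prod:
  assumes P: "P \<in> places \<iota>" and "\<And>i. i \<in> S \<Longrightarrow> f i \<noteq> 0"
  shows "place_val P (prod f S) = (\<Sum>i\<in>S. place_val P (f i))"
  using assms(2) by (induction S rule: infinite_finite_induct) (auto simp: place_val_1[OF P] place_val_mult[OF P])

lemma ring_iff_val:
  assumes P: "P \<in> places \<iota>" and "z \<noteq> 0"
  shows "z \<in> place_ring P \<longleftrightarrow> 0 \<le> place_val P z"
proof -
  interpret place \<iota> P by (rule place[OF P])
  obtain t where t: "uniformizer P t" using ex_uniformizer[OF P] by blast
  have tP: "t \<in> P" by (rule uniformizer_in[OF P t])
  have pos: "w \<in> V" if w: "w \<noteq> 0" "0 \<le> place_val P w" for w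
  proof -
    obtain u where u: "u \<in> units P" "w = t powi place_val P w * u" using place_val_decompose[OF P t w(1)] by blast
    have "t powi place_val P w = t ^ nat (place_val P w)" using w(2) by (simp add: power_int_def)
    then have "t powi place_val P w * u \<in> V" using u(1) ring_mult ring_power place_subset[OF tP] unfolding units_def by auto
    then show ?thesis using u(2) by metis
  qed
  show ?thesis
  proof
    assume z: "z \<in> V"
    show "0 \<le> place_val P z"
    proof (rule ccontr)
      assume n: "\<not> 0 \<le> place_val P z"
      then have "inverse z \<in> V" using pos[of "inverse z"] assms(2) place_val_inverse[OF P] by simp
      then have "z \<in> units P" using z assms(2) unfolding units_def by simp
      then show False using place_val_unit[OF P] n by simp
    qed
  qed (use pos assms in auto)
qed

lemma place_iff_val:
  assumes P: "P \<in> places \<iota>" and "z \<noteq> 0"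
  shows "z \<in> P \<longleftrightarrow> 1 \<le> place_val P z"
  using place.place_not_ring[OF place[OF P] assms(2)] ring_iff_val[OF P, of "inverse z"]
    place_val_inverse[OF P] assms(2) by auto

text \<open>
  The condition \<open>v\<^sub>P(z) \<ge> k\<close> with the convention \<open>v\<^sub>P(0) = \<infinity>\<close>. Unlike \<open>place_val\<close> itself it is
  compatible with sums and products without side conditions on zero.
\<close>
definition vge :: "'f set \<Rightarrow> int \<Rightarrow> 'f \<Rightarrow> bool" where
  "vge P k z \<longleftrightarrow> z = 0 \<or> k \<le> place_val P z"

lemma vge_0: "vge P k 0" by (simp add: vge_def)
lemma vge_mono: "vge P k z \<Longrightarrow> l \<le> k \<Longrightarrow> vge P l z" by (auto simp: vge_def)
lemma vge_mult: "P \<in> places \<iota> \<Longrightarrow> vge P k z \<Longrightarrow> vge P l w \<Longrightarrow> vge P (k + l) (z * w)"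
  using place_val_mult[of P z w] unfolding vge_def by (cases "z = 0"; cases "w = 0") auto
lemma vge_ring: "P \<in> places \<iota> \<Longrightarrow> vge P 0 z \<longleftrightarrow> z \<in> place_ring P"
  unfolding vge_def using ring_iff_val[of P z] place.ring_0[OF place] by auto
lemma vge_place: "P \<in> places \<iota> \<Longrightarrow> vge P 1 z \<longleftrightarrow> z \<in> P"
  unfolding vge_def using place_iff_val[of P z] place.place_0[OF place] by auto

lemma vge_divide: "P \<in> places \<iota> \<Longrightarrow> w \<noteq> 0 \<Longrightarrow> vge P k (z / w) \<longleftrightarrow> vge P (k + place_val P w) z"
  unfolding vge_def divide_inverse using place_val_mult[of P z "inverse w"] place_val_inverse[of P w]
  by (cases "z = 0") auto

lemma vge_add: 
  assumes P: "P \<in> places \<iota>" and "vge P k z" "vge P k w"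
  shows "vge P k (z + w)"
proof -
  obtain t where t: "uniformizer P t" using ex_uniformizer[OF P] by blast
  have t0: "t powi k \<noteq> 0" using t unfolding uniformizer_def by simp
  have v: "place_val P (t powi k) = k" 
    using place_val_powi[OF P] place_val_uniformizer[OF P t] t unfolding uniformizer_def by simp
  have *: "vge P k x \<longleftrightarrow> x / t powi k \<in> place_ring P" for x
    using vge_divide[OF P t0, of 0 x] v vge_ring[OF P] by simp
  show ?thesis using assms(2,3) place.ring_add[OF place[OF P]] unfolding * add_divide_distrib by blast
qed

lemma vge_minus: "P \<in> places \<iota> \<Longrightarrow> vge P k (- z) \<longleftrightarrow> vge P k z"
proof -
  assume P: "P \<in> places \<iota>"
  have "- 1 \<in> place_ring P" using place.ring_minus[OF place[OF P]] place.ring_1[OF place[OF P]] by blast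
  then have "vge P 0 (- 1)" using vge_ring[OF P] by blast
  then have "vge P k (- z)" if "vge P k z" for z using vge_mult[OF P, of 0 "-1" k z] that by simp
  from this[of z] this[of "- z"] show ?thesis by auto
qed

lemma vge_diff: "P \<in> places \<iota> \<Longrightarrow> vge P k z \<Longrightarrow> vge P k w \<Longrightarrow> vge P k (z - w)"
  using vge_add[of P k z "- w"] vge_minus by simp

lemma vge_sum: "P \<in> places \<iota> \<Longrightarrow> (\<And>i. i \<in> S \<Longrightarrow> vge P k (f i)) \<Longrightarrow> vge P k (sum f S)"
  by (induction S rule: infinite_finite_induct) (auto intro: vge_0 vge_add)

lemma place_val_add_less:
  assumes P: "P \<in> places \<iota>" and z: "z \<noteq> 0" and w: "vge P (place_val P z + 1) w"
  shows "z + w \<noteq> 0 \<and> place_val P (z + w) = place_val P z"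
proof -
  have n: "\<not> vge P (place_val P z + 1) (z + w)"
  proof
    assume "vge P (place_val P z + 1) (z + w)"
    then have "vge P (place_val P z + 1) (z + w - w)" using w vge_diff[OF P] by blast
    then show False using z by (simp add: vge_def)
  qed
  have "vge P (place_val P z) (z + w)"
    using vge_add[OF P, of "place_val P z" z w] w vge_mono by (simp add: vge_def)
  then show ?thesis using n unfolding vge_def by auto
qed

lemma const_val: "P \<in> places \<iota> \<Longrightarrow> c \<noteq> 0 \<Longrightarrow> place_val P (\<iota> c) = 0"
  using place_val_unit units_iff place.const_in_ring[OF place] place.const_in_place[OF place] by metis

section \<open>Residue fields\<close>

text \<open>
  The residue classes of \<open>B\<close> are linearly independent over the constant field, and distinct.
\<close>
definition residue_independent :: "'f set \<Rightarrow> 'f set \<Rightarrow> bool" where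
  "residue_independent P B \<longleftrightarrow> finite B \<and> B \<subseteq> place_ring P \<and>
     (\<forall>c. (\<Sum>b\<in>B. \<iota> (c b) * b) \<in> P \<longrightarrow> (\<forall>b\<in>B. c b = 0))"

definition combos :: "'f set \<Rightarrow> 'f set" where
  "combos B = (\<lambda>c. \<Sum>b\<in>B. \<iota> (c b) * b) ` (B \<rightarrow>\<^sub>E UNIV)"

lemma combosI: "(\<Sum>b\<in>B. \<iota> (c b) * b) \<in> combos B"
proof -
  have eq: "(\<Sum>b\<in>B. \<iota> (c b) * b) = (\<Sum>b\<in>B. \<iota> (restrict c B b) * b)" by (intro sum.cong) auto
  show ?thesis unfolding combos_def by (rule image_eqI[where x = "restrict c B"], rule eq, simp)
qed

lemma combosE: "w \<in> combos B \<Longrightarrow> \<exists>c. w = (\<Sum>b\<in>B. \<iota> (c b) * b)"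
  unfolding combos_def by blast

lemma combos_diff: "v \<in> combos B \<Longrightarrow> w \<in> combos B \<Longrightarrow> v - w \<in> combos B"
proof -
  assume "v \<in> combos B" "w \<in> combos B"
  then obtain c d where "v = (\<Sum>b\<in>B. \<iota> (c b) * b)" "w = (\<Sum>b\<in>B. \<iota> (d b) * b)" using combosE by metis
  then have "v - w = (\<Sum>b\<in>B. \<iota> (c b - d b) * b)"
    by (simp add: field_embedding_diff[OF emb] left_diff_distrib sum_subtractf)
  then show ?thesis using combosI[of "\<lambda>b. c b - d b" B] by simp
qed

lemma combos_residue_independent:
  assumes P: "P \<in> places \<iota>" and B: "residue_independent P B"
  shows "finite (combos B)" "combos B \<noteq> {}" "combos B \<subseteq> place_ring P" 
    "\<And>w. w \<in> combos B \<Longrightarrow> w \<in> P \<Longrightarrow> w = 0" "card (combos B) = CARD('k) ^ card B"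
proof -
  interpret place \<iota> P by (rule place[OF P])
  have finB: "finite B" and BV: "B \<subseteq> V" using B unfolding residue_independent_def by auto
  have ind: "(\<Sum>b\<in>B. \<iota> (c b) * b) \<in> P \<Longrightarrow> \<forall>b\<in>B. c b = 0" for c using B unfolding residue_independent_def by blast
  show "finite (combos B)" unfolding combos_def using finB by (intro finite_imageI finite_PiE) auto
  show "combos B \<noteq> {}" using combosI by blast
  show "combos B \<subseteq> V" using BV by (auto dest!: combosE intro!: ring_sum ring_mult const_in_ring)
  show "w = 0" if "w \<in> combos B" "w \<in> P" for w
  proof -
    obtain c where c: "w = (\<Sum>b\<in>B. \<iota> (c b) * b)" using combosE[OF \<open>w \<in> combos B\<close>] by blast
    then have "\<forall>b\<in>B. c b = 0" using ind that by blast
    then show ?thesis unfolding c by (simp add: field_embedding_0[OF emb])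
  qed
  have "inj_on (\<lambda>c. \<Sum>b\<in>B. \<iota> (c b) * b) (B \<rightarrow>\<^sub>E UNIV)"
  proof (rule inj_onI)
    fix c d assume cd: "c \<in> B \<rightarrow>\<^sub>E UNIV" "d \<in> B \<rightarrow>\<^sub>E UNIV" "(\<Sum>b\<in>B. \<iota> (c b) * b) = (\<Sum>b\<in>B. \<iota> (d b) * b)"
    then have "(\<Sum>b\<in>B. \<iota> (c b - d b) * b) = 0"
      by (simp add: field_embedding_diff[OF emb] left_diff_distrib sum_subtractf)
    then have "\<forall>b\<in>B. c b - d b = 0" using ind[of "\<lambda>b. c b - d b"] place_0 by simp
    then show "c = d" by (intro PiE_ext[OF cd(1,2)]) auto
  qed
  then show "card (combos B) = CARD('k) ^ card B"
    unfolding combos_def using finB by (simp add: card_image card_PiE)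
qed

lemma residue_independent_bound:
  assumes P: "P \<in> places \<iota>"
  shows "\<exists>M. \<forall>B. residue_independent P B \<longrightarrow> card B \<le> M"
proof -
  interpret place \<iota> P by (rule place[OF P])
  obtain z where z: "z \<in> range \<kappa>" "z \<noteq> 0" "z \<in> P" using base_element_in_place[OF P] by blast
  have "card B \<le> m * height z" if B: "residue_independent P B" for B
  proof -
    note c = combos_residue_independent[OF P B]
    have i: "x = 0" if "x \<in> V" "z * x \<in> combos B" for x
      using c(4)[OF that(2)] place_mult[OF z(3) that(1)] z(2) by simp
    have "card (combos B) \<le> CARD('k) ^ (m * height z)"
      by (rule card_le_height[where \<Lambda> = V, OF z(1,2) ring_diff ring_mult[OF place_subset[OF z(3)]] c(1,3,2) combos_diff i])
    then show ?thesis unfolding c(5) using q_gt_1 by simp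
  qed
  then show ?thesis by blast
qed

text \<open>
  Residue-independent sets have bounded size: their combinations lie in the valuation ring and only
  zero is divisible by an element \<open>z \<in> P\<close> of \<open>k(x)\<close>. One of maximal size is a basis.
\<close>
lemma ex_residue_basis:
  assumes P: "P \<in> places \<iota>"
  shows "\<exists>B. residue_independent P B \<and> residue_basis \<iota> P B"
proof -
  interpret place \<iota> P by (rule place[OF P])
  obtain M where M: "\<And>B. residue_independent P B \<Longrightarrow> card B \<le> M" using residue_independent_bound[OF P] by blast
  have e: "residue_independent P {}" unfolding residue_independent_def by simp
  have "\<exists>B. residue_independent P B \<and> (\<forall>B'. residue_independent P B' \<longrightarrow> card B' \<le> card B)"
    using ex_has_greatest_nat[of "residue_independent P" "{}" card "Suc M"] e M by (simp add: less_Suc_eq_le)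
  then obtain B where B: "residue_independent P B" and max: "\<And>B'. residue_independent P B' \<Longrightarrow> card B' \<le> card B" by blast
  have finB: "finite B" and BV: "B \<subseteq> V" using B unfolding residue_independent_def by auto
  have ind: "(\<Sum>b\<in>B. \<iota> (c b) * b) \<in> P \<Longrightarrow> \<forall>b\<in>B. c b = 0" for c using B unfolding residue_independent_def by blast
  have ex: "\<exists>c. z - (\<Sum>b\<in>B. \<iota> (c b) * b) \<in> P" if z: "z \<in> V" for z
  proof (rule ccontr)
    assume no: "\<not> ?thesis"
    then have no': "z - (\<Sum>b\<in>B. \<iota> (c b) * b) \<notin> P" for c by simp
    have zB: "z \<notin> B"
    proof
      assume zB: "z \<in> B"
      have "(\<Sum>b\<in>B. \<iota> (if b = z then 1 else 0) * b) = (\<Sum>b\<in>{z}. b)"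
        using zB finB by (intro sum.mono_neutral_cong_right) (auto simp: field_embedding_0[OF emb] field_embedding_1[OF emb])
      then show False using no'[of "\<lambda>b. if b = z then 1 else 0"] place_0 by simp
    qed
    have "residue_independent P (insert z B)"
      unfolding residue_independent_def
    proof (intro conjI allI impI)
      show "finite (insert z B)" "insert z B \<subseteq> V" using finB BV z by auto
      fix c assume c: "(\<Sum>b\<in>insert z B. \<iota> (c b) * b) \<in> P"
      then have c': "\<iota> (c z) * z + (\<Sum>b\<in>B. \<iota> (c b) * b) \<in> P" using finB zB by simp
      have cz: "c z = 0"
      proof (rule ccontr)
        assume n: "c z \<noteq> 0"
        have "\<iota> (inverse (c z)) * (\<iota> (c z) * z + (\<Sum>b\<in>B. \<iota> (c b) * b)) \<in> P"
          by (rule place_mult'[OF const_in_ring c'])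
        also have "\<iota> (inverse (c z)) * (\<iota> (c z) * z + (\<Sum>b\<in>B. \<iota> (c b) * b))
          = z - (\<Sum>b\<in>B. \<iota> (- (inverse (c z) * c b)) * b)"
        proof -
          have "\<iota> (inverse (c z)) * (\<iota> (c z) * z) = z"
            using n by (simp add: field_embedding_inverse[OF emb] field_embedding_eq_0[OF emb])
          then show ?thesis
            by (simp add: distrib_left sum_distrib_left field_embedding_minus[OF emb] field_embedding_mult[OF emb] sum_negf mult.assoc)
        qed
        finally show False using no'[of "\<lambda>b. - (inverse (c z) * c b)"] by simp
      qed
      then have "(\<Sum>b\<in>B. \<iota> (c b) * b) \<in> P" using c' by (simp add: field_embedding_0[OF emb])
      then have "\<forall>b\<in>B. c b = 0" using ind by blast
      then show "\<forall>b\<in>insert z B. c b = 0" using cz by simp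
    qed
    then show False using max[of "insert z B"] finB zB by simp
  qed
  have "residue_basis \<iota> P B"
    unfolding residue_basis_def
  proof (intro conjI ballI)
    show "finite B" "B \<subseteq> V" by fact+
    fix z assume z: "z \<in> V"
    obtain c where c: "z - (\<Sum>b\<in>B. \<iota> (c b) * b) \<in> P" using ex[OF z] by blast
    have eq: "(\<Sum>b\<in>B. \<iota> (restrict c B b) * b) = (\<Sum>b\<in>B. \<iota> (c b) * b)" by (intro sum.cong) auto
    show "\<exists>!c. c \<in> B \<rightarrow>\<^sub>E UNIV \<and> z - (\<Sum>b\<in>B. \<iota> (c b) * b) \<in> P"
    proof (rule ex1I[of _ "restrict c B"])
      show "restrict c B \<in> B \<rightarrow>\<^sub>E UNIV \<and> z - (\<Sum>b\<in>B. \<iota> (restrict c B b) * b) \<in> P" unfolding eq using c by simp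
      fix d assume d: "d \<in> B \<rightarrow>\<^sub>E UNIV \<and> z - (\<Sum>b\<in>B. \<iota> (d b) * b) \<in> P"
      have "(z - (\<Sum>b\<in>B. \<iota> (d b) * b)) - (z - (\<Sum>b\<in>B. \<iota> (c b) * b)) \<in> P" using d c place_diff by blast
      also have "(z - (\<Sum>b\<in>B. \<iota> (d b) * b)) - (z - (\<Sum>b\<in>B. \<iota> (c b) * b)) = (\<Sum>b\<in>B. \<iota> (c b - d b) * b)"
        by (simp add: field_embedding_diff[OF emb] left_diff_distrib sum_subtractf)
      finally have "\<forall>b\<in>B. c b - d b = 0" using ind[of "\<lambda>b. c b - d b"] by blast
      then show "d = restrict c B" using d by (intro PiE_ext[of d B "\<lambda>_. UNIV"]) auto
    qed
  qed
  then show ?thesis using B by blast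
qed

lemma residue_basis_card_le:
  assumes P: "P \<in> places \<iota>" and B: "residue_basis \<iota> P B" and B': "residue_basis \<iota> P B'"
  shows "card B \<le> card B'"
proof -
  interpret place \<iota> P by (rule place[OF P])
  define S where "S B c = (\<Sum>b\<in>B. \<iota> (c b) * b)" for B and c :: "'f \<Rightarrow> 'k"
  have fin: "finite B" "finite B'" and BV: "B \<subseteq> V" and
    u: "\<And>z. z \<in> V \<Longrightarrow> \<exists>!c. c \<in> B \<rightarrow>\<^sub>E (UNIV :: 'k set) \<and> z - S B c \<in> P" and
    u': "\<And>z. z \<in> V \<Longrightarrow> \<exists>!c. c \<in> B' \<rightarrow>\<^sub>E (UNIV :: 'k set) \<and> z - S B' c \<in> P"
    using B B' unfolding residue_basis_def S_def by auto
  have SV: "S B c \<in> V" for c unfolding S_def using BV by (intro ring_sum ring_mult const_in_ring) auto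
  have "\<forall>c. \<exists>d. d \<in> B' \<rightarrow>\<^sub>E (UNIV :: 'k set) \<and> S B c - S B' d \<in> P" using u'[OF SV] by (blast dest: ex1_implies_ex)
  then obtain f where f: "\<And>c. f c \<in> B' \<rightarrow>\<^sub>E (UNIV :: 'k set)" "\<And>c. S B c - S B' (f c) \<in> P" by metis
  have "inj_on f (B \<rightarrow>\<^sub>E UNIV)"
  proof (rule inj_onI)
    fix c d assume cd: "c \<in> B \<rightarrow>\<^sub>E UNIV" "d \<in> B \<rightarrow>\<^sub>E UNIV" "f c = f d"
    have "(S B c - S B' (f c)) - (S B d - S B' (f d)) \<in> P" using f(2) place_diff by blast
    then have "S B c - S B d \<in> P" using cd(3) by simp
    moreover have "S B c - S B c \<in> P" using place_0 by simp
    ultimately show "c = d" using u[OF SV[of c]] cd(1,2) by blast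
  qed
  then have "card (B \<rightarrow>\<^sub>E (UNIV :: 'k set)) \<le> card (B' \<rightarrow>\<^sub>E (UNIV :: 'k set))"
    using f(1) fin by (intro card_inj_on_le[of f] finite_PiE) auto
  then show ?thesis using fin q_gt_1 by (simp add: card_PiE)
qed

lemma place_degree_eq:
  assumes P: "P \<in> places \<iota>" and B: "residue_basis \<iota> P B"
  shows "place_degree \<iota> P = card B"
  unfolding place_degree_def
  by (rule the_equality) (use residue_basis_card_le[OF P] B in \<open>auto intro: le_antisym\<close>)

text \<open>
  A system of representatives of the residue field that is closed under subtraction, the form in which
  residue fields enter the counts below.
\<close>
lemma place_reps:
  assumes P: "P \<in> places \<iota>"
  shows "\<exists>R. finite R \<and> R \<noteq> {} \<and> card R = CARD('k) ^ place_degree \<iota> P \<and> R \<subseteq> place_ring P \<and>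
    (\<forall>v\<in>R. \<forall>w\<in>R. v - w \<in> R) \<and> (\<forall>w\<in>R. w \<in> P \<longrightarrow> w = 0) \<and> (\<forall>z\<in>place_ring P. \<exists>w\<in>R. z - w \<in> P)"
proof -
  obtain B where B: "residue_independent P B" "residue_basis \<iota> P B" using ex_residue_basis[OF P] by blast
  note c = combos_residue_independent[OF P B(1)]
  have "\<exists>w\<in>combos B. z - w \<in> P" if "z \<in> place_ring P" for z
  proof -
    have "\<exists>!c. c \<in> B \<rightarrow>\<^sub>E (UNIV :: 'k set) \<and> z - (\<Sum>b\<in>B. \<iota> (c b) * b) \<in> P"
      using B(2) that unfolding residue_basis_def by simp
    then obtain c :: "'f \<Rightarrow> 'k" where "z - (\<Sum>b\<in>B. \<iota> (c b) * b) \<in> P" by (elim ex1E conjE)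
    then show ?thesis by (intro bexI[OF _ combosI[of c B]])
  qed
  then show ?thesis using c combos_diff place_degree_eq[OF P B(2)]
    by (intro exI[of _ "combos B"]) auto
qed

lemma place_degree_pos:
  assumes P: "P \<in> places \<iota>"
  shows "place_degree \<iota> P \<ge> 1"
proof (rule ccontr)
  interpret place \<iota> P by (rule place[OF P])
  assume "\<not> ?thesis"
  then obtain R where R: "card R = 1" "\<forall>v\<in>R. \<forall>w\<in>R. v - w \<in> R" "\<forall>z\<in>place_ring P. \<exists>w\<in>R. z - w \<in> P"
    using place_reps[OF P] by (auto simp: not_le)
  then obtain r where r: "R = {r}" using card_1_singletonE by metis
  then have "r = 0" using R(2) by simp
  then show False using R(3) r ring_1 one_notin_place by auto
qed

end

context function_field begin

section \<open>Approximation and the number of zeros\<close>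

text \<open>
  A discrete valuation ring is a maximal proper subring: if \<open>w\<close> is outside the ring of \<open>P\<close>, then every
  element is in that ring after division by a power of \<open>w\<close>.
\<close>
lemma exists_ring_diff:
  assumes P: "P \<in> places \<iota>" and Q: "Q \<in> places \<iota>" and ne: "P \<noteq> Q"
  shows "\<exists>a. a \<in> place_ring P \<and> a \<notin> place_ring Q"
proof (rule ccontr)
  assume "\<not> ?thesis"
  then have sub: "place_ring P \<subseteq> place_ring Q" by blast
  interpret P: place \<iota> P by (rule place[OF P])
  interpret Q: place \<iota> Q by (rule place[OF Q])
  have "place_ring P \<noteq> place_ring Q" using ne places_cases(2)[OF P] places_cases(2)[OF Q] by metis
  then obtain w where w: "w \<in> place_ring Q" "w \<notin> place_ring P" using sub by blast
  have w0: "w \<noteq> 0" using w P.ring_0 by metis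
  have wneg: "place_val P w \<le> -1" using w(2) ring_iff_val[OF P w0] by simp
  obtain x where x: "x \<notin> place_ring Q" using Q.ring_proper by blast
  have x0: "x \<noteq> 0" using x Q.ring_0 by metis
  define j where "j = nat \<bar>place_val P x\<bar>"
  have "int j * place_val P w \<le> - int j" using mult_left_mono[OF wneg, of "int j"] by simp
  then have "0 \<le> place_val P x - int j * place_val P w" unfolding j_def by linarith
  also have "\<dots> = place_val P (x * inverse (w ^ j))"
    using place_val_mult[OF P x0, of "inverse (w ^ j)"] place_val_inverse[OF P, of "w ^ j"] place_val_power[OF P w0] w0
    by simp
  finally have "x * inverse (w ^ j) \<in> place_ring P" using ring_iff_val[OF P] x0 w0 by simp
  then have "x * inverse (w ^ j) * w ^ j \<in> place_ring Q" using sub w(1) Q.ring_mult Q.ring_power by blast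
  moreover have "inverse (w ^ j) * w ^ j = 1" by (rule left_inverse) (simp add: w0)
  then have "x * inverse (w ^ j) * w ^ j = x" by (simp only: mult.assoc mult_1_right)
  ultimately show False using x by metis
qed

lemma separate_two:
  assumes P: "P \<in> places \<iota>" and Q: "Q \<in> places \<iota>" and ne: "P \<noteq> Q"
  shows "\<exists>z. z \<noteq> 0 \<and> place_val P z \<ge> 1 \<and> place_val Q z \<le> -1"
proof -
  obtain a where a: "a \<in> place_ring P" "a \<notin> place_ring Q" using exists_ring_diff[OF P Q ne] by blast
  obtain b where b: "b \<in> place_ring Q" "b \<notin> place_ring P" using exists_ring_diff[OF Q P] ne by metis
  have nz: "a \<noteq> 0" "b \<noteq> 0" using a b place.ring_0[OF place[OF Q]] place.ring_0[OF place[OF P]] by metis+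
  have "place_val P a \<ge> 0" "place_val Q a < 0" "place_val Q b \<ge> 0" "place_val P b < 0"
    using a b nz ring_iff_val[OF P] ring_iff_val[OF Q] by (simp_all add: not_le flip: ring_iff_val)
  then show ?thesis
    using nz place_val_mult[OF P nz(1), of "inverse b"] place_val_inverse[OF P nz(2)]
      place_val_mult[OF Q nz(1), of "inverse b"] place_val_inverse[OF Q nz(2)]
    by (intro exI[of _ "a * inverse b"]) simp
qed

lemma place_val_add_neq:
  assumes P: "P \<in> places \<iota>" and "y \<noteq> 0" "z \<noteq> 0" "place_val P y \<noteq> place_val P z"
  shows "y + z \<noteq> 0 \<and> place_val P (y + z) = min (place_val P y) (place_val P z)"
proof (cases "place_val P y < place_val P z")
  case True
  then show ?thesis using place_val_add_less[OF P assms(2), of z] by (simp add: vge_def)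
next
  case False
  then show ?thesis using place_val_add_less[OF P assms(3), of y] assms(4)
    by (simp add: vge_def add.commute)
qed

text \<open>
  Induction on the set of poles: to a function \<open>y\<close> that works for \<open>S\<close> one adds a power of a function
  \<open>z\<close> that separates \<open>P\<close> from the new place \<open>Q\<close>. With a large exponent no cancellation can occur at the
  places of \<open>insert Q S\<close>.
\<close>
lemma separate_many:
  assumes P: "P \<in> places \<iota>" and S: "finite S" "S \<subseteq> places \<iota>" "P \<notin> S"
  shows "\<exists>z. z \<noteq> 0 \<and> place_val P z \<ge> 1 \<and> (\<forall>Q\<in>S. place_val Q z \<le> -1)"
  using S
proof (induction S rule: finite_induct)
  case empty
  obtain t where "uniformizer P t" using ex_uniformizer[OF P] by blast
  then show ?case using place_val_uniformizer[OF P] unfolding uniformizer_def by (intro exI[of _ t]) auto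
next
  case (insert Q S)
  obtain y where y: "y \<noteq> 0" "place_val P y \<ge> 1" "\<And>Q. Q \<in> S \<Longrightarrow> place_val Q y \<le> -1" using insert by auto
  have Q: "Q \<in> places \<iota>" using insert by blast
  have "P \<noteq> Q" using insert.prems by blast
  then obtain z where z: "z \<noteq> 0" "place_val P z \<ge> 1" "place_val Q z \<le> -1"
    using separate_two[OF P Q] by blast
  \<comment> \<open>An exponent larger than every order of \<open>y\<close> in absolute value.\<close>
  define r where "r = Suc (nat (\<Sum>R\<in>insert Q S. \<bar>place_val R y\<bar>))"
  have r: "\<bar>place_val R y\<bar> < int r" if "R \<in> insert Q S" for R
  proof -
    have "\<bar>place_val R y\<bar> \<le> (\<Sum>R\<in>insert Q S. \<bar>place_val R y\<bar>)"
      using that insert.hyps by (intro member_le_sum) auto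
    then show ?thesis unfolding r_def by linarith
  qed
  have r1: "1 \<le> int r" unfolding r_def by simp
  have zr: "z ^ r \<noteq> 0" using z by simp
  have vzr: "place_val R (z ^ r) = int r * place_val R z" if "R \<in> places \<iota>" for R
    using place_val_power[OF that z(1)] .
  have Qz: "int r * place_val Q z \<le> - int r" using mult_left_mono[OF z(3), of "int r"] by simp
  have Qw: "y + z ^ r \<noteq> 0 \<and> place_val Q (y + z ^ r) = min (place_val Q y) (place_val Q (z ^ r))"
    using place_val_add_neq[OF Q y(1) zr] Qz vzr[OF Q] r[of Q] by fastforce
  have "place_val R (y + z ^ r) \<le> -1" if R: "R \<in> insert Q S" for R
  proof (cases "R = Q")
    case True
    have "place_val Q (z ^ r) \<le> -1" using vzr[OF Q] Qz r1 by linarith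
    then show ?thesis using Qw True by (simp add: min.coboundedI2)
  next
    case False
    then have RS: "R \<in> S" "R \<in> places \<iota>" using R insert.prems by auto
    have "int r * place_val R z \<noteq> place_val R y"
    proof
      assume e: "int r * place_val R z = place_val R y"
      then have nz: "place_val R z \<noteq> 0" using y(3)[OF RS(1)] by auto
      have "int r * 1 \<le> int r * \<bar>place_val R z\<bar>" using nz by (intro mult_left_mono) auto
      also have "\<dots> = \<bar>place_val R y\<bar>" using e by (simp flip: e add: abs_mult)
      finally show False using r[OF R] by simp
    qed
    then have "place_val R (y + z ^ r) = min (place_val R y) (place_val R (z ^ r))"
      using place_val_add_neq[OF RS(2) y(1) zr] vzr[OF RS(2)] by auto
    then show ?thesis using y(3)[OF RS(1)] by simp
  qed
  moreover have "place_val P (y + z ^ r) \<ge> 1"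
  proof -
    have "1 * 1 \<le> int r * place_val P z" using z(2) r1 by (intro mult_mono) auto
    then have "vge P 1 (y + z ^ r)" using y(2) vzr[OF P] by (intro vge_add[OF P]) (auto simp: vge_def)
    then show ?thesis using Qw by (simp add: vge_def)
  qed
  ultimately show ?case using Qw by blast
qed

text \<open>
  If \<open>z\<close> vanishes at \<open>P\<close> and has poles on \<open>S\<close>, then \<open>1 / (1 + z)\<close> is a unit at \<open>P\<close> and vanishes on
  \<open>S\<close>.
\<close>
lemma unit_approx:
  assumes P: "P \<in> places \<iota>" and S: "finite S" "S \<subseteq> places \<iota>" "P \<notin> S"
  shows "\<exists>u. u \<noteq> 0 \<and> place_val P u = 0 \<and> (\<forall>Q\<in>S. place_val Q u \<ge> 1)"
proof -
  obtain z where z: "z \<noteq> 0" "place_val P z \<ge> 1" "\<And>Q. Q \<in> S \<Longrightarrow> place_val Q z \<le> -1"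
    using separate_many[OF assms] by blast
  have Pz: "1 + z \<noteq> 0 \<and> place_val P (1 + z) = place_val P 1"
    using place_val_add_less[OF P, of 1 z] z place_val_1[OF P] by (simp add: vge_def)
  have "place_val Q (1 + z) \<le> -1" if "Q \<in> S" for Q
  proof -
    have Q: "Q \<in> places \<iota>" using that S by blast
    have "place_val Q (z + 1) = place_val Q z"
      using place_val_add_less[OF Q z(1), of 1] place_val_1[OF Q] z(3)[OF that] by (simp add: vge_def)
    then show ?thesis using z(3)[OF that] by (simp add: add.commute)
  qed
  then have "place_val Q (inverse (1 + z)) \<ge> 1" if "Q \<in> S" for Q
    using that Pz place_val_inverse[OF subsetD[OF S(2) that], of "1 + z"] by fastforce
  moreover have "place_val P (inverse (1 + z)) = 0"
    using Pz place_val_1[OF P] place_val_inverse[OF P, of "1 + z"] by simp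
  ultimately show ?thesis using Pz by (intro exI[of _ "inverse (1 + z)"]) simp
qed

text \<open>
  \<open>W\<close> represents the functions regular on \<open>S\<close> modulo those that vanish to order \<open>e P\<close> at each \<open>P\<close>. It
  is enlarged one order at a time: to raise \<open>e P\<close> from \<open>n0\<close> to \<open>n0 + 1\<close> one adds \<open>u * r\<close>, where \<open>u\<close> has
  order \<open>n0\<close> at \<open>P\<close> and high order on the rest of \<open>S\<close>, and \<open>r\<close> runs over representatives of the
  residue field.
\<close>
lemma independent_space:
  assumes S: "finite S" "S \<subseteq> places \<iota>"
  shows "\<exists>W. finite W \<and> W \<noteq> {} \<and> (\<forall>x\<in>W. \<forall>y\<in>W. x - y \<in> W) \<and> (\<forall>w\<in>W. \<forall>P\<in>S. vge P 0 w) \<and>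
    (\<forall>w\<in>W. (\<forall>P\<in>S. vge P (int (e P)) w) \<longrightarrow> w = 0) \<and> card W = CARD('k) ^ (\<Sum>P\<in>S. e P * place_degree \<iota> P)"
proof (induction "\<Sum>P\<in>S. e P" arbitrary: e)
  case 0
  then have "\<forall>P\<in>S. e P = 0" using S by simp
  then show ?case by (intro exI[of _ "{0}"]) (auto simp: vge_0)
next
  case (Suc n)
  have "\<exists>P\<in>S. e P \<noteq> 0"
  proof (rule ccontr)
    assume "\<not> ?thesis"
    then have "(\<Sum>P\<in>S. e P) = 0" by simp
    then show False using Suc(2) by simp
  qed
  then obtain P where PS: "P \<in> S" "e P \<noteq> 0" by blast
  then obtain n0 where n0: "e P = Suc n0" by (cases "e P") auto
  have P: "P \<in> places \<iota>" using PS S by blast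
  define e' where "e' = e(P := n0)"
  have sum_split: "(\<Sum>Q\<in>S. f (e Q) Q) = f (e P) P + (\<Sum>Q\<in>S - {P}. f (e Q) Q)"
    "(\<Sum>Q\<in>S. f (e' Q) Q) = f n0 P + (\<Sum>Q\<in>S - {P}. f (e Q) Q)" for f :: "nat \<Rightarrow> 'f set \<Rightarrow> nat"
    using PS(1) S(1) unfolding e'_def by (simp_all add: sum.remove)
  have "n = (\<Sum>Q\<in>S. e' Q)" using Suc(2) sum_split[of "\<lambda>x _. x"] n0 by simp
  then obtain W where W: "finite W" "W \<noteq> {}" "\<forall>x\<in>W. \<forall>y\<in>W. x - y \<in> W" "\<forall>w\<in>W. \<forall>P\<in>S. vge P 0 w"
    "\<forall>w\<in>W. (\<forall>P\<in>S. vge P (int (e' P)) w) \<longrightarrow> w = 0" "card W = CARD('k) ^ (\<Sum>P\<in>S. e' P * place_degree \<iota> P)"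
    using Suc(1)[of e'] by auto
  obtain R where R: "finite R" "R \<noteq> {}" "card R = CARD('k) ^ place_degree \<iota> P" "R \<subseteq> place_ring P"
    "\<forall>v\<in>R. \<forall>w\<in>R. v - w \<in> R" "\<forall>w\<in>R. w \<in> P \<longrightarrow> w = 0"
    using place_reps[OF P] by auto
  obtain t where t: "uniformizer P t" using ex_uniformizer[OF P] by blast
  have t0: "t \<noteq> 0" using t unfolding uniformizer_def by blast
  have "finite (S - {P})" "S - {P} \<subseteq> places \<iota>" "P \<notin> S - {P}" using S by auto
  from unit_approx[OF P this] obtain u0 where u0: "u0 \<noteq> 0" "place_val P u0 = 0" "\<And>Q. Q \<in> S - {P} \<Longrightarrow> place_val Q u0 \<ge> 1"
    by blast
  \<comment> \<open>\<open>h Q\<close> exceeds the loss of order at \<open>Q\<close> caused by \<open>t\<close> and by the representatives.\<close>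
  define h where "h Q = int (e Q) + \<bar>int n0 * place_val Q t\<bar> + (\<Sum>r\<in>R. \<bar>place_val Q r\<bar>)" for Q
  have h0: "0 \<le> h Q" for Q unfolding h_def by (intro add_nonneg_nonneg sum_nonneg) auto
  define N where "N = nat (\<Sum>Q\<in>S. h Q)"
  define u where "u = t ^ n0 * u0 ^ N"
  have u_nz: "u \<noteq> 0" unfolding u_def using t0 u0 by simp
  have valu: "place_val Q u = int n0 * place_val Q t + int N * place_val Q u0" if "Q \<in> places \<iota>" for Q
    unfolding u_def using place_val_mult[OF that] place_val_power[OF that] t0 u0(1) by simp
  have uP: "place_val P u = int n0" using valu[OF P] u0(2) place_val_uniformizer[OF P t] by simp
  have urP: "vge P (int n0) (u * r)" if "r \<in> R" for r
    using vge_mult[OF P, of "int n0" u 0 r] that R(4) vge_ring[OF P] uP by (auto simp: vge_def)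
  have urQ: "vge Q (int (e Q)) (u * r)" if Q: "Q \<in> S - {P}" and r: "r \<in> R" for Q r
  proof (cases "r = 0")
    case True then show ?thesis by (simp add: vge_0)
  next
    case False
    have Qp: "Q \<in> places \<iota>" using Q S by blast
    have "h Q \<le> (\<Sum>Q\<in>S. h Q)" using Q S(1) h0 by (intro member_le_sum) auto
    then have "h Q \<le> int N" unfolding N_def by simp
    also have "\<dots> \<le> int N * place_val Q u0" using mult_left_mono[OF u0(3)[OF Q], of "int N"] by simp
    finally have 1: "h Q \<le> int N * place_val Q u0" .
    have 2: "\<bar>place_val Q r\<bar> \<le> (\<Sum>r\<in>R. \<bar>place_val Q r\<bar>)" using r R(1) by (intro member_le_sum) auto
    have "place_val Q (u * r) = int n0 * place_val Q t + int N * place_val Q u0 + place_val Q r"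
      using place_val_mult[OF Qp u_nz False] valu[OF Qp] by simp
    then show ?thesis using 1 2 unfolding vge_def h_def by linarith
  qed
  define F where "F = (\<lambda>(w, r). w + u * r)"
  have diffF: "F (w, r) - F (w', r') = F (w - w', r - r')" for w r w' r'
    unfolding F_def by (simp add: algebra_simps)
  have zeroF: "w = 0 \<and> r = 0" if wr: "w \<in> W" "r \<in> R" "\<And>Q. Q \<in> S \<Longrightarrow> vge Q (int (e Q)) (F (w, r))" for w r
  proof -
    have "vge Q (int (e' Q)) w" if Q: "Q \<in> S" for Q
    proof -
      have Qp: "Q \<in> places \<iota>" using Q S by blast
      have "int (e' Q) \<le> int (e Q)" unfolding e'_def using n0 by simp
      then have 1: "vge Q (int (e' Q)) (F (w, r))" using vge_mono wr(3)[OF Q] by blast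
      have 2: "vge Q (int (e' Q)) (u * r)" using urP[OF wr(2)] urQ[OF _ wr(2), of Q] Q unfolding e'_def by (cases "Q = P") auto
      show ?thesis using vge_diff[OF Qp 1 2] unfolding F_def by simp
    qed
    then have w0: "w = 0" using W(5) wr(1) by blast
    have "vge P (int (Suc n0)) (u * r)" using wr(3)[OF PS(1)] n0 w0 unfolding F_def by simp
    then have "vge P 1 r" using vge_divide[OF P u_nz, of 1 "u * r"] uP u_nz by (simp add: add.commute)
    then have "r \<in> P" using vge_place[OF P] by blast
    then show ?thesis using w0 R(6) wr(2) by blast
  qed
  have inj: "inj_on F (W \<times> R)"
  proof (rule inj_onI, clarify)
    fix w r w' r' assume wr: "w \<in> W" "r \<in> R" "w' \<in> W" "r' \<in> R" "F (w, r) = F (w', r')"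
    have "F (w - w', r - r') = 0" using wr(5) diffF[of w r w' r'] by simp
    then have "w - w' = 0 \<and> r - r' = 0" using wr W(3) R(5) by (intro zeroF) (auto simp: vge_0)
    then show "w = w' \<and> r = r'" by simp
  qed
  show ?case
  proof (intro exI[of _ "F ` (W \<times> R)"] conjI ballI impI)
    show "finite (F ` (W \<times> R))" using W(1) R(1) by simp
    show "F ` (W \<times> R) \<noteq> {}" using W(2) R(2) by simp
    show "card (F ` (W \<times> R)) = CARD('k) ^ (\<Sum>P\<in>S. e P * place_degree \<iota> P)"
      unfolding card_image[OF inj] card_cartesian_product W(6) R(3)
        sum_split(1)[of "\<lambda>x Q. x * place_degree \<iota> Q"] sum_split(2)[of "\<lambda>x Q. x * place_degree \<iota> Q"] n0
      by (simp add: power_add)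
    fix x assume "x \<in> F ` (W \<times> R)"
    then obtain w r where x: "x = F (w, r)" "w \<in> W" "r \<in> R" by auto
    {
      fix y assume "y \<in> F ` (W \<times> R)"
      then obtain w' r' where y: "y = F (w', r')" "w' \<in> W" "r' \<in> R" by auto
      show "x - y \<in> F ` (W \<times> R)" unfolding x(1) y(1) diffF using x y W(3) R(5) by blast
    next
      fix Q assume Q: "Q \<in> S"
      then have Qp: "Q \<in> places \<iota>" using S by blast
      have "vge Q 0 (u * r)"
      proof (cases "Q = P")
        case True then show ?thesis using urP[OF x(3)] vge_mono[of P "int n0" _ 0] by simp
      next
        case False then show ?thesis using urQ[OF _ x(3), of Q] vge_mono[of Q "int (e Q)" _ 0] Q by simp
      qed
      then show "vge Q 0 x" unfolding x(1) F_def using W(4) x(2) Q vge_add[OF Qp] by simp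
    next
      assume a: "\<forall>P\<in>S. vge P (int (e P)) x"
      have "w = 0 \<and> r = 0" by (rule zeroF[OF x(2,3)]) (use a x(1) in blast)
      then show "x = 0" unfolding x(1) F_def by simp
    }
  qed
qed

text \<open>
  The space \<open>W\<close> of \<open>independent_space\<close> for the orders \<open>e P = v\<^sub>P(z)\<close> meets the multiples \<open>z \<Lambda>\<close> of \<open>z\<close>
  in zero, where \<open>\<Lambda>\<close> consists of the functions regular on \<open>S\<close>. This is the inequality
  \<open>\<Sum> e\<^sub>i f\<^sub>i \<le> [F : k(z)]\<close> of ramification theory, with \<open>m * height z\<close> in place of the degree.
\<close>
lemma sum_zeros_le_height:
  assumes z: "z \<in> range \<kappa>" "z \<noteq> 0" and S: "finite S" "S \<subseteq> places \<iota>" 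
    and pos: "\<And>P. P \<in> S \<Longrightarrow> 0 \<le> place_val P z"
  shows "(\<Sum>P\<in>S. nat (place_val P z) * place_degree \<iota> P) \<le> m * height z"
proof -
  define e where "e P = nat (place_val P z)" for P
  obtain W where W: "finite W" "W \<noteq> {}" "\<forall>x\<in>W. \<forall>y\<in>W. x - y \<in> W" "\<forall>w\<in>W. \<forall>P\<in>S. vge P 0 w"
    "\<forall>w\<in>W. (\<forall>P\<in>S. vge P (int (e P)) w) \<longrightarrow> w = 0" "card W = CARD('k) ^ (\<Sum>P\<in>S. e P * place_degree \<iota> P)"
    using independent_space[OF S, of e] by auto
  define \<Lambda> where "\<Lambda> = {x. \<forall>P\<in>S. vge P 0 x}"
  have zx: "vge P (int (e P)) (z * x)" if "P \<in> S" "x \<in> \<Lambda>" for P x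
  proof -
    have "vge P (int (e P)) z" unfolding vge_def e_def using pos[OF that(1)] by simp
    then show ?thesis using vge_mult[of P "int (e P)" z 0 x] that S(2) unfolding \<Lambda>_def by auto
  qed
  have "card W \<le> CARD('k) ^ (m * height z)"
  proof (rule card_le_height[where \<Lambda> = \<Lambda>, OF z])
    show "x - y \<in> \<Lambda>" if "x \<in> \<Lambda>" "y \<in> \<Lambda>" for x y
      using that S(2) vge_diff unfolding \<Lambda>_def by blast
    show "z * x \<in> \<Lambda>" if "x \<in> \<Lambda>" for x
      using zx[OF _ that] vge_mono[of _ "int (e _)" "z * x" 0] unfolding \<Lambda>_def by auto
    show "finite W" "W \<noteq> {}" by fact+
    show "W \<subseteq> \<Lambda>" using W(4) unfolding \<Lambda>_def by blast
    show "x - y \<in> W" if "x \<in> W" "y \<in> W" for x y using W(3) that by blast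
    show "x = 0" if "x \<in> \<Lambda>" "z * x \<in> W" for x
    proof -
      have "z * x = 0" using W(5) that(2) zx[OF _ that(1)] by blast
      then show ?thesis using z(2) by simp
    qed
  qed
  then have "(\<Sum>P\<in>S. e P * place_degree \<iota> P) \<le> m * height z" unfolding W(6) using q_gt_1 by simp
  then show ?thesis unfolding e_def .
qed

lemma finite_zeros:
  assumes z: "z \<in> range \<kappa>" "z \<noteq> 0"
  shows "finite {P \<in> places \<iota>. 1 \<le> place_val P z}"
proof (rule ccontr)
  assume "infinite {P \<in> places \<iota>. 1 \<le> place_val P z}"
  then obtain S where S: "finite S" "card S = Suc (m * height z)" "S \<subseteq> {P \<in> places \<iota>. 1 \<le> place_val P z}"
    using infinite_arbitrarily_large[of "{P \<in> places \<iota>. 1 \<le> place_val P z}" "Suc (m * height z)"] by blast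
  have "(\<Sum>P\<in>S. 1) \<le> (\<Sum>P\<in>S. nat (place_val P z) * place_degree \<iota> P)"
  proof (rule sum_mono)
    fix P assume "P \<in> S"
    then have "P \<in> places \<iota>" "1 \<le> place_val P z" using S(3) by auto
    then have "1 * 1 \<le> nat (place_val P z) * place_degree \<iota> P" using place_degree_pos by (intro mult_le_mono) auto
    then show "1 \<le> nat (place_val P z) * place_degree \<iota> P" by simp
  qed
  also have "\<dots> \<le> m * height z" using S(3) by (intro sum_zeros_le_height[OF z S(1)]) auto
  finally show False using S(2) by simp
qed

abbreviation L where "L A \<equiv> riemann_roch_space \<iota> A"

section \<open>Riemann-Roch spaces\<close>

lemma riemann_roch_space_vge:
  "L A = {z. \<forall>P\<in>places \<iota>. vge P (- Poly_Mapping.lookup A P) z}"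
  unfolding riemann_roch_space_def vge_def by auto

lemma riemann_roch_space_diff:
  "z \<in> L A \<Longrightarrow> w \<in> L A \<Longrightarrow> z - w \<in> L A"
  unfolding riemann_roch_space_vge using vge_diff by blast

lemma riemann_roch_space_0: "0 \<in> L A"
  unfolding riemann_roch_space_vge by (simp add: vge_0)

lemma subspace_riemann_roch_space: "module.subspace (scale_by \<iota>) (L A)"
proof -
  interpret vector_space "scale_by \<iota>" by (rule vector_space_scale_by[OF emb])
  show ?thesis
  proof (rule subspaceI)
    show "0 \<in> L A" by (rule riemann_roch_space_0)
    show "x + y \<in> L A" if "x \<in> L A" "y \<in> L A" for x y
      using that vge_add unfolding riemann_roch_space_vge by blast
    show "scale_by \<iota> c x \<in> L A" if x: "x \<in> L A" for c x
    proof (cases "c = 0")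
      case True
      then show ?thesis using riemann_roch_space_0 by (simp add: scale_by_def field_embedding_0[OF emb])
    next
      case False
      have "vge P (- Poly_Mapping.lookup A P) (\<iota> c * x)" if P: "P \<in> places \<iota>" for P
        using vge_mult[OF P, of 0 "\<iota> c" "- Poly_Mapping.lookup A P" x] const_val[OF P False] x P
        unfolding riemann_roch_space_vge by (auto simp: vge_def)
      then show ?thesis unfolding riemann_roch_space_vge scale_by_def by blast
    qed
  qed
qed

lemma card_riemann_roch_space:
  "finite (L A) \<Longrightarrow> card (L A) = CARD('k) ^ ell \<iota> A"
  unfolding ell_def
  by (rule card_finite_subspace[OF vector_space_scale_by[OF emb] subspace_riemann_roch_space])

text \<open>
  Map a function in \<open>L(A + P)\<close> to its leading coefficient at \<open>P\<close>. Functions with the same leading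
  coefficient differ by an element of \<open>L(A)\<close>.
\<close>
lemma riemann_roch_space_add_place:
  assumes P: "P \<in> places \<iota>" and fin: "finite (L A)"
  shows "finite (L (A + Poly_Mapping.single P 1)) \<and>
    card (L (A + Poly_Mapping.single P 1))
      \<le> card (L A) * CARD('k) ^ place_degree \<iota> P"
proof -
  let ?A' = "A + Poly_Mapping.single P 1"
  obtain R where R: "finite R" "card R = CARD('k) ^ place_degree \<iota> P"
    "\<forall>z\<in>place_ring P. \<exists>w\<in>R. z - w \<in> P" using place_reps[OF P] by auto
  obtain t where t: "uniformizer P t" using ex_uniformizer[OF P] by blast
  have t0: "t \<noteq> 0" using t unfolding uniformizer_def by blast
  define a where "a = Poly_Mapping.lookup A P + 1"
  have va: "place_val P (t powi (- a)) = - a" using place_val_powi[OF P t0] place_val_uniformizer[OF P t] by simp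
  have ta: "t powi (- a) \<noteq> 0" using t0 by simp
  define \<phi> where "\<phi> z = (SOME w. w \<in> R \<and> z / t powi (- a) - w \<in> P)" for z
  have \<phi>: "\<phi> z \<in> R \<and> z / t powi (- a) - \<phi> z \<in> P" if z: "z \<in> L ?A'" for z
  proof -
    have "vge P (- a) z" using z P unfolding riemann_roch_space_vge a_def by (auto simp: lookup_add)
    then have "vge P 0 (z / t powi (- a))" using vge_divide[OF P ta] va by simp
    then have "\<exists>w. w \<in> R \<and> z / t powi (- a) - w \<in> P" using R(3) vge_ring[OF P] by blast
    then show ?thesis unfolding \<phi>_def by (rule someI_ex)
  qed
  have "finite (L ?A') \<and> card (L ?A') \<le> card (L A) * card R"
  proof (rule card_le_fibres[OF _ R(1) fin])
    show "\<phi> ` L ?A' \<subseteq> R" using \<phi> by blast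
    fix z w assume zw: "z \<in> L ?A'" "w \<in> L ?A'" "\<phi> z = \<phi> w"
    have "(z / t powi (- a) - \<phi> z) - (w / t powi (- a) - \<phi> w) \<in> P"
      using \<phi>[OF zw(1)] \<phi>[OF zw(2)] place.place_diff[OF place[OF P]] by blast
    then have "(z - w) / t powi (- a) \<in> P" using zw(3) by (simp add: diff_divide_distrib)
    then have vP: "vge P (1 - a) (z - w)" using vge_divide[OF P ta, of 1 "z - w"] va vge_place[OF P] by simp
    have "vge Q (- Poly_Mapping.lookup A Q) (z - w)" if Q: "Q \<in> places \<iota>" for Q
    proof (cases "Q = P")
      case True then show ?thesis using vP unfolding a_def by simp
    next
      case False
      then have "Poly_Mapping.lookup ?A' Q = Poly_Mapping.lookup A Q" by (simp add: lookup_add lookup_single)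
      then show ?thesis using riemann_roch_space_diff[OF zw(1,2)] Q unfolding riemann_roch_space_vge by auto
    qed
    then show "z - w \<in> L A" unfolding riemann_roch_space_vge by blast
  qed
  then show ?thesis unfolding R(2) .
qed

lemma riemann_roch_space_add_places:
  assumes P: "P \<in> places \<iota>" and fin: "finite (L A)"
  shows "finite (L (A + Poly_Mapping.single P (int j))) \<and>
    card (L (A + Poly_Mapping.single P (int j)))
      \<le> card (L A) * CARD('k) ^ (j * place_degree \<iota> P)"
proof (induction j)
  case 0 then show ?case using fin by simp
next
  case (Suc j)
  have eq: "A + Poly_Mapping.single P (int (Suc j)) = A + Poly_Mapping.single P (int j) + Poly_Mapping.single P 1"
    by (simp add: add.assoc add.commute flip: single_add)
  have *: "finite (L (A + Poly_Mapping.single P (int (Suc j)))) \<and>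
    card (L (A + Poly_Mapping.single P (int (Suc j))))
      \<le> card (L (A + Poly_Mapping.single P (int j))) * CARD('k) ^ place_degree \<iota> P"
    unfolding eq using riemann_roch_space_add_place[OF P] Suc by blast
  note conjunct2[OF this]
  also have "card (L (A + Poly_Mapping.single P (int j))) * CARD('k) ^ place_degree \<iota> P
     \<le> (card (L A) * CARD('k) ^ (j * place_degree \<iota> P)) * CARD('k) ^ place_degree \<iota> P"
    using Suc by (intro mult_right_mono) auto
  finally show ?case using * by (simp add: power_add mult_ac)
qed

lemma riemann_roch_space_add_effective:
  assumes S: "finite S" "S \<subseteq> places \<iota>" and fin: "finite (L A)"
  shows "finite (L (A + (\<Sum>P\<in>S. Poly_Mapping.single P (int (f P))))) \<and>
    card (L (A + (\<Sum>P\<in>S. Poly_Mapping.single P (int (f P)))))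
      \<le> card (L A) * CARD('k) ^ (\<Sum>P\<in>S. f P * place_degree \<iota> P)"
  using S
proof (induction S rule: finite_induct)
  case empty then show ?case using fin by simp
next
  case (insert P S)
  let ?B = "A + (\<Sum>P\<in>S. Poly_Mapping.single P (int (f P)))"
  have P: "P \<in> places \<iota>" using insert by blast
  have IH: "finite (L ?B)"
    "card (L ?B) \<le> card (L A) * CARD('k) ^ (\<Sum>P\<in>S. f P * place_degree \<iota> P)"
    using insert by auto
  have eq: "A + (\<Sum>P\<in>insert P S. Poly_Mapping.single P (int (f P))) = ?B + Poly_Mapping.single P (int (f P))"
    using insert.hyps by (simp add: add_ac)
  have 1: "finite (L (?B + Poly_Mapping.single P (int (f P))))"
    "card (L (?B + Poly_Mapping.single P (int (f P))))
      \<le> card (L ?B) * CARD('k) ^ (f P * place_degree \<iota> P)"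
    using riemann_roch_space_add_places[OF P IH(1)] by auto
  note 1(2)
  also have "card (L ?B) * CARD('k) ^ (f P * place_degree \<iota> P)
    \<le> (card (L A) * CARD('k) ^ (\<Sum>P\<in>S. f P * place_degree \<iota> P)) * CARD('k) ^ (f P * place_degree \<iota> P)"
    using IH(2) by (rule mult_right_mono) simp
  finally show ?case unfolding eq using 1(1) insert.hyps by (simp add: power_add mult_ac)
qed

lemma divisor_degree_superset:
  assumes "finite S" "Poly_Mapping.keys A \<subseteq> S"
  shows "divisor_degree \<iota> A = (\<Sum>P\<in>S. Poly_Mapping.lookup A P * int (place_degree \<iota> P))"
  unfolding divisor_degree_def using assms
  by (intro sum.mono_neutral_left) (auto simp: in_keys_iff)

lemma divisor_degree_add: "divisor_degree \<iota> (A + B) = divisor_degree \<iota> A + divisor_degree \<iota> B"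
proof -
  let ?S = "Poly_Mapping.keys A \<union> Poly_Mapping.keys B"
  have "finite ?S" by simp
  moreover have "Poly_Mapping.keys (A + B) \<subseteq> ?S" by (rule keys_add)
  ultimately show ?thesis
    using divisor_degree_superset[of ?S] by (simp add: lookup_add distrib_right sum.distrib)
qed

lemma divisor_degree_single: "divisor_degree \<iota> (Poly_Mapping.single P k) = k * int (place_degree \<iota> P)"
  using divisor_degree_superset[of "{P}" "Poly_Mapping.single P k"] by (simp add: lookup_single)

lemma divisor_degree_0: "divisor_degree \<iota> 0 = 0"
  by (simp add: divisor_degree_def)

lemma divisor_degree_sum: "divisor_degree \<iota> (sum f S) = (\<Sum>i\<in>S. divisor_degree \<iota> (f i))"
  by (induction S rule: infinite_finite_induct) (simp_all add: divisor_degree_0 divisor_degree_add)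

lemma divisors_add: "A \<in> divisors \<iota> \<Longrightarrow> B \<in> divisors \<iota> \<Longrightarrow> A + B \<in> divisors \<iota>"
  unfolding divisors_def using keys_add[of A B] by auto
lemma divisors_0: "0 \<in> divisors \<iota>" unfolding divisors_def by simp
lemma divisors_single: "P \<in> places \<iota> \<Longrightarrow> Poly_Mapping.single P k \<in> divisors \<iota>"
  unfolding divisors_def by (simp add: keys_single)
lemma divisors_sum: "(\<And>i. i \<in> S \<Longrightarrow> f i \<in> divisors \<iota>) \<Longrightarrow> sum f S \<in> divisors \<iota>"
  by (induction S rule: infinite_finite_induct) (auto intro: divisors_0 divisors_add)

text \<open>
  Passing from \<open>A\<close> to \<open>B\<close> one place at a time, each step raises the dimension by at most the degree of
  the place that is added.
\<close>
lemma riemann_roch_space_mono: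
  assumes A: "A \<in> divisors \<iota>" and B: "B \<in> divisors \<iota>"
    and le: "\<And>P. P \<in> places \<iota> \<Longrightarrow> Poly_Mapping.lookup A P \<le> Poly_Mapping.lookup B P"
    and fin: "finite (L A)"
  shows "finite (L B)"
    and "int (ell \<iota> B) \<le> int (ell \<iota> A) + divisor_degree \<iota> B - divisor_degree \<iota> A"
proof -
  let ?S = "Poly_Mapping.keys A \<union> Poly_Mapping.keys B"
  define f where "f P = nat (Poly_Mapping.lookup B P - Poly_Mapping.lookup A P)" for P
  have S: "finite ?S" "?S \<subseteq> places \<iota>" using A B unfolding divisors_def by auto
  have f: "int (f P) = Poly_Mapping.lookup B P - Poly_Mapping.lookup A P" if "P \<in> ?S" for P
    using le[of P] that S(2) unfolding f_def by auto
  define E where "E = (\<Sum>P\<in>?S. Poly_Mapping.single P (int (f P)))"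
  have BE: "B = A + E"
  proof (rule poly_mapping_eqI)
    fix P
    have "Poly_Mapping.lookup E P = (\<Sum>R\<in>?S. if R = P then int (f R) else 0)"
      unfolding E_def by (simp add: lookup_sum lookup_single when_def)
    also have "\<dots> = (if P \<in> ?S then int (f P) else 0)" using S(1) by (simp add: sum.delta')
    also have "\<dots> = Poly_Mapping.lookup B P - Poly_Mapping.lookup A P"
      using f by (auto simp: in_keys_iff)
    finally show "Poly_Mapping.lookup B P = Poly_Mapping.lookup (A + E) P" by (simp add: lookup_add)
  qed
  have dE: "divisor_degree \<iota> E = int (\<Sum>P\<in>?S. f P * place_degree \<iota> P)"
    unfolding E_def divisor_degree_sum divisor_degree_single by simp
  note * = riemann_roch_space_add_effective[OF S fin, of f, folded E_def, folded BE]
  show fB: "finite (L B)" using * by blast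
  have "CARD('k) ^ ell \<iota> B \<le> CARD('k) ^ ell \<iota> A * CARD('k) ^ (\<Sum>P\<in>?S. f P * place_degree \<iota> P)"
    using * card_riemann_roch_space[OF fin] card_riemann_roch_space[OF fB] by simp
  then have "ell \<iota> B \<le> ell \<iota> A + (\<Sum>P\<in>?S. f P * place_degree \<iota> P)"
    using q_gt_1 by (simp flip: power_add)
  then have "int (ell \<iota> B) \<le> int (ell \<iota> A) + int (\<Sum>P\<in>?S. f P * place_degree \<iota> P)" by linarith
  moreover have "divisor_degree \<iota> B = divisor_degree \<iota> A + divisor_degree \<iota> E"
    by (subst BE) (rule divisor_degree_add)
  ultimately show "int (ell \<iota> B) \<le> int (ell \<iota> A) + divisor_degree \<iota> B - divisor_degree \<iota> A"
    using dE by linarith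
qed

end

section \<open>The basis of a Kummer extension\<close>

text \<open>
  The span of \<open>1, y, \<dots>, y\<^bsup>m-1\<^esup>\<close> over \<open>k(x)\<close> is closed under multiplication because \<open>y\<^sup>m\<close> is in
  \<open>k(x)\<close>, and under inverses because its elements are algebraic. So it is a subfield and contains the
  field generated by \<open>y\<close>.
\<close>
lemma kummer_generates:
  fixes \<kappa> :: "'k::field poly fract \<Rightarrow> 'f::field"
  assumes K: "kummer_function_field \<kappa> y m f" and m: "m \<ge> 1"
  shows "\<exists>c. w = (\<Sum>j<m. \<kappa> (c j) * y ^ j)"
proof -
  have kap: "field_embedding \<kappa>" and ym: "y ^ m = \<kappa> (Fract f 1)" and adj: "adjoin (range \<kappa>) y = UNIV"
    using K unfolding kummer_function_field_def by auto
  interpret L: vector_space "scale_by \<kappa>" by (rule vector_space_scale_by[OF kap])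
  define T where "T = (\<lambda>j. y ^ j) ` {..<m}"
  define K where "K = L.span T"
  have K_sub: "L.subspace K" unfolding K_def by (rule L.subspace_span)
  have Ks: "\<kappa> c * v \<in> K" if "v \<in> K" for c v
    using L.subspace_scale[OF K_sub that, of c] by (simp add: scale_by_def)
  have T: "y ^ j \<in> K" if "j < m" for j unfolding K_def T_def using that by (intro L.span_base) auto
  have one: "1 \<in> K" using T[of 0] m by simp
  have min: "K \<subseteq> S" if "L.subspace S" "T \<subseteq> S" for S unfolding K_def using L.span_minimal[OF that(2,1)] .
  have subspace_mult: "L.subspace {v. u * v \<in> K}" for u
  proof (rule L.subspaceI)
    show "0 \<in> {v. u * v \<in> K}" using L.subspace_0[OF K_sub] by simp
    show "v + w \<in> {v. u * v \<in> K}" if "v \<in> {v. u * v \<in> K}" "w \<in> {v. u * v \<in> K}" for v w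
      using that L.subspace_add[OF K_sub] by (simp add: distrib_left)
    fix c v assume "v \<in> {v. u * v \<in> K}"
    then have "\<kappa> c * (u * v) \<in> K" using Ks by blast
    then show "scale_by \<kappa> c v \<in> {v. u * v \<in> K}" by (simp add: scale_by_def mult.left_commute)
  qed
  have yK: "y * v \<in> K" if "v \<in> K" for v
  proof -
    have "K \<subseteq> {v. y * v \<in> K}"
    proof (rule min[OF subspace_mult], unfold T_def, clarify)
      fix j assume j: "j < m"
      show "y * y ^ j \<in> K"
      proof (cases "Suc j < m")
        case True then show ?thesis using T[of "Suc j"] by simp
      next
        case False
        then have "Suc j = m" using j by simp
        then have "y * y ^ j = \<kappa> (Fract f 1) * 1" using ym by (metis mult.right_neutral power_Suc)
        then show ?thesis using Ks[OF one, of "Fract f 1"] by simp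
      qed
    qed
    then show ?thesis using that by blast
  qed
  have ypow: "y ^ j * v \<in> K" if "v \<in> K" for j v
    by (induction j) (use that yK in \<open>auto simp: mult.assoc\<close>)
  have mult: "u * v \<in> K" if "u \<in> K" "v \<in> K" for u v
  proof -
    have "K \<subseteq> {v. u * v \<in> K}"
      by (rule min[OF subspace_mult], unfold T_def) (use ypow[OF \<open>u \<in> K\<close>] in \<open>auto simp: mult.commute\<close>)
    then show ?thesis using that by blast
  qed
  have pow: "w ^ i \<in> K" if "w \<in> K" for w i
    by (induction i) (use one mult that in auto)
  have sum: "sum g S \<in> K" if "\<And>i. i \<in> S \<Longrightarrow> g i \<in> K" for g and S :: "nat set"
    using that by (rule L.subspace_sum[OF K_sub])
  have inv: "inverse w \<in> K" if w: "w \<in> K" for w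
  proof (cases "w = 0")
    case True then show ?thesis using w by simp
  next
    case False
    have "finite T" unfolding T_def by simp
    moreover have "w ^ i \<in> L.span T" for i using pow[OF w] unfolding K_def .
    ultimately obtain c r where c: "c 0 \<noteq> 0" "(\<Sum>i\<le>r. \<kappa> (c i) * w ^ i) = 0"
      using power_relation[OF kap False] by blast
    have c0: "\<kappa> (c 0) \<noteq> 0" using c(1) by (simp add: field_embedding_eq_0[OF kap])
    then obtain r' where r': "r = Suc r'" using c(2) by (cases r) auto
    define B where "B = (\<Sum>i\<le>r'. \<kappa> (c (Suc i)) * w ^ i)"
    have BK: "B \<in> K" unfolding B_def by (intro sum Ks pow w)
    have "(\<Sum>i\<le>r'. \<kappa> (c (Suc i)) * w ^ Suc i) = w * B"
      unfolding B_def sum_distrib_left by (intro sum.cong) auto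
    then have "\<kappa> (c 0) + w * B = 0" using c(2) unfolding r' sum.atMost_Suc_shift by simp
    then have wB: "w * B = - \<kappa> (c 0)" by (simp add: eq_neg_iff_add_eq_0 add.commute)
    have "w * (\<kappa> (- inverse (c 0)) * B) = \<kappa> (- inverse (c 0)) * (w * B)" by (simp only: mult.left_commute)
    also have "\<dots> = 1" unfolding wB using c0
      by (simp add: field_embedding_minus[OF kap] field_embedding_inverse[OF kap])
    finally have "inverse w = \<kappa> (- inverse (c 0)) * B" by (rule inverse_unique)
    then show ?thesis using Ks[OF BK] by metis
  qed
  have "is_subfield K"
    unfolding is_subfield_def using one mult inv L.subspace_diff[OF K_sub] by blast
  moreover have "range \<kappa> \<subseteq> K" using Ks[OF one] by auto
  moreover have "y \<in> K" using yK[OF one] by simp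
  ultimately have "adjoin (range \<kappa>) y \<subseteq> K" unfolding adjoin_def by blast
  then have wK: "w \<in> K" using adj by blast
  define S where "S = {w. \<exists>c. w = (\<Sum>j<m. \<kappa> (c j) * y ^ j)}"
  have "L.subspace S"
  proof (rule L.subspaceI)
    show "0 \<in> S" unfolding S_def
      by (intro CollectI exI[of _ "\<lambda>_. 0"]) (simp add: field_embedding_0[OF kap])
  next
    fix u v assume "u \<in> S" "v \<in> S"
    then obtain c d where "u = (\<Sum>j<m. \<kappa> (c j) * y ^ j)" "v = (\<Sum>j<m. \<kappa> (d j) * y ^ j)" unfolding S_def by auto
    then have "u + v = (\<Sum>j<m. \<kappa> (c j + d j) * y ^ j)"
      by (simp add: field_embedding_add[OF kap] distrib_right sum.distrib)
    then show "u + v \<in> S" unfolding S_def by (intro CollectI exI[of _ "\<lambda>j. c j + d j"])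
  next
    fix a u assume "u \<in> S"
    then obtain c where "u = (\<Sum>j<m. \<kappa> (c j) * y ^ j)" unfolding S_def by auto
    then have "scale_by \<kappa> a u = (\<Sum>j<m. \<kappa> (a * c j) * y ^ j)"
      by (simp add: scale_by_def field_embedding_mult[OF kap] sum_distrib_left mult.assoc)
    then show "scale_by \<kappa> a u \<in> S" unfolding S_def by (intro CollectI exI[of _ "\<lambda>j. a * c j"])
  qed
  moreover have "T \<subseteq> S"
  proof
    fix v assume "v \<in> T"
    then obtain i where i: "i < m" "v = y ^ i" unfolding T_def by blast
    define c :: "nat \<Rightarrow> 'k poly fract" where "c j = (if j = i then 1 else 0)" for j
    have "(\<Sum>j<m. \<kappa> (c j) * y ^ j) = (\<Sum>j\<in>{i}. \<kappa> (c j) * y ^ j)"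
      using i(1) by (intro sum.mono_neutral_right) (auto simp: c_def field_embedding_0[OF kap])
    also have "\<dots> = v" unfolding i(2) c_def by (simp add: field_embedding_1[OF kap])
    finally show "v \<in> S" unfolding S_def by (intro CollectI exI[of _ c]) simp
  qed
  ultimately have "w \<in> S" using min wK by blast
  then show ?thesis unfolding S_def by blast
qed

context function_field begin

section \<open>Values of polynomials and ramification\<close>

lemma ev_in_range: "ev p \<in> range \<kappa>" unfolding ev_def by blast

lemma ev_linear_ne_0: "ev [:- c, 1:] \<noteq> 0" by (simp add: ev_eq_0)

lemma ev_pCons: "ev (pCons c p) = \<iota> c + ev [:0, 1:] * ev p"
proof -
  have "pCons c p = [:c:] + [:0, 1:] * p" by simp
  then show ?thesis using ev_add ev_mult ev_const by metis
qed

lemma ev_linear: "ev [:c, 1:] = \<iota> c + ev [:0, 1:]"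
  using ev_pCons[of c 1] ev_1 by (simp add: one_pCons)

lemma height_ev: "height (ev p) \<le> degree p"
  by (rule height_le[of 1 _ p]) (auto simp: ev_1)

lemma height_inverse_ev: "p \<noteq> 0 \<Longrightarrow> height (inverse (ev p)) \<le> degree p"
  by (rule height_le[of p _ 1]) (auto simp: ev_1 inverse_eq_divide)

lemma inverse_ev_in_range: "inverse (ev p) \<in> range \<kappa>"
  unfolding ev_def using field_embedding_inverse[OF kap, of "Fract p 1"] by (metis rangeI)

lemma vge_const: "P \<in> places \<iota> \<Longrightarrow> vge P 0 (\<iota> c)"
  using place.const_in_ring[OF place] vge_ring by blast

lemma vge_ev:
  assumes P: "P \<in> places \<iota>" and x: "vge P 0 (ev [:0, 1:])"
  shows "vge P 0 (ev p)"
proof (induction p)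
  case 0 then show ?case by (simp add: ev_0 vge_0)
next
  case (pCons c p)
  then have "vge P (0 + 0) (ev [:0, 1:] * ev p)" by (intro vge_mult[OF P x])
  then have "vge P 0 (\<iota> c + ev [:0, 1:] * ev p)" by (intro vge_add[OF P vge_const[OF P]]) simp
  then show ?case unfolding ev_pCons[of c p] .
qed

text \<open>
  The zeros of \<open>z\<close> have total degree at most \<open>m\<close>. A zero whose order is a multiple of \<open>m\<close> uses up this
  bound, so its order is \<open>m\<close>, its degree is one and there is no other zero.
\<close>
lemma totally_ramified:
  assumes z: "z \<in> range \<kappa>" "z \<noteq> 0" "height z \<le> 1" and P: "P \<in> places \<iota>"
    and pos: "1 \<le> place_val P z" and dvd: "int m dvd place_val P z"
  shows "place_val P z = int m" "place_degree \<iota> P = 1"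
    and "P' \<in> places \<iota> \<Longrightarrow> 1 \<le> place_val P' z \<Longrightarrow> P' = P"
proof -
  have bound: "(\<Sum>P\<in>S. nat (place_val P z) * place_degree \<iota> P) \<le> m"
    if "finite S" "S \<subseteq> places \<iota>" "\<And>P. P \<in> S \<Longrightarrow> 0 \<le> place_val P z" for S
    using sum_zeros_le_height[OF z(1,2) that] mult_le_mono2[OF z(3), of m] by linarith
  have ge: "int m \<le> place_val P z" using dvd pos by (intro zdvd_imp_le) auto
  have d: "1 \<le> place_degree \<iota> P" by (rule place_degree_pos[OF P])
  have le: "nat (place_val P z) * place_degree \<iota> P \<le> m" using bound[of "{P}"] P pos by simp
  have "nat (place_val P z) * 1 \<le> nat (place_val P z) * place_degree \<iota> P" using d by (intro mult_le_mono2)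
  then show v: "place_val P z = int m" using le ge by linarith
  have m0: "0 < m" using pos v by simp
  show d1: "place_degree \<iota> P = 1" using le d m0 v by simp
  show "P' = P" if P': "P' \<in> places \<iota>" "1 \<le> place_val P' z"
  proof (rule ccontr)
    assume "P' \<noteq> P"
    moreover have "0 \<le> place_val R z" if "R \<in> {P', P}" for R using that P'(2) pos by auto
    then have "(\<Sum>R\<in>{P', P}. nat (place_val R z) * place_degree \<iota> R) \<le> m"
      using P P'(1) by (intro bound) auto
    ultimately have "nat (place_val P' z) * place_degree \<iota> P' + m \<le> m" using v d1 by simp
    moreover have "1 * 1 \<le> nat (place_val P' z) * place_degree \<iota> P'"
      using P'(2) place_degree_pos[OF P'(1)] by (intro mult_le_mono) auto
    ultimately show False by simp
  qed
qed

text \<open>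
  A one-element basis \<open>b\<close> of the residue field can be exchanged for \<open>1\<close>, because \<open>1\<close> is a non-zero
  multiple of \<open>b\<close> modulo \<open>P\<close>.
\<close>
lemma residue_constant:
  assumes P: "P \<in> places \<iota>" and d: "place_degree \<iota> P = 1" and z: "z \<in> place_ring P"
  shows "\<exists>!c. z - \<iota> c \<in> P"
proof -
  interpret place \<iota> P by (rule place[OF P])
  obtain B where B: "residue_independent P B" "residue_basis \<iota> P B" using ex_residue_basis[OF P] by blast
  have "card B = 1" using place_degree_eq[OF P B(2)] d by simp
  then obtain b where b: "B = {b}" using card_1_singletonE by metis
  have ex: "\<exists>c. v - \<iota> c * b \<in> P" if v: "v \<in> V" for v
  proof -
    have "\<exists>!c. c \<in> B \<rightarrow>\<^sub>E (UNIV :: 'k set) \<and> v - (\<Sum>b\<in>B. \<iota> (c b) * b) \<in> P"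
      using B(2) v unfolding residue_basis_def by simp
    then obtain c :: "'f \<Rightarrow> 'k" where "v - (\<Sum>b\<in>B. \<iota> (c b) * b) \<in> P" by (elim ex1E conjE)
    then show ?thesis unfolding b by (intro exI[of _ "c b"]) simp
  qed
  obtain c0 where c0: "1 - \<iota> c0 * b \<in> P" using ex[OF ring_1] by blast
  obtain c1 where c1: "z - \<iota> c1 * b \<in> P" using ex[OF z] by blast
  have c0n: "c0 \<noteq> 0" using c0 one_notin_place by (auto simp: field_embedding_0[OF emb])
  have "(z - \<iota> c1 * b) - \<iota> (c1 / c0) * (1 - \<iota> c0 * b) \<in> P"
    by (intro place_diff c1 place_mult' const_in_ring c0)
  also have "(z - \<iota> c1 * b) - \<iota> (c1 / c0) * (1 - \<iota> c0 * b) = z - \<iota> (c1 / c0)"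
    using c0n by (simp add: field_embedding_divide[OF emb] field_embedding_eq_0[OF emb] field_simps)
  finally have zc: "z - \<iota> (c1 / c0) \<in> P" .
  show ?thesis
  proof (rule ex1I[of _ "c1 / c0"])
    show "z - \<iota> (c1 / c0) \<in> P" by (rule zc)
    fix c assume "z - \<iota> c \<in> P"
    then have "(z - \<iota> c) - (z - \<iota> (c1 / c0)) \<in> P" using zc place_diff by blast
    then have "\<iota> (c1 / c0 - c) \<in> P" by (simp add: field_embedding_diff[OF emb])
    then show "c = c1 / c0" using const_in_place by simp
  qed
qed

end

section \<open>Places of the Kummer function field\<close>

locale kummer =
  fixes \<kappa> :: "'k::{field,finite} poly fract \<Rightarrow> 'f::field" and \<iota> :: "'k \<Rightarrow> 'f"
    and y :: 'f and a :: "nat \<Rightarrow> 'k" and m n :: nat and Q :: "nat \<Rightarrow> 'f set"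
  assumes m2: "m \<ge> 2" and n2: "n \<ge> 2" and coprime: "coprime m n" and inj_a: "inj_on a {1..n}"
    and kummer: "kummer_function_field \<kappa> y m (\<Prod>k=1..n. [:- a k, 1:])"
    and iota: "\<iota> = \<kappa> \<circ> rat_const"
    and Q0: "Q 0 \<in> places \<iota>" "lies_over \<kappa> (Q 0) rat_place_infinity"
    and Qk: "\<And>k. k \<in> {1..n} \<Longrightarrow> Q k \<in> places \<iota>" "\<And>k. k \<in> {1..n} \<Longrightarrow> lies_over \<kappa> (Q k) (rat_place (a k))"

sublocale kummer \<subseteq> function_field \<kappa> \<iota> m "\<lambda>j. y ^ j"
proof
  show "field_embedding \<kappa>" using kummer unfolding kummer_function_field_def by blast
  show "\<iota> = \<kappa> \<circ> rat_const" by (rule iota)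
  show "\<exists>c. w = (\<Sum>j<m. \<kappa> (c j) * y ^ j)" for w
    using kummer_generates[OF kummer] m2 by simp
qed

context kummer begin

abbreviation x where "x \<equiv> ev [:0, 1:]"
text \<open>
  The function \<open>x - c\<close>.
\<close>
abbreviation X where "X c \<equiv> ev [:- c, 1:]"

lemma X_eq: "X c = x - \<iota> c"
  using ev_linear[of "- c"] by (simp add: field_embedding_minus[OF emb])

lemma y_power: "y ^ m = (\<Prod>k=1..n. X (a k))"
proof -
  have "y ^ m = ev (\<Prod>k=1..n. [:- a k, 1:])"
    using kummer unfolding kummer_function_field_def ev_def by blast
  then show ?thesis unfolding ev_prod .
qed

lemma y_ne_0: "y \<noteq> 0"
proof -
  have "(\<Prod>k=1..n. X (a k)) \<noteq> 0"
    using ev_linear_ne_0 by (simp only: prod_zero_iff[OF finite_atLeastAtMost]) blast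
  then have "y ^ m \<noteq> 0" unfolding y_power .
  then show ?thesis using m2 by (intro notI) (simp add: power_0_left)
qed

lemma val_y: "P \<in> places \<iota> \<Longrightarrow> int m * place_val P y = (\<Sum>k=1..n. place_val P (X (a k)))"
  using place_val_power[of P y m] y_ne_0 y_power place_val_prod[of P "{1..n}" "\<lambda>k. X (a k)"] ev_linear_ne_0
  by simp

lemma rat_infinity:
  assumes "q \<noteq> 0" "degree p < degree q"
  shows "ev p / ev q \<in> Q 0"
proof -
  have "Fract p q \<in> rat_place_infinity" unfolding rat_place_infinity_def
    using assms by (intro CollectI exI[of _ p] exI[of _ q]) simp
  then have "\<kappa> (Fract p q) \<in> Q 0" using Q0(2) unfolding lies_over_def by blast
  then show ?thesis unfolding kappa_Fract[OF assms(1)] .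
qed

lemma val_infinity_less: "p \<noteq> 0 \<Longrightarrow> degree p < degree q \<Longrightarrow> place_val (Q 0) (ev q) < place_val (Q 0) (ev p)"
proof -
  assume p: "p \<noteq> 0" and d: "degree p < degree q"
  have q: "q \<noteq> 0" using d by auto
  have "ev p / ev q \<noteq> 0" using p q by (simp add: ev_eq_0)
  then have "1 \<le> place_val (Q 0) (ev p / ev q)" using rat_infinity[OF q d] place_iff_val[OF Q0(1)] by blast
  then show ?thesis unfolding divide_inverse
    using p q place_val_mult[OF Q0(1), of "ev p" "inverse (ev q)"] place_val_inverse[OF Q0(1), of "ev q"]
    by (simp add: ev_eq_0)
qed

lemma val_infinity_X_eq: "place_val (Q 0) (X c) = place_val (Q 0) x"
proof -
  have neg: "place_val (Q 0) x < 0"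
    using val_infinity_less[of 1 "[:0, 1:]"] by (simp add: ev_1 place_val_1[OF Q0(1)])
  have "place_val (Q 0) (x + (- \<iota> c)) = place_val (Q 0) x"
    using place_val_add_less[OF Q0(1), of x "- \<iota> c"] neg vge_const[OF Q0(1), of "- c"] vge_mono[of "Q 0" 0]
      ev_eq_0[of "[:0,1:]"] by (simp add: field_embedding_minus[OF emb])
  then show ?thesis by (simp add: X_eq)
qed

text \<open>
  Comparing orders in \<open>y\<^sup>m = f(x)\<close> gives \<open>m v(y) = n v(x)\<close>. As \<open>m\<close> and \<open>n\<close> are coprime, \<open>m\<close> divides
  the order of the zero of \<open>1/x\<close>.
\<close>
lemma infinity:
  shows val_infinity_x: "place_val (Q 0) x = - int m"
    and degree_Q0: "place_degree \<iota> (Q 0) = 1"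
    and infinity_unique: "\<And>P. P \<in> places \<iota> \<Longrightarrow> place_val P x < 0 \<Longrightarrow> P = Q 0"
    and val_infinity_y: "place_val (Q 0) y = - int n"
proof -
  have x0: "x \<noteq> 0" by (simp add: ev_eq_0)
  have vi: "place_val P (inverse x) = - place_val P x" if "P \<in> places \<iota>" for P
    using place_val_inverse[OF that x0] .
  have neg: "place_val (Q 0) x < 0"
    using val_infinity_less[of 1 "[:0, 1:]"] by (simp add: ev_1 place_val_1[OF Q0(1)])
  have my: "int m * place_val (Q 0) y = int n * place_val (Q 0) x"
    using val_y[OF Q0(1)] by (simp add: val_infinity_X_eq)
  then have "int m dvd int n * place_val (Q 0) x" by (metis dvd_triv_left)
  moreover have "coprime (int m) (int n)" using coprime by simp
  ultimately have "int m dvd place_val (Q 0) x" by (metis coprime_dvd_mult_right_iff)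
  then have dvd: "int m dvd place_val (Q 0) (inverse x)" unfolding vi[OF Q0(1)] by simp
  have h: "height (inverse x) \<le> 1" using height_inverse_ev[of "[:0, 1:]"] by simp
  have pos: "1 \<le> place_val (Q 0) (inverse x)" using neg vi[OF Q0(1)] by simp
  have ix: "inverse x \<noteq> 0" using x0 by simp
  note * = totally_ramified[OF inverse_ev_in_range ix h Q0(1) pos dvd]
  show v: "place_val (Q 0) x = - int m" using *(1) vi[OF Q0(1)] by simp
  show "place_degree \<iota> (Q 0) = 1" by (rule *(2))
  show "P = Q 0" if "P \<in> places \<iota>" "place_val P x < 0" for P using *(3)[OF that(1)] that vi by simp
  have "int m * place_val (Q 0) y = int m * (- int n)" using my v by simp
  then show "place_val (Q 0) y = - int n" using m2 by (subst (asm) mult_left_cancel) auto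
qed

lemma val_x_nonneg: "P \<in> places \<iota> \<Longrightarrow> P \<noteq> Q 0 \<Longrightarrow> vge P 0 x"
  using infinity_unique[of P] by (force simp: vge_def)

lemma val_infinity_ev:
  assumes "p \<noteq> 0"
  shows "place_val (Q 0) (ev p) = - (int m * int (degree p))"
  using assms
proof (induction p)
  case 0 then show ?case by simp
next
  case (pCons c p)
  show ?case
  proof (cases "p = 0")
    case True
    then show ?thesis using pCons const_val[OF Q0(1), of c] by (simp add: ev_const)
  next
    case False
    have xp: "x * ev p \<noteq> 0" using False by (simp add: ev_eq_0)
    have v: "place_val (Q 0) (x * ev p) = - int m - int m * int (degree p)"
      using place_val_mult[OF Q0(1), of x "ev p"] pCons.IH[OF False] False val_infinity_x by (simp add: ev_eq_0)
    have "0 \<le> int m * int (degree p)" by simp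
    then have "- int m - int m * int (degree p) + 1 \<le> 0" using m2 by linarith
    then have "place_val (Q 0) (x * ev p + \<iota> c) = - int m - int m * int (degree p)"
      using place_val_add_less[OF Q0(1) xp] vge_const[OF Q0(1), of c] vge_mono unfolding v by blast
    then show ?thesis unfolding ev_pCons[of c p] using False by (simp add: add.commute algebra_simps)
  qed
qed

lemma val_X_shift:
  assumes P: "P \<in> places \<iota>" and "1 \<le> place_val P (X c)" and "d \<noteq> c"
  shows "place_val P (X d) = 0"
proof -
  have "X d = \<iota> (c - d) + X c" unfolding X_eq by (simp add: field_embedding_diff[OF emb])
  moreover have nz: "c - d \<noteq> 0" using assms(3) by simp
  moreover have "\<iota> (c - d) \<noteq> 0" using nz field_embedding_eq_0[OF emb] by blast
  moreover have "place_val P (\<iota> (c - d)) = 0" by (rule const_val[OF P nz])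
  ultimately show ?thesis using place_val_add_less[OF P, of "\<iota> (c - d)" "X c"] assms(2) by (simp add: vge_def)
qed

text \<open>
  Only the factor \<open>x - a\<^sub>k\<close> of \<open>f\<close> vanishes at \<open>Q\<^sub>k\<close>, so \<open>m v(y) = v(x - a\<^sub>k)\<close>.
\<close>
lemma finite_ramified:
  assumes k: "k \<in> {1..n}"
  shows val_X_Q: "place_val (Q k) (X (a k)) = int m"
    and degree_Qk: "place_degree \<iota> (Q k) = 1"
    and Qk_unique: "\<And>P. P \<in> places \<iota> \<Longrightarrow> 1 \<le> place_val P (X (a k)) \<Longrightarrow> P = Q k"
    and val_y_Q: "place_val (Q k) y = 1"
proof -
  note P = Qk(1)[OF k]
  have "Fract [:- a k, 1:] 1 \<in> rat_place (a k)" unfolding rat_place_def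
    by (intro CollectI exI[of _ "[:- a k, 1:]"] exI[of _ 1]) simp
  then have "X (a k) \<in> Q k" using Qk(2)[OF k] unfolding lies_over_def ev_def by blast
  then have pos: "1 \<le> place_val (Q k) (X (a k))" using place_iff_val[OF P ev_linear_ne_0] by blast
  have "(\<Sum>j=1..n. place_val (Q k) (X (a j))) = place_val (Q k) (X (a k)) + (\<Sum>j\<in>{1..n} - {k}. place_val (Q k) (X (a j)))"
    using k by (intro sum.remove) auto
  also have "(\<Sum>j\<in>{1..n} - {k}. place_val (Q k) (X (a j))) = 0"
  proof (rule sum.neutral, rule ballI)
    fix j assume "j \<in> {1..n} - {k}"
    then have "a j \<noteq> a k" using inj_on_eq_iff[OF inj_a, of j k] k by simp
    then show "place_val (Q k) (X (a j)) = 0" by (rule val_X_shift[OF P pos])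
  qed
  finally have my: "int m * place_val (Q k) y = place_val (Q k) (X (a k))" using val_y[OF P] by simp
  then have dvd: "int m dvd place_val (Q k) (X (a k))" by (metis dvd_triv_left)
  have h: "height (X (a k)) \<le> 1" using height_ev[of "[:- a k, 1:]"] by simp
  note * = totally_ramified[OF ev_in_range ev_linear_ne_0 h P pos dvd]
  show v: "place_val (Q k) (X (a k)) = int m" by (rule *(1))
  show "place_degree \<iota> (Q k) = 1" by (rule *(2))
  show "\<And>P. P \<in> places \<iota> \<Longrightarrow> 1 \<le> place_val P (X (a k)) \<Longrightarrow> P = Q k" by (rule *(3))
  show "place_val (Q k) y = 1" using my m2 unfolding v by simp
qed

lemma places_Q: "k \<in> {0..n} \<Longrightarrow> Q k \<in> places \<iota>"
  using Q0(1) Qk(1) by (cases "k = 0") auto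

lemma degree_Q: "k \<in> {0..n} \<Longrightarrow> place_degree \<iota> (Q k) = 1"
  using degree_Q0 degree_Qk by (cases "k = 0") auto

lemma inj_Q: "inj_on Q {0..n}"
proof -
  have Q0k: "Q k \<noteq> Q 0" if "k \<in> {1..n}" for k
    using val_y_Q[OF that] val_infinity_y n2 by auto
  have Qjk: "Q j \<noteq> Q k" if jk: "j \<in> {1..n}" "k \<in> {1..n}" "j \<noteq> k" for j k
  proof
    assume e: "Q j = Q k"
    have "a j \<noteq> a k" using inj_on_eq_iff[OF inj_a jk(1,2)] jk(3) by simp
    then have "place_val (Q j) (X (a k)) = 0"
      using val_X_shift[OF Qk(1)[OF jk(1)], of "a j" "a k"] val_X_Q[OF jk(1)] m2 by fastforce
    then show False using val_X_Q[OF jk(2)] e m2 by simp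
  qed
  show ?thesis
  proof (rule inj_onI, rule ccontr)
    fix j k assume jk: "j \<in> {0..n}" "k \<in> {0..n}" "Q j = Q k" "j \<noteq> k"
    consider "j = 0" "k \<in> {1..n}" | "k = 0" "j \<in> {1..n}" | "j \<in> {1..n}" "k \<in> {1..n}"
      using jk by force
    then show False using Q0k Qjk jk by cases metis+
  qed
qed

lemma val_y_other:
  assumes P: "P \<in> places \<iota>" and "P \<notin> Q ` {0..n}"
  shows "place_val P y = 0"
proof -
  have P0: "P \<noteq> Q 0" using assms(2) by auto
  have "place_val P (X (a k)) = 0" if k: "k \<in> {1..n}" for k
  proof -
    have "vge P 0 (X (a k))" by (rule vge_ev[OF P val_x_nonneg[OF P P0]])
    then have "0 \<le> place_val P (X (a k))" using ev_linear_ne_0 by (simp add: vge_def)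
    moreover have "P \<noteq> Q k" using assms(2) k by auto
    then have "\<not> 1 \<le> place_val P (X (a k))" using Qk_unique[OF k P] by blast
    ultimately show ?thesis by linarith
  qed
  then have "int m * place_val P y = 0" unfolding val_y[OF P] by (intro sum.neutral) blast
  then show ?thesis using m2 by simp
qed

lemma val_y_nonneg: "P \<in> places \<iota> \<Longrightarrow> P \<noteq> Q 0 \<Longrightarrow> 0 \<le> place_val P y"
proof -
  assume P: "P \<in> places \<iota>" "P \<noteq> Q 0"
  show ?thesis
  proof (cases "P \<in> Q ` {0..n}")
    case True
    then obtain k where k: "k \<in> {0..n}" "P = Q k" by blast
    then have "k \<noteq> 0" using P(2) by metis
    then have "k \<in> {1..n}" using k(1) by simp
    then show ?thesis using val_y_Q k(2) by simp
  next
    case False then show ?thesis using val_y_other[OF P(1)] by simp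
  qed
qed

section \<open>Independence of the powers of y\<close>

lemma val_infinity_base: "r \<noteq> 0 \<Longrightarrow> int m dvd place_val (Q 0) (\<kappa> r)"
proof -
  assume r: "r \<noteq> 0"
  obtain u v where uv: "r = Fract u v" "v \<noteq> 0" by (rule fract_cases)
  have u: "u \<noteq> 0" using r uv by (auto simp: Zero_fract_def eq_fract)
  have "\<kappa> r = ev u * inverse (ev v)" unfolding uv(1) kappa_Fract[OF uv(2)] by (simp add: divide_inverse)
  then have "place_val (Q 0) (\<kappa> r) = - (int m * int (degree u)) + int m * int (degree v)"
    using place_val_mult[OF Q0(1), of "ev u" "inverse (ev v)"] place_val_inverse[OF Q0(1), of "ev v"] u uv(2)
    by (simp add: ev_eq_0 val_infinity_ev)
  also have "\<dots> = int m * (int (degree v) - int (degree u))" by (simp add: right_diff_distrib)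
  finally show ?thesis by simp
qed

text \<open>
  At \<open>Q\<^sub>0\<close> the orders of non-zero elements of \<open>k(x)\<close> are multiples of \<open>m\<close> and \<open>y\<^sup>j\<close> has order
  \<open>- n j\<close>. So the terms of the sum have distinct orders and cannot cancel.
\<close>
lemma powers_independent:
  assumes "(\<Sum>j<m. \<kappa> (c j) * y ^ j) = 0"
  shows "\<forall>j<m. c j = 0"
proof (rule ccontr)
  assume neg: "\<not> (\<forall>j<m. c j = 0)"
  define J where "J = {j. j < m \<and> c j \<noteq> 0}"
  define v where "v j = place_val (Q 0) (\<kappa> (c j) * y ^ j)" for j
  have J: "finite J" "J \<noteq> {}" unfolding J_def using neg by auto
  have nz: "\<kappa> (c j) * y ^ j \<noteq> 0" if "j \<in> J" for j
    using that y_ne_0 unfolding J_def by (simp add: field_embedding_eq_0[OF kap])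
  have "inj_on v J"
  proof (rule inj_onI)
    fix i j assume ij: "i \<in> J" "j \<in> J" "v i = v j"
    have vj: "v j = place_val (Q 0) (\<kappa> (c j)) - int n * int j" if "j \<in> J" for j
      using that place_val_mult[OF Q0(1), of "\<kappa> (c j)" "y ^ j"] place_val_power[OF Q0(1) y_ne_0] y_ne_0 val_infinity_y
      unfolding v_def J_def by (simp add: field_embedding_eq_0[OF kap])
    have "int n * (int i - int j) = place_val (Q 0) (\<kappa> (c i)) - place_val (Q 0) (\<kappa> (c j))"
      using vj[OF ij(1)] vj[OF ij(2)] ij(3) by (simp add: right_diff_distrib)
    moreover have "int m dvd place_val (Q 0) (\<kappa> (c i)) - place_val (Q 0) (\<kappa> (c j))"
      using ij val_infinity_base unfolding J_def by (intro dvd_diff) auto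
    ultimately have "int m dvd int n * (int i - int j)" by metis
    then have "int m dvd int i - int j" using coprime by (metis coprime_dvd_mult_right_iff coprime_int_iff)
    moreover have "\<bar>int i - int j\<bar> < int m" using ij unfolding J_def by auto
    ultimately show "i = j" using zdvd_imp_le[of "int m" "\<bar>int i - int j\<bar>"] by (cases "i = j") auto
  qed
  define j where "j = arg_min_on v J"
  have j: "j \<in> J" "\<And>i. i \<in> J \<Longrightarrow> v j \<le> v i"
    unfolding j_def using arg_min_if_finite[OF J, of v] by (auto simp: not_less)
  have "vge (Q 0) (v j + 1) (\<Sum>i\<in>J - {j}. \<kappa> (c i) * y ^ i)"
  proof (rule vge_sum[OF Q0(1)])
    fix i assume i: "i \<in> J - {j}"
    then have "v i \<noteq> v j" using \<open>inj_on v J\<close> j(1) by (auto dest: inj_onD)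
    then have "v j + 1 \<le> v i" using j(2)[of i] i by simp
    then show "vge (Q 0) (v j + 1) (\<kappa> (c i) * y ^ i)" unfolding vge_def v_def by simp
  qed
  then have "\<kappa> (c j) * y ^ j + (\<Sum>i\<in>J - {j}. \<kappa> (c i) * y ^ i) \<noteq> 0"
    using place_val_add_less[OF Q0(1) nz[OF j(1)]] unfolding v_def by blast
  moreover have "(\<Sum>i<m. \<kappa> (c i) * y ^ i) = (\<Sum>i\<in>J. \<kappa> (c i) * y ^ i)"
    by (rule sum.mono_neutral_right) (auto simp: J_def field_embedding_0[OF kap])
  moreover have "\<dots> = \<kappa> (c j) * y ^ j + (\<Sum>i\<in>J - {j}. \<kappa> (c i) * y ^ i)"
    using J(1) j(1) by (rule sum.remove)
  ultimately show False using assms by simp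
qed

lemma extension_degree: "extension_degree \<kappa> = m"
proof -
  interpret L: vector_space "scale_by \<kappa>" by (rule vector_space_scale_by[OF kap])
  let ?T = "(\<lambda>j. y ^ j) ` {..<m}"
  have inj: "inj_on (\<lambda>j. y ^ j) {..<m}"
  proof (rule inj_onI, rule ccontr)
    fix i j assume ij: "i \<in> {..<m}" "j \<in> {..<m}" "y ^ i = y ^ j" "i \<noteq> j"
    have "int i * int n = int j * int n"
      using place_val_power[OF Q0(1) y_ne_0, of i] place_val_power[OF Q0(1) y_ne_0, of j] ij(3) val_infinity_y by auto
    then show False using ij(4) n2 by simp
  qed
  have "L.independent ?T"
  proof (rule L.independent_if_scalars_zero)
    show "finite ?T" by simp
    fix f w assume s: "(\<Sum>v\<in>?T. scale_by \<kappa> (f v) v) = 0" and w: "w \<in> ?T"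
    have "(\<Sum>j<m. \<kappa> (f (y ^ j)) * y ^ j) = 0" using s unfolding sum.reindex[OF inj] by (simp add: scale_by_def)
    then have "\<forall>j<m. f (y ^ j) = 0" by (rule powers_independent)
    then show "f w = 0" using w by auto
  qed
  moreover have "L.span ?T = UNIV"
  proof -
    have "w \<in> L.span ?T" for w
    proof -
      obtain c where c: "w = (\<Sum>j<m. \<kappa> (c j) * y ^ j)" using gen by blast
      have "(\<Sum>j<m. scale_by \<kappa> (c j) (y ^ j)) \<in> L.span ?T"
        by (intro L.span_sum L.span_scale L.span_base) auto
      then show ?thesis using c by (simp add: scale_by_def)
    qed
    then show ?thesis by blast
  qed
  ultimately have "L.dim UNIV = card ?T" using L.dim_eq_card[of ?T UNIV] L.span_UNIV by simp
  then show ?thesis unfolding extension_degree_def card_image[OF inj] by simp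
qed

section \<open>Riemann's inequality\<close>

lemma coords_below_vge: 
  assumes "P \<in> places \<iota>" "P \<noteq> Q 0" "w \<in> coords_below D"
  shows "vge P 0 w"
proof -
  obtain u where u: "w = (\<Sum>j<m. ev (u j) * y ^ j)" using assms(3) unfolding coords_below_def by blast
  have y: "vge P 0 (y ^ j)" for j
    using place_val_power[OF assms(1) y_ne_0] val_y_nonneg[OF assms(1,2)] by (simp add: vge_def)
  show ?thesis unfolding u
    using vge_mult[OF assms(1) vge_ev[OF assms(1) val_x_nonneg[OF assms(1,2)]] y]
    by (intro vge_sum[OF assms(1)]) simp
qed

lemma coords_below_vge_infinity:
  assumes "w \<in> coords_below D"
  shows "vge (Q 0) (- int (m * D + n * m)) w"
proof -
  obtain u where u: "w = (\<Sum>j<m. ev (u j) * y ^ j)" "\<forall>j<m. u j \<in> below D" using assms unfolding coords_below_def by blast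
  have "vge (Q 0) (- int (m * D + n * m)) (ev (u j) * y ^ j)" if j: "j < m" for j
  proof (cases "u j = 0")
    case True then show ?thesis by (simp add: ev_0 vge_0)
  next
    case False
    then have "degree (u j) \<le> D" using u(2) j unfolding below_def by auto
    then have 1: "int m * int (degree (u j)) \<le> int m * int D" by (intro mult_left_mono) auto
    have 2: "int n * int j \<le> int n * int m" using j by (intro mult_left_mono) auto
    have "place_val (Q 0) (ev (u j) * y ^ j) = - (int m * int (degree (u j))) - int n * int j"
      using place_val_mult[OF Q0(1), of "ev (u j)" "y ^ j"] place_val_power[OF Q0(1) y_ne_0] False y_ne_0
        val_infinity_y val_infinity_ev by (simp add: ev_eq_0)
    then show ?thesis using 1 2 unfolding vge_def by simp
  qed
  then show ?thesis unfolding u(1) by (intro vge_sum[OF Q0(1)]) simp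
qed

lemma coords_below_subset: "coords_below D \<subseteq> L (Poly_Mapping.single (Q 0) (int (m * D + n * m)))"
proof
  fix w assume w: "w \<in> coords_below D"
  have "vge P (- Poly_Mapping.lookup (Poly_Mapping.single (Q 0) (int (m * D + n * m))) P) w" if P: "P \<in> places \<iota>" for P
    using coords_below_vge[OF P _ w] coords_below_vge_infinity[OF w] by (cases "P = Q 0") (auto simp: lookup_single)
  then show "w \<in> L (Poly_Mapping.single (Q 0) (int (m * D + n * m)))" unfolding riemann_roch_space_vge by blast
qed

text \<open>
  By independence of the powers of \<open>y\<close>, different coordinates give different elements.
\<close>
lemma card_coords_below_ge: "CARD('k) ^ (m * D) \<le> card (coords_below D)"
proof -
  define F where "F u = (\<Sum>j<m. ev (u j) * y ^ j)" for u
  let ?S = "{..<m} \<rightarrow>\<^sub>E (below D :: 'k poly set)"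
  have inj: "inj_on F ?S"
  proof (rule inj_onI)
    fix u u' assume u: "u \<in> ?S" "u' \<in> ?S" "F u = F u'"
    have "(\<Sum>j<m. \<kappa> (Fract (u j - u' j) 1) * y ^ j) = F u - F u'"
      unfolding F_def ev_def[symmetric] by (simp add: ev_diff left_diff_distrib sum_subtractf)
    then have "\<forall>j<m. Fract (u j - u' j) 1 = 0" using u(3) by (intro powers_independent) simp
    then have "\<forall>j<m. u j - u' j = 0" by (simp add: Zero_fract_def eq_fract)
    then show "u = u'" by (intro PiE_ext[OF u(1,2)]) auto
  qed
  have "F ` ?S \<subseteq> coords_below D" unfolding coords_below_def F_def by auto
  then have "card ?S \<le> card (coords_below D)" by (rule card_inj_on_le[OF inj _ card_coords_below(1)])
  then show ?thesis by (simp add: card_PiE card_below mult.commute flip: power_mult)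
qed

lemma single_Q0_divisor: "Poly_Mapping.single (Q 0) c \<in> divisors \<iota>"
  by (rule divisors_single[OF Q0(1)])

text \<open>
  A non-zero function with a zero at \<open>Q\<^sub>0\<close> has a pole.
\<close>
lemma L_negative: "L (Poly_Mapping.single (Q 0) (- 1)) = {0}"
proof -
  interpret place \<iota> "Q 0" by (rule place[OF Q0(1)])
  have "z = 0" if z: "z \<in> L (Poly_Mapping.single (Q 0) (- 1))" for z
  proof (rule ccontr)
    assume z0: "z \<noteq> 0"
    have v: "vge P (- Poly_Mapping.lookup (Poly_Mapping.single (Q 0) (- 1 :: int)) P) z" if "P \<in> places \<iota>" for P
      using z that unfolding riemann_roch_space_vge by blast
    have "z \<in> Q 0" using v[OF Q0(1)] vge_place[OF Q0(1)] by (simp add: lookup_single)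
    then obtain P where P: "P \<in> places \<iota>" "z \<notin> place_ring P" using exists_pole z0 by blast
    have "vge P 0 z" using v[OF P(1)] vge_mono[of P 1 z 0] by (cases "P = Q 0") (auto simp: lookup_single)
    then show False using P vge_ring by blast
  qed
  then show ?thesis using riemann_roch_space_0 by blast
qed

lemma finite_L_infinity: "c \<ge> - 1 \<Longrightarrow> finite (L (Poly_Mapping.single (Q 0) c))"
  by (rule riemann_roch_space_mono(1)[OF single_Q0_divisor[of "- 1"] single_Q0_divisor])
    (auto simp: lookup_single when_def L_negative)

lemma ell_infinity: "m * D \<le> ell \<iota> (Poly_Mapping.single (Q 0) (int (m * D + n * m)))"
proof -
  let ?A = "Poly_Mapping.single (Q 0) (int (m * D + n * m))"
  have fin: "finite (L ?A)" by (rule finite_L_infinity) (rule order_trans[OF _ of_nat_0_le_iff], simp)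
  have "CARD('k) ^ (m * D) \<le> card (L ?A)"
    using card_coords_below_ge[of D] card_mono[OF fin coords_below_subset[of D]] by simp
  then show ?thesis unfolding card_riemann_roch_space[OF fin] using q_gt_1 by simp
qed

text \<open>
  Every place other than \<open>Q 0\<close> contains a polynomial in \<open>x\<close>, namely the numerator of an element of
  \<open>k(x)\<close> that vanishes there.
\<close>
lemma dominating_polynomial:
  assumes "finite S" "S \<subseteq> places \<iota>" "Q 0 \<notin> S"
  shows "\<exists>h. h \<noteq> 0 \<and> (\<forall>P\<in>S. e P \<le> place_val P (ev h))"
  using assms
proof (induction S rule: finite_induct)
  case empty then show ?case by (intro exI[of _ 1]) simp
next
  case (insert P S)
  then obtain h where h: "h \<noteq> 0" "\<And>R. R \<in> S \<Longrightarrow> e R \<le> place_val R (ev h)" by auto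
  have P: "P \<in> places \<iota>" "P \<noteq> Q 0" using insert.prems by auto
  obtain z where z: "z \<in> range \<kappa>" "z \<noteq> 0" "z \<in> P" using base_element_in_place[OF P(1)] by blast
  obtain u v where uv: "z = ev u / ev v" "v \<noteq> 0" using height[OF z(1)] by blast
  have evv: "ev v \<noteq> 0" using uv(2) ev_eq_0 by blast
  have evu: "ev u \<noteq> 0" using uv z(2) by auto
  have nonneg: "0 \<le> place_val R (ev p)" if "R \<in> insert P S" "p \<noteq> 0" for R p
  proof -
    have "R \<in> places \<iota>" "R \<noteq> Q 0" using that(1) insert.prems by auto
    then show ?thesis using vge_ev[OF _ val_x_nonneg, of R p] that(2) by (simp add: vge_def ev_eq_0)
  qed
  have u: "u \<noteq> 0" using evu ev_eq_0 by blast
  have "ev u = z * ev v" using uv(1) evv by simp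
  then have "place_val P (ev u) = place_val P z + place_val P (ev v)"
    using place_val_mult[OF P(1) z(2) evv] by simp
  then have Pu: "1 \<le> place_val P (ev u)"
    using place_iff_val[OF P(1) z(2)] z(3) nonneg[of P v] uv(2) by simp
  define h' where "h' = h * u ^ nat \<bar>e P\<bar>"
  have v': "place_val R (ev h') = place_val R (ev h) + int (nat \<bar>e P\<bar>) * place_val R (ev u)" if "R \<in> insert P S" for R
  proof -
    have "R \<in> places \<iota>" using that insert.prems by blast
    then show ?thesis unfolding h'_def ev_mult ev_power
      using place_val_mult[of R "ev h" "ev u ^ nat \<bar>e P\<bar>"] place_val_power[of R "ev u"] evu h(1) by (simp add: ev_eq_0)
  qed
  have "e R \<le> place_val R (ev h')" if R: "R \<in> insert P S" for R
  proof (cases "R = P")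
    case True
    have "\<bar>e P\<bar> * 1 \<le> \<bar>e P\<bar> * place_val P (ev u)" using Pu by (intro mult_left_mono) auto
    then show ?thesis unfolding v'[OF R] using True nonneg[of P h] h(1) by simp
  next
    case False
    then have "e R \<le> place_val R (ev h)" using h(2) R by blast
    moreover have "0 \<le> int (nat \<bar>e P\<bar>) * place_val R (ev u)" using nonneg[OF R u] by simp
    ultimately show ?thesis unfolding v'[OF R] by linarith
  qed
  moreover have "h' \<noteq> 0" unfolding h'_def using h(1) u by simp
  ultimately show ?case by blast
qed

text \<open>
  The divisor \<open>B\<close>, the sum of \<open>c Q\<^sub>0\<close> and the divisor of a suitable polynomial \<open>h(x)\<close>, lies above
  \<open>A\<close>. Multiplication by \<open>h(x)\<close> identifies \<open>L(B)\<close> with \<open>L(c Q\<^sub>0)\<close>, and the degree of \<open>B\<close> is at most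
  \<open>c\<close> since \<open>h(x)\<close> has at most as many zeros as poles. So the bound for \<open>A\<close> follows from the one for
  \<open>c Q\<^sub>0\<close>.
\<close>
lemma finite_and_bounded:
  assumes A: "A \<in> divisors \<iota>"
  shows "finite (L A)" and "divisor_degree \<iota> A - int (ell \<iota> A) \<le> int (n * m)"
proof -
  let ?lk = "Poly_Mapping.lookup"
  have "finite (Poly_Mapping.keys A - {Q 0})" "Poly_Mapping.keys A - {Q 0} \<subseteq> places \<iota>" "Q 0 \<notin> Poly_Mapping.keys A - {Q 0}"
    using A unfolding divisors_def by auto
  from dominating_polynomial[OF this, of "?lk A"] obtain h where h: "h \<noteq> 0" "\<And>P. P \<in> Poly_Mapping.keys A - {Q 0} \<Longrightarrow> ?lk A P \<le> place_val P (ev h)"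
    by blast
  have evh: "ev h \<noteq> 0" using h(1) ev_eq_0 by blast
  have vh: "0 \<le> place_val P (ev h)" if "P \<in> places \<iota>" "P \<noteq> Q 0" for P
    using vge_ev[OF that(1) val_x_nonneg[OF that], of h] evh by (simp add: vge_def)
  have vh0: "place_val (Q 0) (ev h) = - (int m * int (degree h))" by (rule val_infinity_ev[OF h(1)])
  define Z where "Z = {P \<in> places \<iota>. 1 \<le> place_val P (ev h)}"
  have Z: "finite Z" "Z \<subseteq> places \<iota>" unfolding Z_def using finite_zeros[OF ev_in_range evh] by auto
  have "0 \<le> int m * int (degree h)" by simp
  then have "\<not> 1 \<le> place_val (Q 0) (ev h)" using vh0 by linarith
  then have Q0Z: "Q 0 \<notin> Z" unfolding Z_def by blast
  \<comment> \<open>\<open>D\<close> makes the coefficient of \<open>B\<close> at \<open>Q 0\<close> at least that of \<open>A\<close>.\<close>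
  define D where "D = degree h + nat \<bar>?lk A (Q 0)\<bar>"
  define c where "c = int (m * D + n * m)"
  define B where "B = (\<Sum>P\<in>Z. Poly_Mapping.single P (place_val P (ev h))) + Poly_Mapping.single (Q 0) (c - int m * int (degree h))"
  have lkZ: "?lk (\<Sum>P\<in>Z. Poly_Mapping.single P (place_val P (ev h))) R = (if R \<in> Z then place_val R (ev h) else 0)" for R
  proof -
    have "?lk (\<Sum>P\<in>Z. Poly_Mapping.single P (place_val P (ev h))) R = (\<Sum>P\<in>Z. if P = R then place_val P (ev h) else 0)"
      by (simp add: lookup_sum lookup_single when_def)
    then show ?thesis using Z(1) by (simp add: sum.delta')
  qed
  have lkB: "?lk B P = place_val P (ev h)" if "P \<in> places \<iota>" "P \<noteq> Q 0" for P
    using that vh[OF that] unfolding B_def lookup_add lkZ by (auto simp: lookup_single Z_def when_def)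
  have lkB0: "?lk B (Q 0) = c - int m * int (degree h)"
    unfolding B_def lookup_add lkZ using Q0Z by (simp add: lookup_single)
  have Bdiv: "B \<in> divisors \<iota>"
    unfolding B_def using Z(2) by (intro divisors_add divisors_sum divisors_single Q0(1)) auto
  have AB: "?lk A P \<le> ?lk B P" if P: "P \<in> places \<iota>" for P
  proof (cases "P = Q 0")
    case True
    have "1 * int (nat \<bar>?lk A (Q 0)\<bar>) \<le> int m * int (nat \<bar>?lk A (Q 0)\<bar>)" using m2 by (intro mult_right_mono) auto
    moreover have "c - int m * int (degree h) = int m * int (nat \<bar>?lk A (Q 0)\<bar>) + int (n * m)"
      unfolding c_def D_def by (simp add: algebra_simps)
    moreover have "0 \<le> int (n * m)" by simp
    ultimately have "?lk A (Q 0) \<le> c - int m * int (degree h)" by linarith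
    then show ?thesis unfolding True lkB0 .
  next
    case False
    then show ?thesis using lkB[OF P False] h(2)[of P] vh[OF P False] by (cases "P \<in> Poly_Mapping.keys A") (auto simp: in_keys_iff)
  qed
  have LB: "z \<in> L B \<longleftrightarrow> z * ev h \<in> L (Poly_Mapping.single (Q 0) c)" for z
  proof -
    have "vge P (- ?lk B P) z \<longleftrightarrow> vge P (- ?lk (Poly_Mapping.single (Q 0) c) P) (z * ev h)" if P: "P \<in> places \<iota>" for P
    proof -
      have "vge P (- ?lk B P) z \<longleftrightarrow> vge P (- ?lk B P + place_val P (ev h)) (z * ev h)"
        using vge_divide[OF P evh, of "- ?lk B P" "z * ev h"] evh by simp
      also have "- ?lk B P + place_val P (ev h) = - ?lk (Poly_Mapping.single (Q 0) c) P"
        using lkB[OF P] lkB0 vh0 by (cases "P = Q 0") (auto simp: lookup_single)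
      finally show ?thesis .
    qed
    then show ?thesis unfolding riemann_roch_space_vge by simp
  qed
  have img: "L (Poly_Mapping.single (Q 0) c) = (\<lambda>z. z * ev h) ` L B"
  proof
    show "(\<lambda>z. z * ev h) ` L B \<subseteq> L (Poly_Mapping.single (Q 0) c)" using LB by blast
    show "L (Poly_Mapping.single (Q 0) c) \<subseteq> (\<lambda>z. z * ev h) ` L B"
    proof
      fix w assume w: "w \<in> L (Poly_Mapping.single (Q 0) c)"
      have "w = (w / ev h) * ev h" using evh by simp
      then show "w \<in> (\<lambda>z. z * ev h) ` L B" using LB[of "w / ev h"] w by (intro image_eqI[of w _ "w / ev h"]) auto
    qed
  qed
  have inj: "inj_on (\<lambda>z. z * ev h) (L B)" using evh by (auto simp: inj_on_def)
  have fc: "finite (L (Poly_Mapping.single (Q 0) c))" unfolding c_def by (rule finite_L_infinity) (rule order_trans[OF _ of_nat_0_le_iff], simp)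
  then have fB: "finite (L B)" using finite_imageD inj unfolding img by blast
  have "CARD('k) ^ ell \<iota> (Poly_Mapping.single (Q 0) c) = CARD('k) ^ ell \<iota> B"
    using card_riemann_roch_space[OF fc] card_riemann_roch_space[OF fB] card_image[OF inj] unfolding img by simp
  then have "ell \<iota> (Poly_Mapping.single (Q 0) c) = ell \<iota> B" using q_gt_1 by simp
  then have "m * D \<le> ell \<iota> B" using ell_infinity[of D, folded c_def] by simp
  then have ellB: "int (m * D) \<le> int (ell \<iota> B)" by (simp only: of_nat_le_iff)
  have "L A \<subseteq> L B" unfolding riemann_roch_space_vge using AB vge_mono by fastforce
  then show fA: "finite (L A)" using fB finite_subset by blast
  have "divisor_degree \<iota> B = int (\<Sum>P\<in>Z. nat (place_val P (ev h)) * place_degree \<iota> P) + c - int m * int (degree h)"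
    unfolding B_def divisor_degree_add divisor_degree_sum divisor_degree_single degree_Q0
    by (simp add: Z_def)
  moreover have "(\<Sum>P\<in>Z. nat (place_val P (ev h)) * place_degree \<iota> P) \<le> m * height (ev h)"
    by (rule sum_zeros_le_height[OF ev_in_range evh Z]) (simp add: Z_def)
  then have "(\<Sum>P\<in>Z. nat (place_val P (ev h)) * place_degree \<iota> P) \<le> m * degree h"
    using mult_le_mono2[OF height_ev[of h], of m] by linarith
  then have "int (\<Sum>P\<in>Z. nat (place_val P (ev h)) * place_degree \<iota> P) \<le> int (m * degree h)"
    by (simp only: of_nat_le_iff)
  ultimately have degB: "divisor_degree \<iota> B \<le> c" unfolding of_nat_mult by linarith
  have "int (ell \<iota> B) \<le> int (ell \<iota> A) + divisor_degree \<iota> B - divisor_degree \<iota> A"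
    by (rule riemann_roch_space_mono(2)[OF A Bdiv AB fA])
  then show "divisor_degree \<iota> A - int (ell \<iota> A) \<le> int (n * m)" using degB ellB unfolding c_def of_nat_add by linarith
qed

text \<open>
  By \<open>finite_and_bounded\<close> the set of integers in the definition of the genus is bounded above, so its
  greatest element exists.
\<close>
lemma riemann_inequality:
  assumes A: "A \<in> divisors \<iota>"
  shows "divisor_degree \<iota> A + 1 - genus \<iota> \<le> int (ell \<iota> A)"
proof -
  define S where "S = {divisor_degree \<iota> A - int (ell \<iota> A) + 1 | A. A \<in> divisors \<iota>}"
  have bound: "d \<le> int (n * m) + 1" if "d \<in> S" for d using that finite_and_bounded(2) unfolding S_def by fastforce
  have ne: "divisor_degree \<iota> A - int (ell \<iota> A) + 1 \<in> S" using A unfolding S_def by blast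
  define d0 where "d0 = divisor_degree \<iota> A - int (ell \<iota> A) + 1"
  have "finite {d \<in> S. d0 \<le> d}" by (rule finite_subset[of _ "{d0..int (n * m) + 1}"]) (use bound in auto)
  moreover have "d0 \<in> {d \<in> S. d0 \<le> d}" using ne unfolding d0_def by simp
  ultimately have Max: "Max {d \<in> S. d0 \<le> d} \<in> {d \<in> S. d0 \<le> d}" "\<And>d. d \<in> {d \<in> S. d0 \<le> d} \<Longrightarrow> d \<le> Max {d \<in> S. d0 \<le> d}"
    using Max_in[of "{d \<in> S. d0 \<le> d}"] by (blast, simp)
  have "(GREATEST d. d \<in> S) = Max {d \<in> S. d0 \<le> d}"
  proof (rule Greatest_equality)
    show "Max {d \<in> S. d0 \<le> d} \<in> S" using Max(1) by blast
    fix d assume "d \<in> S"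
    then show "d \<le> Max {d \<in> S. d0 \<le> d}" using Max(1) Max(2)[of d] by (cases "d0 \<le> d") auto
  qed
  moreover have "genus \<iota> = (GREATEST d. d \<in> S)" unfolding genus_def S_def by (rule arg_cong[where f = Greatest]) auto
  ultimately have "d0 \<le> genus \<iota>" using Max(1) by simp
  then show ?thesis unfolding d0_def by simp
qed

end

context function_field begin

section \<open>Evaluation codes\<close>

lemma place_eval_eq:
  assumes P: "P \<in> places \<iota>" and d: "place_degree \<iota> P = 1" and z: "z - \<iota> c \<in> P"
  shows "place_eval \<iota> P z = c"
proof -
  interpret place \<iota> P by (rule place[OF P])
  have "z - \<iota> c + \<iota> c \<in> V" using place_subset[OF z] const_in_ring by (rule ring_add)
  then have "z \<in> V" by simp
  then show ?thesis unfolding place_eval_def using residue_constant[OF P d] z by (simp add: the1_equality)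
qed

lemma place_eval_residue:
  assumes P: "P \<in> places \<iota>" and d: "place_degree \<iota> P = 1" and z: "z \<in> place_ring P"
  shows "z - \<iota> (place_eval \<iota> P z) \<in> P"
  unfolding place_eval_def by (rule theI'[OF residue_constant[OF assms]])

lemma place_eval_diff:
  assumes P: "P \<in> places \<iota>" and d: "place_degree \<iota> P = 1" and z: "z \<in> place_ring P" "w \<in> place_ring P"
  shows "place_eval \<iota> P (z - w) = place_eval \<iota> P z - place_eval \<iota> P w"
proof (rule place_eval_eq[OF P d])
  have "(z - \<iota> (place_eval \<iota> P z)) - (w - \<iota> (place_eval \<iota> P w)) \<in> P"
    using place_eval_residue[OF P d] z place.place_diff[OF place[OF P]] by blast
  then show "z - w - \<iota> (place_eval \<iota> P z - place_eval \<iota> P w) \<in> P"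
    by (simp add: field_embedding_diff[OF emb] algebra_simps)
qed

lemma place_eval_scale:
  assumes P: "P \<in> places \<iota>" and d: "place_degree \<iota> P = 1" and z: "z \<in> place_ring P"
  shows "place_eval \<iota> P (\<iota> c * z) = c * place_eval \<iota> P z"
proof (rule place_eval_eq[OF P d])
  have "\<iota> c * (z - \<iota> (place_eval \<iota> P z)) \<in> P"
    using place_eval_residue[OF P d z] place.place_mult'[OF place[OF P] place.const_in_ring[OF place[OF P]]] by blast
  then show "\<iota> c * z - \<iota> (c * place_eval \<iota> P z) \<in> P"
    by (simp add: field_embedding_mult[OF emb] right_diff_distrib)
qed

text \<open>
  The hypothesis on agreement makes evaluation injective on both spaces and the sum of the two codes
  direct, so \<open>\<ell>(G) + \<ell>(H)\<close> is at most the length. With the reverse inequality the sum is everything.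
\<close>
lemma lcp_of_trivial_agreement:
  fixes R :: "'i::finite \<Rightarrow> 'f set"
  assumes R: "\<And>i. R i \<in> places \<iota>" "\<And>i. place_degree \<iota> (R i) = 1"
    and supp: "\<And>i. Poly_Mapping.lookup G (R i) = 0" "\<And>i. Poly_Mapping.lookup H (R i) = 0"
    and fin: "finite (L G)" "finite (L H)"
    and agree: "\<And>z w. z \<in> L G \<Longrightarrow> w \<in> L H \<Longrightarrow>
      (\<And>i. z - w \<in> R i) \<Longrightarrow> z = 0 \<and> w = 0"
    and count: "CARD('i) \<le> ell \<iota> G + ell \<iota> H"
  shows "linear_complementary_pair (ag_code \<iota> R G) (ag_code \<iota> R H)"
    and "vec.dim (ag_code \<iota> R G) = ell \<iota> G" "vec.dim (ag_code \<iota> R H) = ell \<iota> H"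
    and "ell \<iota> G + ell \<iota> H = CARD('i)"
proof -
  define evaluate :: "'f \<Rightarrow> 'k ^ 'i" where "evaluate z = (\<chi> i. place_eval \<iota> (R i) z)" for z
  have reg: "z \<in> place_ring (R i)" if "z \<in> L A" "Poly_Mapping.lookup A (R i) = 0" for z A i
    using that R(1)[of i] vge_ring[OF R(1)[of i]] unfolding riemann_roch_space_vge by force
  have code: "ag_code \<iota> R A = evaluate ` L A" for A unfolding ag_code_def evaluate_def by blast
  have evaluate_diff: "evaluate (z - w) = evaluate z - evaluate w" if "\<And>i. z \<in> place_ring (R i)" "\<And>i. w \<in> place_ring (R i)" for z w
    unfolding evaluate_def using place_eval_diff[OF R] that by (simp add: vec_eq_iff)
  have evaluate_scale: "evaluate (\<iota> c * z) = c *s evaluate z" if "\<And>i. z \<in> place_ring (R i)" for c z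
    unfolding evaluate_def using place_eval_scale[OF R] that by (simp add: vec_eq_iff)
  have zero: "0 \<in> L A" for A by (rule riemann_roch_space_0)
  have evaluate_eq: "z - w \<in> R i" if "evaluate z = evaluate w" "\<And>i. z \<in> place_ring (R i)" "\<And>i. w \<in> place_ring (R i)" for z w i
  proof -
    have "place_eval \<iota> (R i) z = place_eval \<iota> (R i) w" using that(1) unfolding evaluate_def by (simp add: vec_eq_iff)
    then have "(z - \<iota> (place_eval \<iota> (R i) z)) - (w - \<iota> (place_eval \<iota> (R i) z)) \<in> R i"
      using place_eval_residue[OF R that(2)] place_eval_residue[OF R that(3)] place.place_diff[OF place[OF R(1)]] by metis
    then show ?thesis by simp
  qed
  have sub: "vec.subspace (evaluate ` L A)" if A: "\<And>i. Poly_Mapping.lookup A (R i) = 0" for A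
  proof (rule vec.subspaceI)
    note r = reg[OF _ A]
    have "evaluate (0 - 0) = evaluate 0 - evaluate 0" by (rule evaluate_diff) (use r zero in blast)+
    then have e0: "evaluate 0 = 0" by simp
    then show "0 \<in> evaluate ` L A" using zero by (metis imageI)
    show "u + v \<in> evaluate ` L A" if uv: "u \<in> evaluate ` L A" "v \<in> evaluate ` L A" for u v
    proof -
      obtain z w where zw: "u = evaluate z" "v = evaluate w" "z \<in> L A" "w \<in> L A" using uv by blast
      have mw: "0 - w \<in> L A" using zero zw(4) by (rule riemann_roch_space_diff)
      have "evaluate (0 - w) = - v" using evaluate_diff[of 0 w] r zero zw e0 by simp
      then have "evaluate (z - (0 - w)) = u + v" using evaluate_diff[of z "0 - w"] r zw(3) mw zw(1) by simp
      then show ?thesis using riemann_roch_space_diff[OF zw(3) mw] by (metis imageI)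
    qed
    show "c *s u \<in> evaluate ` L A" if u: "u \<in> evaluate ` L A" for c u
    proof -
      interpret K: vector_space "scale_by \<iota>" by (rule vector_space_scale_by[OF emb])
      obtain z where z: "u = evaluate z" "z \<in> L A" using u by blast
      have "scale_by \<iota> c z \<in> L A" using subspace_riemann_roch_space z(2) by (rule K.subspace_scale)
      moreover have "evaluate (scale_by \<iota> c z) = c *s u" unfolding scale_by_def z(1) using r z(2) by (intro evaluate_scale)
      ultimately show ?thesis by (metis imageI)
    qed
  qed
  note sG = sub[OF supp(1)] and sH = sub[OF supp(2)]
  note rG = reg[OF _ supp(1)] and rH = reg[OF _ supp(2)]
  have injG: "inj_on evaluate (L G)"
  proof (rule inj_onI)
    fix z w assume zw: "z \<in> L G" "w \<in> L G" "evaluate z = evaluate w"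
    have "z - w - 0 \<in> R i" for i using evaluate_eq[OF zw(3) rG[OF zw(1)] rG[OF zw(2)]] by simp
    then have "z - w = 0" using agree[OF riemann_roch_space_diff[OF zw(1,2)] zero] by blast
    then show "z = w" by simp
  qed
  have injH: "inj_on evaluate (L H)"
  proof (rule inj_onI)
    fix z w assume zw: "z \<in> L H" "w \<in> L H" "evaluate z = evaluate w"
    have "0 - (z - w) \<in> R i" for i
      using evaluate_eq[OF zw(3)[symmetric] rH[OF zw(2)] rH[OF zw(1)], of i] by simp
    then have "z - w = 0" using agree[OF zero riemann_roch_space_diff[OF zw(1,2)]] by blast
    then show "z = w" by simp
  qed
  let ?C = "evaluate ` L G" and ?D = "evaluate ` L H"
  have cC: "card ?C = CARD('k) ^ ell \<iota> G" and cD: "card ?D = CARD('k) ^ ell \<iota> H"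
    using card_image[OF injG] card_image[OF injH] card_riemann_roch_space fin by simp_all
  have meet: "?C \<inter> ?D = {0}"
  proof
    show "{0} \<subseteq> ?C \<inter> ?D" using vec.subspace_0[OF sG] vec.subspace_0[OF sH] by blast
    show "?C \<inter> ?D \<subseteq> {0}"
    proof
      fix u assume "u \<in> ?C \<inter> ?D"
      then obtain z w where zw: "u = evaluate z" "z \<in> L G" "u = evaluate w" "w \<in> L H" by blast
      have "z - w \<in> R i" for i
        by (rule evaluate_eq[of z w i]) (use zw rG rH in simp_all)
      then have "z = 0" using agree[OF zw(2,4)] by blast
      moreover have "evaluate (0 - 0) = evaluate 0 - evaluate 0" by (rule evaluate_diff) (use rG zero in blast)+
      ultimately show "u \<in> {0}" using zw(1) by simp
    qed
  qed
  define F where "F = (\<lambda>(c, d). c + d :: 'k ^ 'i)"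
  have inj: "inj_on F (?C \<times> ?D)"
  proof (rule inj_onI, clarsimp simp: F_def)
    fix z w z' w' assume zw: "z \<in> L G" "w \<in> L H"
      "z' \<in> L G" "w' \<in> L H" "evaluate z + evaluate w = evaluate z' + evaluate w'"
    have "evaluate z - evaluate z' \<in> ?C" "evaluate w' - evaluate w \<in> ?D"
      using zw vec.subspace_diff[OF sG] vec.subspace_diff[OF sH] by blast+
    moreover have eq: "evaluate z - evaluate z' = evaluate w' - evaluate w" using zw(5) by (simp add: algebra_simps)
    ultimately have "evaluate z - evaluate z' = 0" using meet by (metis Int_iff singletonD)
    then show "evaluate z = evaluate z' \<and> evaluate w = evaluate w'" using eq by simp
  qed
  have card: "card (F ` (?C \<times> ?D)) = CARD('k) ^ (ell \<iota> G + ell \<iota> H)"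
    unfolding card_image[OF inj] card_cartesian_product cC cD by (simp add: power_add)
  have finU: "finite (UNIV :: ('k ^ 'i) set)" by simp
  have "card (F ` (?C \<times> ?D)) \<le> CARD('k ^ 'i)" by (rule card_mono[OF finU subset_UNIV])
  then have "CARD('k) ^ (ell \<iota> G + ell \<iota> H) \<le> CARD('k) ^ CARD('i)" unfolding card by simp
  then have "ell \<iota> G + ell \<iota> H \<le> CARD('i)" using q_gt_1 by simp
  then show eq: "ell \<iota> G + ell \<iota> H = CARD('i)" using count by simp
  have "F ` (?C \<times> ?D) = UNIV"
    by (rule card_subset_eq[OF finU subset_UNIV]) (simp add: card eq)
  moreover have "F ` (?C \<times> ?D) = {c + d | c d. c \<in> ?C \<and> d \<in> ?D}" unfolding F_def by auto
  ultimately show "linear_complementary_pair (ag_code \<iota> R G) (ag_code \<iota> R H)"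
    unfolding linear_complementary_pair_def code using sG sH meet by simp
  have "card ?C = CARD('k) ^ vec.dim ?C" "card ?D = CARD('k) ^ vec.dim ?D"
    using card_finite_subspace[OF vec.vector_space_axioms sG] card_finite_subspace[OF vec.vector_space_axioms sH] fin by simp_all
  then show "vec.dim (ag_code \<iota> R G) = ell \<iota> G" "vec.dim (ag_code \<iota> R H) = ell \<iota> H"
    unfolding code using cC cD q_gt_1 by simp_all
qed

end

section \<open>Completely split places\<close>

text \<open>
  The rational function field is an extension of itself of degree one, so the general theory also
  describes its own places.
\<close>
lemma function_field_rational:
  "function_field (id :: 'k::{field,finite} poly fract \<Rightarrow> _) rat_const 1 (\<lambda>_. 1)"
proof
  show "field_embedding (id :: 'k poly fract \<Rightarrow> _)" by (simp add: field_embedding_def)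
  show "rat_const = (id :: 'k poly fract \<Rightarrow> _) \<circ> rat_const" by simp
  have one: "{..<1::nat} = {0}" by auto
  show "\<exists>c. w = (\<Sum>j<(1::nat). id (c j) * 1)" for w :: "'k poly fract"
    unfolding one by (intro exI[of _ "\<lambda>_. w"]) simp
qed

lemma rational_place_linear:
  fixes P :: "'k::{field,finite} poly fract set"
  assumes P: "P \<in> rational_places rat_const" and x: "Fract [:0, 1:] 1 \<in> place_ring P"
  shows "\<exists>c. Fract [:- c, 1:] 1 \<in> P"
proof -
  interpret K: function_field "id :: 'k poly fract \<Rightarrow> _" rat_const 1 "\<lambda>_. 1" by (rule function_field_rational)
  have "P \<in> places rat_const" "place_degree rat_const P = 1" using P unfolding rational_places_def by auto
  then obtain c where c: "Fract [:0, 1:] 1 - rat_const c \<in> P" using K.residue_constant x by blast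
  have "Fract [:0, 1:] 1 - rat_const c = Fract [:- c, 1:] 1" by (simp add: rat_const_def)
  then show ?thesis using c by metis
qed

lemma rational_place_unique:
  fixes P P' :: "'k::{field,finite} poly fract set"
  assumes P: "P \<in> places rat_const" "P' \<in> places rat_const" and c: "Fract [:- c, 1:] 1 \<in> P" "Fract [:- c, 1:] 1 \<in> P'"
  shows "P' = P"
proof -
  interpret K: function_field "id :: 'k poly fract \<Rightarrow> _" rat_const 1 "\<lambda>_. 1" by (rule function_field_rational)
  let ?z = "Fract [:- c, 1:] 1 :: 'k poly fract"
  have z: "K.ev [:- c, 1:] = ?z" unfolding K.ev_def by simp
  have h: "K.height ?z \<le> 1" using K.height_ev[of "[:- c, 1:]"] unfolding z by simp
  have nz: "?z \<noteq> 0" using K.ev_linear_ne_0[of c] unfolding z .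
  have v: "1 \<le> place_val P ?z" "1 \<le> place_val P' ?z" using K.place_iff_val nz P c by blast+
  show ?thesis by (rule K.totally_ramified(3)[OF _ nz h P(1) v(1) _ P(2) v(2)]) auto
qed

context kummer begin

text \<open>
  The places above the point \<open>c\<close> of the affine line, as zeros of \<open>x - c\<close>.
\<close>
definition over :: "'k \<Rightarrow> 'f set set" where
  "over c = {S \<in> places \<iota>. 1 \<le> place_val S (X c)}"

lemma disjoint_over: "S \<in> over c \<Longrightarrow> S \<in> over d \<Longrightarrow> c = d"
  using val_X_shift[of S c d] unfolding over_def by (cases "c = d") auto

text \<open>
  There is only one place above infinity, so a completely split rational place is a point \<open>c\<close> of the
  affine line. The zeros of \<open>x - c\<close> have total degree at most
  \<open>m\<close> and at least \<open>m\<close> of them are given, so these are all, and all are simple of degree one.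
\<close>
lemma splits_completely_over:
  assumes P: "P \<in> rational_places rat_const" and split: "splits_completely \<kappa> P"
  shows "\<exists>c. Fract [:- c, 1:] 1 \<in> P \<and> {S \<in> places \<iota>. lies_over \<kappa> S P} = over c \<and> card (over c) = m \<and>
    (\<forall>S\<in>over c. place_val S (X c) = 1 \<and> place_degree \<iota> S = 1)"
proof -
  let ?T = "{S \<in> places \<iota>. lies_over \<kappa> S P}"
  have cardT: "card ?T = m" using split unfolding splits_completely_def extension_degree iota by simp
  have Pp: "P \<in> places rat_const" using P unfolding rational_places_def by blast
  interpret rp: place rat_const P by unfold_locales (rule field_embedding_rat_const, rule Pp)
  have "Fract [:0, 1:] 1 \<in> place_ring P"
  proof (rule ccontr)
    assume "Fract [:0, 1:] 1 \<notin> place_ring P"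
    then have iP: "inverse (Fract [:0, 1:] 1) \<in> P" by (rule rp.not_ring_inverse)
    have "?T \<subseteq> {Q 0}"
    proof
      fix S assume S: "S \<in> ?T"
      then have Sp: "S \<in> places \<iota>" and over: "\<kappa> ` P \<subseteq> S" unfolding lies_over_def by auto
      have x0: "x \<noteq> 0" by (simp add: ev_eq_0)
      have "\<kappa> (inverse (Fract [:0, 1:] 1)) \<in> S" using over iP by blast
      then have "inverse x \<in> S" by (simp only: ev_def field_embedding_inverse[OF kap])
      then have "1 \<le> place_val S (inverse x)" using place_iff_val[OF Sp, of "inverse x"] x0 by simp
      then have "place_val S x < 0" using place_val_inverse[OF Sp x0] by simp
      then show "S \<in> {Q 0}" using infinity_unique[OF Sp] by blast
    qed
    then have "card ?T \<le> card {Q 0}" by (intro card_mono) auto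
    then show False using cardT m2 by simp
  qed
  then obtain c where c: "Fract [:- c, 1:] 1 \<in> P" using rational_place_linear[OF P] by blast
  define w where "w S = nat (place_val S (X c)) * place_degree \<iota> S" for S
  have fin: "finite (over c)" unfolding over_def by (rule finite_zeros[OF ev_in_range ev_linear_ne_0])
  have TS: "?T \<subseteq> over c"
  proof
    fix S assume S: "S \<in> ?T"
    then have "X c \<in> S" using c unfolding lies_over_def ev_def by blast
    then show "S \<in> over c" using S place_iff_val[of S "X c"] ev_linear_ne_0 unfolding over_def by blast
  qed
  have w1: "1 \<le> w S" if "S \<in> over c" for S
  proof -
    have "1 * 1 \<le> nat (place_val S (X c)) * place_degree \<iota> S"
      using that place_degree_pos unfolding over_def by (intro mult_le_mono) auto
    then show ?thesis unfolding w_def by simp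
  qed
  have "(\<Sum>S\<in>over c. w S) \<le> m * height (X c)"
    unfolding w_def using fin by (intro sum_zeros_le_height[OF ev_in_range ev_linear_ne_0]) (auto simp: over_def)
  also have "\<dots> \<le> m * 1" using height_ev[of "[:- c, 1:]"] by (intro mult_le_mono2) simp
  finally have sum_le: "(\<Sum>S\<in>over c. w S) \<le> m" by simp
  have "(\<Sum>S\<in>over c. 1) \<le> (\<Sum>S\<in>over c. w S)" using w1 by (rule sum_mono)
  then have "card (over c) \<le> m" using sum_le by simp
  moreover have "m \<le> card (over c)" using card_mono[OF fin TS] cardT by simp
  ultimately have co: "card (over c) = m" by simp
  have eq: "?T = over c" by (rule card_subset_eq[OF fin TS]) (simp add: cardT co)
  have w_eq: "w S = 1" if S: "S \<in> over c" for S
  proof (rule ccontr)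
    assume "w S \<noteq> 1"
    then have "1 < w S" using w1[OF S] by simp
    then have "(\<Sum>S\<in>over c. 1) < (\<Sum>S\<in>over c. w S)" using w1 S by (intro sum_strict_mono_ex1[OF fin]) auto
    then show False using sum_le co by simp
  qed
  have "place_val S (X c) = 1 \<and> place_degree \<iota> S = 1" if S: "S \<in> over c" for S
    using w_eq[OF S] unfolding w_def by (auto simp: nat_eq_iff2)
  then show ?thesis using c eq co by blast
qed

text \<open>
  The function \<open>h\<close> with divisor \<open>D - N Q\<^sub>0\<close> is the product of the functions \<open>x - b j\<close>, where \<open>b j\<close> is the
  point of the affine line that belongs to \<open>P j\<close>. The branch points do not occur among the \<open>b j\<close>, since
  \<open>x - a\<^sub>k\<close> has a zero of order \<open>m > 1\<close>.
\<close>
lemma evaluation_divisor: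
  fixes P :: "nat \<Rightarrow> 'k poly fract set" and R :: "'i::finite \<Rightarrow> 'f set"
  assumes inj_P: "inj_on P {1..t}"
    and split: "\<forall>j\<in>{1..t}. P j \<in> rational_places rat_const \<and> splits_completely \<kappa> (P j)"
    and bij: "bij_betw R UNIV {S \<in> rational_places \<iota>. \<exists>j\<in>{1..t}. lies_over \<kappa> S (P j)}"
  shows "\<exists>h. h \<noteq> 0 \<and> place_val (Q 0) h = - int CARD('i) \<and>
    (\<forall>i. R i \<in> places \<iota> \<and> place_degree \<iota> (R i) = 1 \<and> place_val (R i) h = 1 \<and> R i \<notin> Q ` {0..n}) \<and>
    (\<forall>S\<in>places \<iota>. S \<noteq> Q 0 \<longrightarrow> S \<notin> range R \<longrightarrow> place_val S h = 0)"
proof -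
  define N where "N = CARD('i)"
  have Pj: "P j \<in> rational_places rat_const" "splits_completely \<kappa> (P j)" if "j \<in> {1..t}" for j
    using split that by auto
  \<comment> \<open>\<open>P j\<close> is the place of the point \<open>b j\<close> of the affine line.\<close>
  obtain b where b: "\<And>j. j \<in> {1..t} \<Longrightarrow> Fract [:- b j, 1:] 1 \<in> P j"
    "\<And>j. j \<in> {1..t} \<Longrightarrow> {S \<in> places \<iota>. lies_over \<kappa> S (P j)} = over (b j)"
    "\<And>j. j \<in> {1..t} \<Longrightarrow> card (over (b j)) = m"
    "\<And>j S. j \<in> {1..t} \<Longrightarrow> S \<in> over (b j) \<Longrightarrow> place_val S (X (b j)) = 1 \<and> place_degree \<iota> S = 1"
  proof -
    have "\<forall>j\<in>{1..t}. \<exists>c. Fract [:- c, 1:] 1 \<in> P j \<and> {S \<in> places \<iota>. lies_over \<kappa> S (P j)} = over c \<and> card (over c) = m \<and>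
      (\<forall>S\<in>over c. place_val S (X c) = 1 \<and> place_degree \<iota> S = 1)"
      using splits_completely_over Pj by blast
    from bchoice[OF this] show ?thesis using that by blast
  qed
  have inj_b: "inj_on b {1..t}"
  proof (rule inj_onI)
    fix i j assume ij: "i \<in> {1..t}" "j \<in> {1..t}" "b i = b j"
    have pl: "P i \<in> places rat_const" "P j \<in> places rat_const" using Pj ij unfolding rational_places_def by auto
    have "P j = P i" by (rule rational_place_unique[OF pl b(1)[OF ij(1)]]) (use b(1)[OF ij(2)] ij(3) in simp)
    then show "i = j" using inj_P ij by (auto dest: inj_onD)
  qed
  \<comment> \<open>The places \<open>R i\<close> are the zeros of \<open>h\<close> below; all of them are simple and of degree one.\<close>
  have R_range: "range R = (\<Union>j\<in>{1..t}. over (b j))"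
  proof -
    have "range R = {S \<in> rational_places \<iota>. \<exists>j\<in>{1..t}. lies_over \<kappa> S (P j)}"
      using bij by (rule bij_betw_imp_surj_on)
    also have "\<dots> = (\<Union>j\<in>{1..t}. over (b j))"
    proof (intro set_eqI iffI)
      fix S assume "S \<in> {S \<in> rational_places \<iota>. \<exists>j\<in>{1..t}. lies_over \<kappa> S (P j)}"
      then obtain j where "j \<in> {1..t}" "S \<in> places \<iota>" "lies_over \<kappa> S (P j)" unfolding rational_places_def by auto
      then show "S \<in> (\<Union>j\<in>{1..t}. over (b j))" using b(2) by blast
    next
      fix S assume "S \<in> (\<Union>j\<in>{1..t}. over (b j))"
      then obtain j where j: "j \<in> {1..t}" "S \<in> over (b j)" by blast
      then have "S \<in> places \<iota>" "lies_over \<kappa> S (P j)" using b(2)[OF j(1)] by auto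
      moreover have "place_degree \<iota> S = 1" using b(4) j by blast
      ultimately show "S \<in> {S \<in> rational_places \<iota>. \<exists>j\<in>{1..t}. lies_over \<kappa> S (P j)}"
        using j(1) unfolding rational_places_def by auto
    qed
    finally show ?thesis .
  qed
  have R_over: "\<exists>j\<in>{1..t}. R i \<in> over (b j)" for i using R_range by blast
  have R_place: "R i \<in> places \<iota>" for i using R_over[of i] unfolding over_def by blast
  have R_deg: "place_degree \<iota> (R i) = 1" for i using R_over[of i] b(4) by blast
  have N_eq: "N = m * t"
  proof -
    have inj_R: "inj R" using bij by (rule bij_betw_imp_inj_on)
    have fin_over: "finite (over (b j))" if "j \<in> {1..t}" for j using b(3)[OF that] m2 by (intro card_ge_0_finite) simp
    have "N = card (range R)" using card_image[OF inj_R] N_def by simp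
    also have "\<dots> = (\<Sum>j\<in>{1..t}. card (over (b j)))"
      unfolding R_range
    proof (intro card_UN_disjoint ballI impI)
      fix i j assume ij: "i \<in> {1..t}" "j \<in> {1..t}" "i \<noteq> j"
      then have "b i \<noteq> b j" using inj_on_eq_iff[OF inj_b] by simp
      then show "over (b i) \<inter> over (b j) = {}" using disjoint_over by blast
    qed (use fin_over in auto)
    also have "\<dots> = m * t" using b(3) by simp
    finally show ?thesis .
  qed
  define h where "h = (\<Prod>j=1..t. X (b j))"
  have h0: "h \<noteq> 0" unfolding h_def using ev_linear_ne_0 by simp
  have val_h: "place_val S h = (\<Sum>j=1..t. place_val S (X (b j)))" if "S \<in> places \<iota>" for S
    unfolding h_def by (rule place_val_prod[OF that ev_linear_ne_0])
  have val_h_Q0: "place_val (Q 0) h = - int N"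
    unfolding val_h[OF Q0(1)] N_eq by (simp add: val_infinity_X_eq val_infinity_x)
  have val_h_R: "place_val (R i) h = 1" for i
  proof -
    obtain j where j: "j \<in> {1..t}" "R i \<in> over (b j)" using R_over by blast
    have "(\<Sum>l=1..t. place_val (R i) (X (b l))) = place_val (R i) (X (b j)) + (\<Sum>l\<in>{1..t} - {j}. place_val (R i) (X (b l)))"
      using j(1) by (intro sum.remove) auto
    also have "(\<Sum>l\<in>{1..t} - {j}. place_val (R i) (X (b l))) = 0"
    proof (rule sum.neutral, rule ballI)
      fix l assume l: "l \<in> {1..t} - {j}"
      then have "b l \<noteq> b j" using inj_b j(1) by (auto dest: inj_onD)
      then show "place_val (R i) (X (b l)) = 0" using val_X_shift[OF R_place] j(2) unfolding over_def by blast
    qed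
    finally show ?thesis using val_h[OF R_place] b(4)[OF j] by simp
  qed
  have val_h_other: "place_val S h = 0" if S: "S \<in> places \<iota>" "S \<noteq> Q 0" "S \<notin> range R" for S
  proof -
    have "place_val S (X (b j)) = 0" if j: "j \<in> {1..t}" for j
    proof -
      have "\<not> 1 \<le> place_val S (X (b j))" using S R_range j unfolding over_def by blast
      moreover have "0 \<le> place_val S (X (b j))"
        using vge_ev[OF S(1) val_x_nonneg[OF S(1,2)], of "[:- b j, 1:]"] ev_linear_ne_0 by (simp add: vge_def)
      ultimately show ?thesis by linarith
    qed
    then show ?thesis unfolding val_h[OF S(1)] by (intro sum.neutral) blast
  qed
  have R_Q: "R i \<noteq> Q k" if k: "k \<in> {0..n}" for i k
  proof
    assume e: "R i = Q k"
    obtain j where j: "j \<in> {1..t}" "R i \<in> over (b j)" using R_over by blast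
    have v: "place_val (Q k) (X (b j)) = 1" using b(4)[OF j] e by simp
    show False
    proof (cases "k = 0")
      case True then show ?thesis using v val_infinity_X_eq val_infinity_x by simp
    next
      case False
      then have k: "k \<in> {1..n}" using that by simp
      show ?thesis
      proof (cases "b j = a k")
        case True then show ?thesis using v val_X_Q[OF k] m2 by simp
      next
        case False
        then have "place_val (Q k) (X (b j)) = 0"
          using val_X_shift[OF Qk(1)[OF k], of "a k" "b j"] val_X_Q[OF k] m2 by simp
        then show ?thesis using v by simp
      qed
    qed
  qed
  show ?thesis
    using h0 val_h_Q0 R_place R_deg val_h_R R_Q val_h_other unfolding N_def
    by (intro exI[of _ h]) auto
qed

end

section \<open>The linear complementary pair\<close>

theorem theorem5p4:
  fixes \<kappa> :: "'k::{field,finite} poly fract \<Rightarrow> 'f::field"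
    and \<iota> :: "'k \<Rightarrow> 'f"
    and y :: 'f
    and a :: "nat \<Rightarrow> 'k"
    and m n t N :: nat
    and g s :: int
    and Q :: "nat \<Rightarrow> 'f set"
    and P :: "nat \<Rightarrow> 'k poly fract set"
    and R :: "'i::finite \<Rightarrow> 'f set"
    and \<alpha> \<beta> :: "nat \<Rightarrow> int"
    and E\<^sub>1 E\<^sub>2 G H :: "'f set \<Rightarrow>\<^sub>0 int"
  assumes "m \<ge> 2" and "n \<ge> 2" and "\<not> CHAR('k) dvd m" and "coprime m n"
    and "inj_on a {1..n}"
    and "kummer_function_field \<kappa> y m (\<Prod>k=1..n. [:- a k, 1:])"
    and "\<iota> = \<kappa> \<circ> rat_const"
    and "g = genus \<iota>" and "g \<ge> 1"
    and "Q 0 \<in> places \<iota>" and "lies_over \<kappa> (Q 0) rat_place_infinity"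
    and "\<forall>k\<in>{1..n}. Q k \<in> places \<iota> \<and> lies_over \<kappa> (Q k) (rat_place (a k))"
    and "inj_on P {1..t}"
    and "\<forall>j\<in>{1..t}. P j \<in> rational_places rat_const \<and> splits_completely \<kappa> (P j)"
    and "N = CARD('i)"
    and "bij_betw R UNIV {S \<in> rational_places \<iota>. \<exists>j\<in>{1..t}. lies_over \<kappa> S (P j)}"
    and "E\<^sub>1 = (\<Sum>k=1..n. Poly_Mapping.single (Q k) (\<alpha> k))"
    and "E\<^sub>2 = (\<Sum>k=0..n-1. Poly_Mapping.single (Q k) (\<beta> k))"
    and "nonspecial \<iota> E\<^sub>1" and "divisor_degree \<iota> E\<^sub>1 = g - 1"
    and "nonspecial \<iota> E\<^sub>2" and "divisor_degree \<iota> E\<^sub>2 = g - 1"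
    and "\<forall>k\<in>{1..n-1}. \<alpha> k - \<beta> k \<le> s"
    and "\<alpha> n \<le> s"
    and "real_of_int s \<le> real_of_int (\<beta> 0 + int N) / real n"
    and "real_of_int (g - 1 + \<beta> 0 - \<alpha> n) / real (n - 1) < real_of_int s"
    and "real_of_int s < real_of_int (int N - g + 1 + \<beta> 0 - \<alpha> n) / real (n - 1)"
    and "G = (\<Sum>k=1..n-1. Poly_Mapping.single (Q k) (\<alpha> k))
             + Poly_Mapping.single (Q n) s
             + Poly_Mapping.single (Q 0) (\<beta> 0 + int N - s * int n)"
    and "H = (\<Sum>k=1..n-1. Poly_Mapping.single (Q k) (s + \<beta> k))
             + Poly_Mapping.single (Q n) (\<alpha> n)"
  shows "linear_complementary_pair (ag_code \<iota> R G) (ag_code \<iota> R H)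
    \<and> linear_code (ag_code \<iota> R G) N (int N - s * (int n - 1) - (\<alpha> n - \<beta> 0))
    \<and> linear_code (ag_code \<iota> R H) N (s * (int n - 1) + \<alpha> n - \<beta> 0)"
proof -
  interpret kummer \<kappa> \<iota> y a m n Q
  proof
    show "2 \<le> m" "2 \<le> n" "coprime m n" "inj_on a {1..n}" by (rule assms(1,2,4,5))+
    show "kummer_function_field \<kappa> y m (\<Prod>k=1..n. [:- a k, 1:])" by (rule assms(6))
    show "\<iota> = \<kappa> \<circ> rat_const" by (rule assms(7))
    show "Q 0 \<in> places \<iota>" "lies_over \<kappa> (Q 0) rat_place_infinity" by (rule assms(10,11))+
    show "Q k \<in> places \<iota>" "lies_over \<kappa> (Q k) (rat_place (a k))" if "k \<in> {1..n}" for k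
      using bspec[OF assms(12) that] by simp_all
  qed
  let ?lk = "Poly_Mapping.lookup"
  obtain h where h: "h \<noteq> 0" "place_val (Q 0) h = - int CARD('i)"
    "\<And>i. R i \<in> places \<iota> \<and> place_degree \<iota> (R i) = 1 \<and> place_val (R i) h = 1 \<and> R i \<notin> Q ` {0..n}"
    "\<And>S. S \<in> places \<iota> \<Longrightarrow> S \<noteq> Q 0 \<Longrightarrow> S \<notin> range R \<Longrightarrow> place_val S h = 0"
    using evaluation_divisor[OF assms(13,14,16)] by auto
  have h0: "h \<noteq> 0" and val_h_Q0: "place_val (Q 0) h = - int N" using h(1,2) assms(15) by simp_all
  have R_place: "R i \<in> places \<iota>" and R_deg: "place_degree \<iota> (R i) = 1" and val_h_R: "place_val (R i) h = 1"
    and R_out: "R i \<notin> Q ` {0..n}" for i using h(3)[of i] by auto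
  note val_h_other = h(4)
  have R_Q: "R i \<noteq> Q k" if "k \<in> {0..n}" for i k using R_out[of i] that by auto
  have n1: "n \<in> {0..n}" "n \<noteq> 0" "{1..n - 1} \<subseteq> {0..n}" "{0..n - 1} \<subseteq> {0..n}" using n2 by auto
  have Q_eq: "Q j = Q k \<longleftrightarrow> j = k" if "j \<in> {0..n}" "k \<in> {0..n}" for j k
    using inj_Q that by (auto dest: inj_onD)
  have lk_sum: "?lk (\<Sum>k\<in>I. Poly_Mapping.single (Q k) (f k)) (Q j) = (if j \<in> I then f j else 0)"
    if "I \<subseteq> {0..n}" "j \<in> {0..n}" for I j and f :: "nat \<Rightarrow> int"
  proof -
    have "finite I" using that(1) by (rule finite_subset) simp
    have "?lk (\<Sum>k\<in>I. Poly_Mapping.single (Q k) (f k)) (Q j) = (\<Sum>k\<in>I. if k = j then f k else 0)"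
      unfolding lookup_sum using that Q_eq by (intro sum.cong) (auto simp: lookup_single when_def)
    then show ?thesis using \<open>finite I\<close> by (simp add: sum.delta')
  qed
  have lk_out: "?lk (\<Sum>k\<in>I. Poly_Mapping.single (Q k) (f k)) S = 0" if "I \<subseteq> {0..n}" "S \<notin> Q ` {0..n}" for I S and f :: "nat \<Rightarrow> int"
    unfolding lookup_sum using that by (intro sum.neutral) (auto simp: lookup_single when_def)
  have lk1: "?lk (Poly_Mapping.single (Q k) c) (Q j) = (if j = k then c else 0)"
    if "k \<in> {0..n}" "j \<in> {0..n}" for j k and c :: int
    using Q_eq that by (auto simp: lookup_single when_def)
  have lk1_out: "?lk (Poly_Mapping.single (Q k) c) S = 0" if "k \<in> {0..n}" "S \<notin> Q ` {0..n}" for k S and c :: int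
    using that by (auto simp: lookup_single when_def)
  \<comment> \<open>Coefficients of \<open>G\<close> and of \<open>H\<close> at the places \<open>Q k\<close>.\<close>
  define gQ where "gQ k = (if k = 0 then \<beta> 0 + int N - s * int n else if k = n then s else \<alpha> k)" for k
  define hQ where "hQ k = (if k = 0 then 0 else if k = n then \<alpha> n else s + \<beta> k)" for k
  have lkG: "?lk G (Q k) = gQ k" if "k \<in> {0..n}" for k
    unfolding assms(28) lookup_add lk_sum[OF n1(3) that] lk1[OF n1(1) that] using that n1(2) lk1[of 0 k]
    by (auto simp: gQ_def)
  have lkH: "?lk H (Q k) = hQ k" if "k \<in> {0..n}" for k
    unfolding assms(29) lookup_add lk_sum[OF n1(3) that] lk1[OF n1(1) that] using that n1(2)
    by (auto simp: hQ_def)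
  have lkE1: "?lk E\<^sub>1 (Q k) = (if k = 0 then 0 else \<alpha> k)" if "k \<in> {0..n}" for k
    unfolding assms(17) using lk_sum[of "{1..n}" k \<alpha>] that by auto
  have lkE2: "?lk E\<^sub>2 (Q k) = (if k = n then 0 else \<beta> k)" if "k \<in> {0..n}" for k
    unfolding assms(18) using lk_sum[OF n1(4) that, of \<beta>] that n1(2) by auto
  have outG: "?lk G S = 0" and outH: "?lk H S = 0" and outE1: "?lk E\<^sub>1 S = 0" and outE2: "?lk E\<^sub>2 S = 0"
    if "S \<notin> Q ` {0..n}" for S
    unfolding assms(17,18,28,29) lookup_add using that n1 lk_out lk1_out by simp_all
  have div: "E\<^sub>1 \<in> divisors \<iota>" "E\<^sub>2 \<in> divisors \<iota>" "G \<in> divisors \<iota>" "H \<in> divisors \<iota>"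
    unfolding assms(17,18,28,29) using places_Q n1
    by (auto intro!: divisors_add divisors_sum divisors_single)
  \<comment> \<open>A non-special divisor of degree \<open>g - 1\<close> has dimension zero.\<close>
  have ell0: "L E = {0}" if E: "nonspecial \<iota> E" "divisor_degree \<iota> E = g - 1" "E \<in> divisors \<iota>" for E
  proof -
    have "ell \<iota> E = 0" using E(1,2) unfolding nonspecial_def assms(8) by simp
    then have "card (L E) = 1" using card_riemann_roch_space[OF finite_and_bounded(1)[OF E(3)]] by simp
    then obtain z where "L E = {z}" by (rule card_1_singletonE)
    then show ?thesis using riemann_roch_space_0[of E] by auto
  qed
  have LE1: "L E\<^sub>1 = {0}" and LE2: "L E\<^sub>2 = {0}"
    using ell0[OF assms(19,20) div(1)] ell0[OF assms(21,22) div(2)] by auto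
  have sn: "s * int n \<le> \<beta> 0 + int N"
  proof -
    have "real_of_int s * real n \<le> real_of_int (\<beta> 0 + int N)" using assms(25) n2 by (simp add: field_simps)
    then have "real_of_int (s * int n) \<le> real_of_int (\<beta> 0 + int N)" by simp
    then show ?thesis by linarith
  qed
  have ab: "\<alpha> k \<le> s + \<beta> k" if "k \<in> {1..n - 1}" for k using assms(23) that by force
  have cases_k: "k = 0 \<or> k = n \<or> k \<in> {1..n - 1}" if "k \<in> {0..n}" for k using that by auto
  have agree: "z = 0 \<and> w = 0" if z: "z \<in> L G" and w: "w \<in> L H" and zw: "\<And>i. z - w \<in> R i" for z w
  proof -
    have vz: "vge S (- ?lk G S) z" and vw: "vge S (- ?lk H S) w" if "S \<in> places \<iota>" for S
      using z w that unfolding riemann_roch_space_vge by auto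
    \<comment> \<open>The divisor of \<open>y\<^sup>s / h\<close> carries the maximum of \<open>G\<close> and \<open>H\<close>, lowered by \<open>D\<close>, to \<open>E\<^sub>2\<close>.\<close>
    define u where "u = (z - w) * (y powi s * inverse h)"
    have f0: "y powi s * inverse h \<noteq> 0" using y_ne_0 h0 by simp
    have vf: "place_val S (y powi s * inverse h) = s * place_val S y - place_val S h" if "S \<in> places \<iota>" for S
      using place_val_mult[OF that, of "y powi s" "inverse h"] place_val_powi[OF that y_ne_0] place_val_inverse[OF that h0] y_ne_0 h0
      by simp
    have vu: "vge S (k + s * place_val S y - place_val S h) u" if "S \<in> places \<iota>" "vge S k (z - w)" for S k
      unfolding u_def using vge_mult[OF that, of "s * place_val S y - place_val S h" "y powi s * inverse h"] vf[OF that(1)]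
      by (simp add: vge_def algebra_simps)
    have "vge S (- ?lk E\<^sub>2 S) u" if S: "S \<in> places \<iota>" for S
    proof (cases "S \<in> Q ` {0..n}")
      case True
      then obtain k where k: "k \<in> {0..n}" "S = Q k" by blast
      \<comment> \<open>At \<open>Q k\<close> a difference has order at least minus the maximum of the two coefficients.\<close>
      have zwk: "vge (Q k) (- c) (z - w)" if "gQ k \<le> c" "hQ k \<le> c" for c
        using vz[OF S] vw[OF S] that lkG[OF k(1)] lkH[OF k(1)] unfolding k(2)
        by (intro vge_diff[OF S[unfolded k(2)]]) (auto intro: vge_mono)
      have valh: "place_val (Q k) h = 0" if "k \<noteq> 0"
        using val_h_other[of "Q k"] S k R_Q[OF k(1)] Q_eq[OF k(1), of 0] that by force
      show ?thesis
      proof (cases "k = 0")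
        case True
        have "vge (Q 0) (- (\<beta> 0 + int N - s * int n)) (z - w)"
          using zwk[of "\<beta> 0 + int N - s * int n"] True sn by (simp add: gQ_def hQ_def)
        then have "vge (Q 0) (- (\<beta> 0 + int N - s * int n) + s * place_val (Q 0) y - place_val (Q 0) h) u"
          by (rule vu[OF Q0(1)])
        then show ?thesis using lkE2[OF k(1)] True k n1(2) by (simp add: val_infinity_y val_h_Q0 algebra_simps)
      next
        case False
        then have k1: "k \<in> {1..n}" using k(1) by simp
        show ?thesis
        proof (cases "k = n")
          case True
          have "vge (Q k) (- s) (z - w)" using zwk[of s] True False assms(24) by (simp add: gQ_def hQ_def)
          then have "vge (Q k) (- s + s * place_val (Q k) y - place_val (Q k) h) u" using vu S k(2) by blast
          then show ?thesis using lkE2[OF k(1)] True k(2) val_y_Q[OF k1] valh[OF False] by simp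
        next
          case nn: False
          then have "k \<in> {1..n - 1}" using k1 by auto
          then have "vge (Q k) (- (s + \<beta> k)) (z - w)"
            using zwk[of "s + \<beta> k"] nn False ab by (simp add: gQ_def hQ_def)
          then have "vge (Q k) (- (s + \<beta> k) + s * place_val (Q k) y - place_val (Q k) h) u" using vu S k(2) by blast
          then show ?thesis using lkE2[OF k(1)] nn k(2) val_y_Q[OF k1] valh[OF False] by simp
        qed
      qed
    next
      case False
      have y0: "place_val S y = 0" by (rule val_y_other[OF S False])
      show ?thesis
      proof (cases "S \<in> range R")
        case True
        then obtain i where i: "S = R i" by blast
        have "vge S 1 (z - w)" using zw[of i] vge_place[OF S] i by simp
        then have "vge S (1 + s * place_val S y - place_val S h) u" by (rule vu[OF S])
        then show ?thesis using y0 val_h_R i outE2[OF False] by simp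
      next
        case nR: False
        have "vge S 0 (z - w)" using vz[OF S] vw[OF S] outG[OF False] outH[OF False] vge_diff[OF S] by simp
        then have "vge S (0 + s * place_val S y - place_val S h) u" by (rule vu[OF S])
        moreover have "S \<noteq> Q 0" using False by auto
        ultimately show ?thesis using y0 val_h_other[OF S _ nR] outE2[OF False] by simp
      qed
    qed
    then have "u \<in> L E\<^sub>2" unfolding riemann_roch_space_vge by blast
    then have "u = 0" using LE2 by blast
    then have "z - w = 0" using f0 mult_eq_0_iff[of "z - w" "y powi s * inverse h"] unfolding u_def by blast
    \<comment> \<open>The minimum of \<open>G\<close> and \<open>H\<close> is \<open>E\<^sub>1\<close>.\<close>
    then have wz: "w = z" by simp
    have "vge S (- ?lk E\<^sub>1 S) z" if S: "S \<in> places \<iota>" for S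
    proof (cases "S \<in> Q ` {0..n}")
      case True
      then obtain k where k: "k \<in> {0..n}" "S = Q k" by blast
      have le: "gQ k \<le> ?lk E\<^sub>1 (Q k) \<or> hQ k \<le> ?lk E\<^sub>1 (Q k)"
        using cases_k[OF k(1)] unfolding lkE1[OF k(1)] by (auto simp: gQ_def hQ_def)
      have "vge (Q k) (- gQ k) z" "vge (Q k) (- hQ k) z"
        using vz[OF S] vw[OF S] lkG[OF k(1)] lkH[OF k(1)] k(2) wz by simp_all
      then show ?thesis using le vge_mono unfolding k(2) by (meson neg_le_iff_le)
    next
      case False
      then show ?thesis using vz[OF S] outG outE1 by simp
    qed
    then have "z \<in> L E\<^sub>1" unfolding riemann_roch_space_vge by blast
    then show ?thesis using LE1 wz by simp
  qed
  have deg_sum: "(\<Sum>k\<in>I. f k * int (place_degree \<iota> (Q k))) = (\<Sum>k\<in>I. f k)"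
    if "I \<subseteq> {0..n}" for I and f :: "nat \<Rightarrow> int"
    using that degree_Q by (intro sum.cong refl) (simp add: subset_iff)
  have degE1: "(\<Sum>k=1..n. \<alpha> k) = g - 1"
    using assms(20) deg_sum[of "{1..n}" \<alpha>] unfolding assms(17) divisor_degree_sum divisor_degree_single by simp
  have degE2: "(\<Sum>k=0..n - 1. \<beta> k) = g - 1"
    using assms(22) unfolding assms(18) divisor_degree_sum divisor_degree_single deg_sum[OF n1(4)] .
  have s1: "(\<Sum>k=1..n. \<alpha> k) = (\<Sum>k=1..n - 1. \<alpha> k) + \<alpha> n" using n2 by (cases n) auto
  have s2: "(\<Sum>k=0..n - 1. \<beta> k) = \<beta> 0 + (\<Sum>k=1..n - 1. \<beta> k)" by (simp add: sum.atLeast_Suc_atMost)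
  have n_int: "int (n - 1) = int n - 1" using n2 by simp
  have degG: "divisor_degree \<iota> G = (\<Sum>k=1..n - 1. \<alpha> k) + s + (\<beta> 0 + int N - s * int n)"
    unfolding assms(28) divisor_degree_add divisor_degree_sum divisor_degree_single deg_sum[OF n1(3)]
    using degree_Q by simp
  have degH: "divisor_degree \<iota> H = (int n - 1) * s + (\<Sum>k=1..n - 1. \<beta> k) + \<alpha> n"
    unfolding assms(29) divisor_degree_add divisor_degree_sum divisor_degree_single deg_sum[OF n1(3)]
    using degree_Q n_int by (simp add: sum.distrib)
  \<comment> \<open>The degrees of \<open>G\<close> and \<open>H\<close> follow from those of \<open>E\<^sub>1\<close> and \<open>E\<^sub>2\<close>, and these lower bounds add up to \<open>N\<close>.\<close>
  have ellG: "int N - s * (int n - 1) - (\<alpha> n - \<beta> 0) \<le> int (ell \<iota> G)"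
    using riemann_inequality[OF div(3)] degG degE1 s1 assms(8) by (simp add: algebra_simps)
  have ellH: "s * (int n - 1) + \<alpha> n - \<beta> 0 \<le> int (ell \<iota> H)"
    using riemann_inequality[OF div(4)] degH degE2 s2 assms(8) by (simp add: algebra_simps)
  have count: "CARD('i) \<le> ell \<iota> G + ell \<iota> H" using ellG ellH assms(15) by linarith
  note rule = lcp_of_trivial_agreement[where R = R, OF R_place R_deg outG[OF R_out] outH[OF R_out]
      finite_and_bounded(1)[OF div(3)] finite_and_bounded(1)[OF div(4)] _ count]
  have lcp: "linear_complementary_pair (ag_code \<iota> R G) (ag_code \<iota> R H)"
    "vec.dim (ag_code \<iota> R G) = ell \<iota> G" "vec.dim (ag_code \<iota> R H) = ell \<iota> H"
    "ell \<iota> G + ell \<iota> H = CARD('i)"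
    by (rule rule; use agree in blast)+
  have "int (ell \<iota> G) = int N - s * (int n - 1) - (\<alpha> n - \<beta> 0)" "int (ell \<iota> H) = s * (int n - 1) + \<alpha> n - \<beta> 0"
    using lcp(4) ellG ellH assms(15) by linarith+
  then show ?thesis
    using lcp(1-3) assms(15) unfolding linear_code_def linear_complementary_pair_def by simp
qed

end
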